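(* Let $n\ge2$ and let $i>j\ge1$ be indices in $\{1,\dots,n\}$. For any $s\ge0$, any $\sigma\in[0,s+1/2)$ and any $\lambda\in\mathbb{R}\setminus\{0\}$, the following holds: for any constant $C>0$ there is $\delta>0$ such that for every $t\in\mathbb{R}$ with $|t|>\delta$ (and each sign $\pm$) there is a smooth vector $g\in\mathrm{Ind}_P^{SL(n,\mathbb{R})}(\lambda_t^\pm)$ and a smooth solution $f\in\mathrm{Ind}_P^{SL(n,\mathbb{R})}(\lambda_t^\pm)$ of $$(\mathfrak{u}_{i,j}+\lambda\sqrt{-1})f=g$$ such that $$\|(I-\mathfrak{u}_{j,i}^2)^{s/2}f\|>C\|g\|_{s+\sigma}.$$
   Context: $\mathfrak{u}_{i,j}\in\mathfrak{sl}(n,\mathbb{R})$ ($i\ne j$) is the matrix with $1$ in entry $(i,j)$ and $0$ elsewhere, acting by the derived (skew-adjoint) representation. $P$ is the maximal parabolic subgroup of $SL(n,\mathbb{R})$ stabilizing the line $\mathbb{R}e_1$, consisting of matrices $\begin{pmatrix}a&v\\0&\mathcal{A}\end{pmatrix}$ ($a\ne0$, $v^\tau\in\mathbb{R}^{n-1}$, $\mathcal{A}\in GL(n-1,\mathbb{R})$); $\lambda_t^\pm$ is its unitary character $\lambda_t^\pm\begin{pmatrix}a&v\\0&\mathcal{A}\end{pmatrix}=\varepsilon^\pm(a)|a|^{t\sqrt{-1}}$ with $\varepsilon^+\equiv1$, $\varepsilon^-(a)=\mathrm{sgn}(a)$; $\mathrm{Ind}_P^{SL(n,\mathbb{R})}(\lambda_t^\pm)$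 is the normalized unitarily induced representation. $\|\cdot\|_r$ is the Sobolev norm with respect to a fixed basis of $\mathfrak{sl}(n,\mathbb{R})$ ($\|v\|_k^2=\|v\|^2+\sum_{m\le k}\sum\|Y_{j_1}\cdots Y_{j_m}v\|^2$, interpolated for non-integer orders); smooth vectors are those of finite Sobolev norm of all orders. *)

theory Defs
  imports "HOL-Analysis.Analysis"
begin

text \<open>The index set {1..n} is rendered by a finite linearly ordered type 'n, n = CARD('n).
  Matrices are real^'n^'n, with entry (k,l) equal to X$k$l.\<close>

definition elem_mat :: "'n::finite \<Rightarrow> 'n \<Rightarrow> real^'n^'n" where
  "elem_mat i j = (\<chi> k l. if k = i \<and> l = j then 1 else 0)"

definition sl_basis :: "(real^'n::finite^'n) set \<Rightarrow> bool" where
  "sl_basis B \<longleftrightarrow> independent B \<and> span B = {X. trace X = 0}"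

definition pd :: "'n::finite \<Rightarrow> (real^'n \<Rightarrow> complex) \<Rightarrow> real^'n \<Rightarrow> complex" where
  "pd k F x = vector_derivative (\<lambda>\<tau>::real. F (x + \<tau> *\<^sub>R axis k 1)) (at 0)"

definition iter_pd :: "'n::finite list \<Rightarrow> (real^'n \<Rightarrow> complex) \<Rightarrow> real^'n \<Rightarrow> complex" where
  "iter_pd ks F = foldr pd ks F"

definition smooth_off0 :: "(real^'n::finite \<Rightarrow> complex) \<Rightarrow> bool" where
  "smooth_off0 F \<longleftrightarrow> (\<forall>ks x. x \<noteq> 0 \<longrightarrow> iter_pd ks F differentiable (at x))"

definition eps_char :: "bool \<Rightarrow> real \<Rightarrow> complex" where
  "eps_char pm a = (if pm then 1 else complex_of_real (sgn a))"

text \<open>Smooth vectors of Ind_P^G(lambda_t^pm) (normalized induction), realized as smooth functions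
  F on R^n minus 0 with F(g e_1) = f(g), so that
  F(a x) = eps(a) |a|^(-n/2 - i t) F(x); the group acts by (pi(g)F)(x) = F(g^{-1} x).
  The value at 0 is normalized to 0.\<close>
definition ind_smooth :: "bool \<Rightarrow> real \<Rightarrow> (real^'n::finite \<Rightarrow> complex) set" where
  "ind_smooth pm t = {F. F 0 = 0 \<and> smooth_off0 F \<and>
     (\<forall>a x. a \<noteq> 0 \<longrightarrow> x \<noteq> 0 \<longrightarrow>
        F (a *\<^sub>R x) = eps_char pm a * complex_of_real (\<bar>a\<bar> powr (- real CARD('n) / 2))
                         * cis (- t * ln \<bar>a\<bar>) * F x)}"

text \<open>Derived (skew-adjoint) action: d/d tau F(exp(-tau X) x) at 0.\<close>
definition dpi :: "real^'n^'n \<Rightarrow> (real^'n::finite \<Rightarrow> complex) \<Rightarrow> real^'n \<Rightarrow> complex" where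
  "dpi X F x = - (\<Sum>k\<in>UNIV. \<Sum>l\<in>UNIV. complex_of_real (X$k$l * x$l) * pd k F x)"

text \<open>Hilbert norm: L^2 norm over the unit sphere, computed as the integral over the annulus
  1 <= |x| <= e (equal to the sphere integral by homogeneity of |F|^2 of degree -n).\<close>
definition L2n :: "(real^'n::finite \<Rightarrow> complex) \<Rightarrow> real" where
  "L2n F = sqrt (integral {x. 1 \<le> norm x \<and> norm x \<le> exp 1} (\<lambda>x. (cmod (F x))\<^sup>2))"

definition act_word :: "(real^'n^'n) list \<Rightarrow> (real^'n::finite \<Rightarrow> complex) \<Rightarrow> real^'n \<Rightarrow> complex" where
  "act_word w F = foldr dpi w F"

definition sob_int :: "(real^'n^'n) set \<Rightarrow> nat \<Rightarrow> (real^'n::finite \<Rightarrow> complex) \<Rightarrow> real" where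
  "sob_int B k F = sqrt ((L2n F)\<^sup>2 +
     (\<Sum>m\<in>{1..k}. \<Sum>w\<in>{w. length w = m \<and> set w \<subseteq> B}. (L2n (act_word w F))\<^sup>2))"

text \<open>Real interpolation (K-method, exponent 2) between consecutive integer orders, normalized so
  that for a Hilbert scale given by a positive operator it reproduces the spectral norm exactly.\<close>
definition interp :: "(real^'n::finite \<Rightarrow> complex) set \<Rightarrow> (nat \<Rightarrow> (real^'n \<Rightarrow> complex) \<Rightarrow> real)
     \<Rightarrow> real \<Rightarrow> (real^'n \<Rightarrow> complex) \<Rightarrow> real" where
  "interp V N r F =
    (let k = nat \<lfloor>r\<rfloor>; \<theta> = r - real k;
         K2 = (\<lambda>\<tau>::real. Inf {(N k v0)\<^sup>2 + \<tau>\<^sup>2 * (N (Suc k) v1)\<^sup>2 | v0 v1.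
                                v0 \<in> V \<and> v1 \<in> V \<and> (\<lambda>x. v0 x + v1 x) = F})
     in if \<theta> = 0 then N k F
        else sqrt (2 * sin (pi * \<theta>) / pi *
               enn2real (\<integral>\<^sup>+ \<tau>. ennreal (indicator {0<..} \<tau> * \<tau> powr (- 2 * \<theta> - 1) * K2 \<tau>) \<partial>lborel)))"

definition sob :: "(real^'n^'n) set \<Rightarrow> bool \<Rightarrow> real \<Rightarrow> real \<Rightarrow> (real^'n::finite \<Rightarrow> complex) \<Rightarrow> real" where
  "sob B pm t r F = interp (ind_smooth pm t) (sob_int B) r F"

text \<open>||(I - U^2)^{k/2} F|| for integer k (U skew-adjoint): sum_m binom(k,m) ||U^m F||^2.\<close>
definition opnorm_int :: "real^'n^'n \<Rightarrow> nat \<Rightarrow> (real^'n::finite \<Rightarrow> complex) \<Rightarrow> real" where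
  "opnorm_int U k F = sqrt (\<Sum>m\<le>k. real (k choose m) * (L2n ((dpi U ^^ m) F))\<^sup>2)"

definition opnorm :: "real^'n^'n \<Rightarrow> bool \<Rightarrow> real \<Rightarrow> real \<Rightarrow> (real^'n::finite \<Rightarrow> complex) \<Rightarrow> real" where
  "opnorm U pm t s F = interp (ind_smooth pm t) (opnorm_int U) s F"

end

theory Submission
  imports Defs
begin

text \<open>In the chart \<open>x\<^sub>j = 1\<close> with coordinate \<open>y = x\<^sub>i / x\<^sub>j\<close>, the equation reads
  \<open>h' - i \<lambda> h = - g\<close>, so a solution is \<open>exp (i \<lambda> y) Q(y)\<close> with \<open>g\<close> proportional to
  \<open>exp (i \<lambda> y) Q'(y)\<close>. Where \<open>Q = 1\<close>, the operator \<open>u\<^sub>j\<^sub>i\<close> acts essentially as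
  multiplication by \<open>i y (t + \<lambda> y)\<close>: this has size \<open>t\<^sup>2\<close> between its zeros \<open>y = 0\<close> and
  \<open>y = \<kappa> = - t / \<lambda>\<close>. We let \<open>Q\<close> rise from 0 to 1 at unit scale near 0 and return to 0
  near \<open>\<kappa>\<close>, where \<open>exp (i \<lambda> y)\<close> is corrected by the phase \<open>\<bar>y\<bar> powr (- i t)\<close>, so that the
  right-hand side is a non-oscillating bump in the chart \<open>x\<^sub>i = 1\<close> dilated by \<open>\<kappa>\<close>. Both pieces
  of \<open>g\<close> then have norm \<open>O(1)\<close> and every Lie algebra element costs one factor \<open>t\<close>, so
  \<open>sob\<^sub>r g = O(t powr r)\<close>; that the second piece has norm \<open>O(1)\<close> is the lower bound \<open>c / sqrt t\<close> for
  an integral with a nondegenerate critical point. Pairing the middle part of \<open>f\<close>, whose norm is of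
  order \<open>sqrt t\<close>, with test functions of the form \<open>u\<^sub>j\<^sub>i\<^sup>k \<psi>\<close> bounds the K-functional from
  below and shows that the left-hand side is at least of order \<open>t powr (2 s + 1/2)\<close>.\<close>

section \<open>Iterated directional derivatives\<close>

text \<open>Infinite y is the hyperplane \<open>x\<^sub>j = 0\<close>, where f has to be smooth.
  This is arranged by letting Q vanish for large y, so \<open>Q'\<close> has integral 0 and the rise
  near 0 must be undone elsewhere. A plain cutoff in z = y / \<kappa> would undo it with a
  \<open>Q'\<close> of norm of order \<open>1 / sqrt t\<close>, but would leave in g the oscillation
  of \<open>exp (i \<lambda> y)\<close> against the multiplier, on which
  \<open>u\<^sub>j\<^sub>i\<close> costs t^2 as it does on f. The phase correction removes that
  oscillation; its price is that the corrected density has an integral of order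
  \<open>1 / sqrt t\<close> instead of 1, and normalizing it costs just the available factor
  \<open>sqrt t\<close>. For non-integer s the left-hand side is an infimum over splittings f = v0 +
  v1, which is why it is bounded by duality: when f is paired with k + 1 letters applied to a test
  function, k of them can be moved to v0 and all of them to v1, and the two costs balance at the
  scale \<bar>\<kappa> t\<bar>. The hypothesis on \<sigma> says that 2 s + 1/2 exceeds s +
  \<sigma>.\<close>

definition dd :: "'a::euclidean_space \<Rightarrow> ('a \<Rightarrow> 'b::real_normed_vector) \<Rightarrow> 'a \<Rightarrow> 'b" where
  "dd b F x = vector_derivative (\<lambda>\<tau>::real. F (x + \<tau> *\<^sub>R b)) (at 0)"

lemma pd_eq_dd: "pd k F = dd (axis k 1) F"
  by (simp add: pd_def dd_def fun_eq_iff)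

text \<open>The recursion strips the derivative that is applied first, so the product and chain
  rules reduce one level to sums and products at the level below. Level 0 is vacuous because
  continuity comes from differentiability one level up, and only the intersection of all levels
  matters.\<close>

fun Ck :: "nat \<Rightarrow> 'a::euclidean_space set \<Rightarrow> ('a \<Rightarrow> 'b::real_normed_vector) \<Rightarrow> bool" where
  "Ck 0 S F \<longleftrightarrow> True"
| "Ck (Suc m) S F \<longleftrightarrow> (\<forall>x\<in>S. F differentiable (at x)) \<and> (\<forall>b\<in>Basis. Ck m S (dd b F))"

definition smooth :: "'a::euclidean_space set \<Rightarrow> ('a \<Rightarrow> 'b::real_normed_vector) \<Rightarrow> bool" where
  "smooth S F \<longleftrightarrow> (\<forall>m. Ck m S F)"

lemma dd_eq:
  assumes "(F has_derivative F') (at x)"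
  shows "dd b F x = F' b"
proof -
  interpret bounded_linear F' using assms by (rule has_derivative_bounded_linear)
  have "((\<lambda>\<tau>::real. x + \<tau> *\<^sub>R b) has_derivative (\<lambda>\<tau>. \<tau> *\<^sub>R b)) (at 0)"
    by (auto intro!: derivative_eq_intros)
  then have "((\<lambda>\<tau>::real. F (x + \<tau> *\<^sub>R b)) has_derivative (\<lambda>\<tau>. F' (\<tau> *\<^sub>R b))) (at 0)"
    using assms by (auto intro: has_derivative_compose)
  then show ?thesis
    unfolding dd_def by (auto intro!: vector_derivative_at simp: has_vector_derivative_def scaleR)
qed

lemma dd_cong:
  assumes "open S" "x \<in> S" "\<And>y. y \<in> S \<Longrightarrow> F y = G y"
  shows "dd b F x = dd b G x"
proof -
  obtain e where e: "e > 0" "ball x e \<subseteq> S" using assms openE by blast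
  have "\<forall>\<^sub>F \<tau> in nhds (0::real). norm (\<tau> *\<^sub>R b) < e"
  proof -
    have "open {\<tau>::real. norm (\<tau> *\<^sub>R b) < e}"
      by (intro open_Collect_less continuous_intros)
    then show ?thesis using e by (auto simp: eventually_nhds)
  qed
  then have "\<forall>\<^sub>F \<tau> in nhds (0::real). F (x + \<tau> *\<^sub>R b) = G (x + \<tau> *\<^sub>R b)"
    by eventually_elim (rule assms, use e in \<open>auto simp: dist_norm subset_iff\<close>)
  then show ?thesis
    unfolding dd_def by (intro vector_derivative_cong_eq) auto
qed

lemma differentiable_cong_open:
  assumes "open S" "x \<in> S" "\<And>y. y \<in> S \<Longrightarrow> F y = G y" "F differentiable (at x)"
  shows "G differentiable (at x)"
  using assms unfolding differentiable_def by (metis has_derivative_transform_within_open)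

lemma Ck_cong:
  assumes "open S" "Ck m S F" "\<And>y. y \<in> S \<Longrightarrow> F y = G y"
  shows "Ck m S G"
  using assms
proof (induction m arbitrary: F G)
  case (Suc m)
  have "G differentiable (at x)" if "x \<in> S" for x
    using differentiable_cong_open[of S x F G] Suc.prems that by auto
  moreover have "Ck m S (dd b G)" if "b \<in> Basis" for b
    by (rule Suc.IH[of "dd b F"]) (use Suc.prems that in \<open>auto intro: dd_cong[of S]\<close>)
  ultimately show ?case by simp
qed auto

lemma Ck_Suc_imp: "Ck (Suc m) S F \<Longrightarrow> Ck m S F"
  by (induction m arbitrary: F) auto

lemma Ck_Un: "Ck m S F \<Longrightarrow> Ck m T F \<Longrightarrow> Ck m (S \<union> T) F"
  by (induction m arbitrary: F) auto

lemma Ck_subset: "Ck m S F \<Longrightarrow> T \<subseteq> S \<Longrightarrow> Ck m T F"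
  by (induction m arbitrary: F) auto

lemma Ck_SucI:
  assumes "open S" "\<And>x. x \<in> S \<Longrightarrow> (F has_derivative F' x) (at x)"
    "\<And>b. b \<in> Basis \<Longrightarrow> Ck m S (\<lambda>x. F' x b)"
  shows "Ck (Suc m) S F"
proof -
  have "Ck m S (dd b F)" if "b \<in> Basis" for b
    by (rule Ck_cong[OF assms(1) assms(3)[OF that]]) (simp add: dd_eq[OF assms(2)])
  then show ?thesis using assms(2) by (auto simp: differentiable_def)
qed

lemma Ck_const: "Ck m S (\<lambda>x. c)"
proof (induction m arbitrary: c)
  case (Suc m)
  have "dd b (\<lambda>x. c) = (\<lambda>x. 0)" for b :: 'a
    by (auto simp: dd_def fun_eq_iff)
  then show ?case using Suc by simp
qed auto

lemma Ck_has_derivative: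
  assumes "Ck (Suc m) S F" "x \<in> S"
  obtains F' where "(F has_derivative F') (at x)" "\<And>b. F' b = dd b F x"
  using assms dd_eq by (force simp: differentiable_def)

lemma Ck_bounded_linear:
  assumes "bounded_linear L" "open S" "Ck m S F"
  shows "Ck m S (\<lambda>x. L (F x))"
  using assms(3)
proof (induction m arbitrary: F)
  case (Suc m)
  show ?case
  proof (rule Ck_SucI[OF assms(2), where F' = "\<lambda>x b. L (dd b F x)"])
    fix x assume "x \<in> S"
    then obtain F' where F': "(F has_derivative F') (at x)" "\<And>b. F' b = dd b F x"
      using Ck_has_derivative[OF Suc.prems] by blast
    show "((\<lambda>x. L (F x)) has_derivative (\<lambda>b. L (dd b F x))) (at x)"
      using bounded_linear.has_derivative[OF assms(1) F'(1)] F'(2) by simp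
  qed (use Suc in auto)
qed auto

lemma Ck_linear_fun:
  assumes "bounded_linear L"
  shows "Ck m S L"
proof (cases m)
  case (Suc n)
  have "(L has_derivative L) (at x)" for x using assms by (rule bounded_linear_imp_has_derivative)
  then have "dd b L = (\<lambda>x. L b)" for b by (auto simp: dd_eq)
  then show ?thesis using Suc Ck_const assms bounded_linear_imp_differentiable by force
qed auto

lemma Ck_add:
  assumes "open S" "Ck m S F" "Ck m S G"
  shows "Ck m S (\<lambda>x. F x + G x)"
  using assms(2,3)
proof (induction m arbitrary: F G)
  case (Suc m)
  show ?case
  proof (rule Ck_SucI[OF assms(1), where F' = "\<lambda>x b. dd b F x + dd b G x"])
    fix x assume "x \<in> S"
    then obtain F' G' where F': "(F has_derivative F') (at x)" "\<And>b. F' b = dd b F x"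
      and G': "(G has_derivative G') (at x)" "\<And>b. G' b = dd b G x"
      using Ck_has_derivative Suc.prems by metis
    show "((\<lambda>x. F x + G x) has_derivative (\<lambda>b. dd b F x + dd b G x)) (at x)"
      using has_derivative_add[OF F'(1) G'(1)] F'(2) G'(2) by simp
  qed (use Suc in auto)
qed auto

lemma Ck_mult:
  fixes F G :: "'a::euclidean_space \<Rightarrow> 'b::real_normed_algebra"
  assumes "open S" "Ck m S F" "Ck m S G"
  shows "Ck m S (\<lambda>x. F x * G x)"
  using assms(2,3)
proof (induction m arbitrary: F G)
  case (Suc m)
  show ?case
  proof (rule Ck_SucI[OF assms(1), where F' = "\<lambda>x b. F x * dd b G x + dd b F x * G x"])
    fix x assume "x \<in> S"
    then obtain F' G' where F': "(F has_derivative F') (at x)" "\<And>b. F' b = dd b F x"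
      and G': "(G has_derivative G') (at x)" "\<And>b. G' b = dd b G x"
      using Ck_has_derivative Suc.prems by metis
    show "((\<lambda>x. F x * G x) has_derivative (\<lambda>b. F x * dd b G x + dd b F x * G x)) (at x)"
      using has_derivative_mult[OF F'(1) G'(1)] F'(2) G'(2) by simp
  next
    fix b :: 'a assume "b \<in> Basis"
    then show "Ck m S (\<lambda>x. F x * dd b G x + dd b F x * G x)"
      using Suc.prems Ck_Suc_imp[OF Suc.prems(1)] Ck_Suc_imp[OF Suc.prems(2)]
      by (intro Ck_add[OF assms(1)] Suc.IH) auto
  qed
qed auto

lemma Ck_compose:
  fixes h :: "real \<Rightarrow> 'b::real_normed_algebra_1"
  assumes "open S" "open T" "Ck m T h" "Ck m S \<eta>" "\<And>x. x \<in> S \<Longrightarrow> \<eta> x \<in> T"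
  shows "Ck m S (\<lambda>x. h (\<eta> x))"
  using assms(3,4)
proof (induction m arbitrary: h)
  case (Suc m)
  show ?case
  proof (rule Ck_SucI[OF assms(1), where F' = "\<lambda>x b. of_real (dd b \<eta> x) * dd 1 h (\<eta> x)"])
    fix x assume x: "x \<in> S"
    then obtain e' h' where e: "(\<eta> has_derivative e') (at x)" "\<And>b. e' b = dd b \<eta> x"
      and h: "(h has_derivative h') (at (\<eta> x))" "\<And>b. h' b = dd b h (\<eta> x)"
      using Ck_has_derivative Suc.prems assms(5) by metis
    have "h' r = of_real r * dd 1 h (\<eta> x)" for r
      using linear_scale[OF has_derivative_linear[OF h(1)], of r 1] h(2)[of 1] by (simp add: scaleR_conv_of_real)
    then show "((\<lambda>x. h (\<eta> x)) has_derivative (\<lambda>b. of_real (dd b \<eta> x) * dd 1 h (\<eta> x))) (at x)"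
      using has_derivative_compose[OF e(1) h(1)] e(2) by simp
  next
    fix b :: 'a assume b: "b \<in> Basis"
    have 1: "Ck m S (\<lambda>x. of_real (dd b \<eta> x) :: 'b)"
      by (rule Ck_bounded_linear[OF bounded_linear_of_real assms(1)]) (use Suc.prems b in auto)
    have 2: "Ck m S (\<lambda>x. dd 1 h (\<eta> x))"
      by (rule Suc.IH) (use Suc.prems Ck_Suc_imp[OF Suc.prems(2)] in auto)
    show "Ck m S (\<lambda>x. of_real (dd b \<eta> x) * dd 1 h (\<eta> x))"
      by (rule Ck_mult[OF assms(1) 1 2])
  qed
qed auto

lemma smooth_cong: "open S \<Longrightarrow> smooth S F \<Longrightarrow> (\<And>y. y \<in> S \<Longrightarrow> F y = G y) \<Longrightarrow> smooth S G"
  unfolding smooth_def using Ck_cong by blast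
lemma smooth_Un: "smooth S F \<Longrightarrow> smooth T F \<Longrightarrow> smooth (S \<union> T) F"
  unfolding smooth_def using Ck_Un by blast
lemma smooth_subset: "smooth S F \<Longrightarrow> T \<subseteq> S \<Longrightarrow> smooth T F"
  unfolding smooth_def using Ck_subset by blast
lemma smooth_const: "smooth S (\<lambda>x. c)"
  unfolding smooth_def using Ck_const by blast
lemma smooth_linear: "bounded_linear L \<Longrightarrow> smooth S L"
  unfolding smooth_def using Ck_linear_fun by blast
lemma smooth_bounded_linear: "bounded_linear L \<Longrightarrow> open S \<Longrightarrow> smooth S F \<Longrightarrow> smooth S (\<lambda>x. L (F x))"
  unfolding smooth_def using Ck_bounded_linear by blast
lemma smooth_of_real: "open S \<Longrightarrow> smooth S F \<Longrightarrow> smooth S (\<lambda>x. of_real (F x) :: 'b::real_normed_algebra_1)"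
  by (rule smooth_bounded_linear[OF bounded_linear_of_real])
lemma smooth_add: "open S \<Longrightarrow> smooth S F \<Longrightarrow> smooth S G \<Longrightarrow> smooth S (\<lambda>x. F x + G x)"
  unfolding smooth_def using Ck_add by blast
lemma smooth_mult:
  fixes F G :: "'a::euclidean_space \<Rightarrow> 'b::real_normed_algebra"
  shows "open S \<Longrightarrow> smooth S F \<Longrightarrow> smooth S G \<Longrightarrow> smooth S (\<lambda>x. F x * G x)"
  unfolding smooth_def using Ck_mult by blast
lemma smooth_compose:
  fixes h :: "real \<Rightarrow> 'b::real_normed_algebra_1"
  shows "open S \<Longrightarrow> open T \<Longrightarrow> smooth T h \<Longrightarrow> smooth S \<eta> \<Longrightarrow> (\<And>x. x \<in> S \<Longrightarrow> \<eta> x \<in> T)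
    \<Longrightarrow> smooth S (\<lambda>x. h (\<eta> x))"
  unfolding smooth_def using Ck_compose by blast

lemma smooth_minus: "open S \<Longrightarrow> smooth S F \<Longrightarrow> smooth S (\<lambda>x. - F x)"
  by (rule smooth_bounded_linear[OF bounded_linear_minus[OF bounded_linear_ident]])
lemma smooth_diff: "open S \<Longrightarrow> smooth S F \<Longrightarrow> smooth S G \<Longrightarrow> smooth S (\<lambda>x. F x - G x)"
  using smooth_add[of S F "\<lambda>x. - G x"] smooth_minus[of S G] by simp

lemma smooth_sum: "open S \<Longrightarrow> (\<And>i. i \<in> A \<Longrightarrow> smooth S (F i)) \<Longrightarrow> smooth S (\<lambda>x. \<Sum>i\<in>A. F i x)"
  by (induction A rule: infinite_finite_induct) (auto intro: smooth_const smooth_add)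

lemma smooth_prod:
  fixes F :: "'i \<Rightarrow> 'a::euclidean_space \<Rightarrow> 'b::{real_normed_algebra,comm_ring_1}"
  shows "open S \<Longrightarrow> (\<And>i. i \<in> A \<Longrightarrow> smooth S (F i)) \<Longrightarrow> smooth S (\<lambda>x. \<Prod>i\<in>A. F i x)"
  by (induction A rule: infinite_finite_induct) (auto intro: smooth_const smooth_mult)

lemma smooth_dd: "smooth S F \<Longrightarrow> b \<in> Basis \<Longrightarrow> smooth S (dd b F)"
  unfolding smooth_def by (metis Ck.simps(2))

lemma smooth_differentiable: "smooth S F \<Longrightarrow> x \<in> S \<Longrightarrow> F differentiable (at x)"
  unfolding smooth_def by (metis Ck.simps(2))

lemma smooth_continuous_on: "smooth S F \<Longrightarrow> continuous_on S F"
  by (meson continuous_at_imp_continuous_on differentiable_imp_continuous_within smooth_differentiable)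

lemma smooth_has_derivative:
  assumes "smooth S F" "x \<in> S"
  obtains F' where "(F has_derivative F') (at x)" "\<And>b. F' b = dd b F x"
  using assms Ck_has_derivative unfolding smooth_def by metis

lemma smooth_has_dd:
  assumes "smooth S F" "x \<in> S"
  shows "(F has_derivative (\<lambda>b. dd b F x)) (at x)"
  using smooth_has_derivative[OF assms] by (metis (no_types, lifting) ext)

text \<open>Bootstrapping: the derivative is an expression in F itself, so each known order of
  smoothness yields the next. It serves for exponentials, real powers and characters, which are
  multiples of their own derivatives.\<close>

lemma smooth_ode:
  fixes F :: "real \<Rightarrow> 'b::real_normed_algebra"
  assumes "open S" "\<And>x. x \<in> S \<Longrightarrow> (F has_vector_derivative (a x * F x + c x)) (at x)"
    "smooth S a" "smooth S c"
  shows "smooth S F"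
  unfolding smooth_def
proof
  fix m show "Ck m S F"
  proof (induction m)
    case (Suc m)
    show ?case
    proof (rule Ck_SucI[OF assms(1), where F' = "\<lambda>x r. r *\<^sub>R (a x * F x + c x)"])
      show "(F has_derivative (\<lambda>r. r *\<^sub>R (a x * F x + c x))) (at x)" if "x \<in> S" for x
        using assms(2)[OF that] by (simp add: has_vector_derivative_def)
      show "Ck m S (\<lambda>x. b *\<^sub>R (a x * F x + c x))" for b
        using Suc assms(3,4) unfolding smooth_def
        by (intro Ck_bounded_linear[OF bounded_linear_scaleR_right] Ck_add Ck_mult assms(1)) auto
    qed
  qed auto
qed

lemma smooth_antiderivative:
  fixes F :: "real \<Rightarrow> 'b::real_normed_algebra"
  assumes "open S" "\<And>x. x \<in> S \<Longrightarrow> (F has_vector_derivative c x) (at x)" "smooth S c"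
  shows "smooth S F"
  by (rule smooth_ode[of S F "\<lambda>_. 0" c]) (use assms smooth_const in auto)

lemma smooth_inverse: "smooth (- {0}) (inverse :: real \<Rightarrow> real)"
  unfolding smooth_def
proof
  fix m show "Ck m (- {0}) (inverse :: real \<Rightarrow> real)"
  proof (induction m)
    case (Suc m)
    show ?case
    proof (rule Ck_SucI[where F' = "\<lambda>x r. r *\<^sub>R (- (inverse x * inverse x))"])
      show "(inverse has_derivative (\<lambda>r. r *\<^sub>R - (inverse x * inverse x))) (at x)" if "x \<in> - {0}" for x :: real
        using that by (auto intro!: derivative_eq_intros simp: fun_eq_iff)
      show "Ck m (- {0}) (\<lambda>x::real. b *\<^sub>R - (inverse x * inverse x))" for b
        using Suc by (intro Ck_bounded_linear[OF bounded_linear_scaleR_right]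
            Ck_bounded_linear[OF bounded_linear_minus[OF bounded_linear_ident]] Ck_mult) auto
    qed auto
  qed auto
qed

lemma smooth_divide:
  fixes F G :: "'a::euclidean_space \<Rightarrow> real"
  assumes "open S" "smooth S F" "smooth S G" "\<And>x. x \<in> S \<Longrightarrow> G x \<noteq> 0"
  shows "smooth S (\<lambda>x. F x / G x)"
  unfolding divide_inverse
  by (rule smooth_mult[OF assms(1,2)], rule smooth_compose[OF assms(1) _ smooth_inverse assms(3)])
    (use assms(4) in auto)

lemma has_derivative_cexp:
  fixes g :: "'a::real_normed_vector \<Rightarrow> complex"
  assumes "(g has_derivative g') (at x)"
  shows "((\<lambda>x. exp (g x)) has_derivative (\<lambda>h. exp (g x) * g' h)) (at x)"
  using has_derivative_compose[OF assms DERIV_exp[unfolded has_field_derivative_def]] .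

lemma smooth_exp: "smooth UNIV (\<lambda>x::real. exp (c * of_real x) :: complex)"
proof (rule smooth_ode[of UNIV _ "\<lambda>_. c" "\<lambda>_. 0"])
  fix x :: real
  have "((\<lambda>x::real. c * of_real x) has_derivative (\<lambda>h. c * of_real h)) (at x)"
    by (auto intro!: derivative_eq_intros)
  from has_derivative_cexp[OF this]
  show "((\<lambda>x::real. exp (c * of_real x) :: complex) has_vector_derivative (c * exp (c * of_real x) + 0)) (at x)"
    by (simp add: has_vector_derivative_def scaleR_conv_of_real mult_ac)
qed (auto intro: smooth_const)

lemma smooth_nth: "smooth S (\<lambda>x::real^'n::finite. x $ k)"
  by (rule smooth_linear[OF bounded_linear_vec_nth])

text \<open>Bridge between derivatives indexed by lists and the recursion of \<open>Ck\<close>: one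
  direction consumes a list from its end, where the innermost derivative stands, the other from its
  head.\<close>

lemma smooth_off0_iff: "smooth_off0 F \<longleftrightarrow> smooth (- {0}) (F :: real^'n::finite \<Rightarrow> complex)"
proof
  have iter: "iter_pd (ks @ [k]) F = iter_pd ks (pd k F)" for ks k and F :: "real^'n \<Rightarrow> complex"
    by (simp add: iter_pd_def)
  have iter1: "iter_pd (k # ks) F = pd k (iter_pd ks F)" for ks k and F :: "real^'n \<Rightarrow> complex"
    by (simp add: iter_pd_def)
  show "smooth (- {0}) F" if "smooth_off0 F"
    unfolding smooth_def
  proof
    fix m
    show "Ck m (- {0}) F" using that
    proof (induction m arbitrary: F)
      case (Suc m)
      have "F differentiable (at x)" if "x \<noteq> 0" for x
        using Suc.prems that unfolding smooth_off0_def by (metis foldr.simps(1) id_apply iter_pd_def)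
      moreover have "Ck m (- {0}) (dd b F)" if "b \<in> Basis" for b
      proof -
        from that obtain k where b: "b = axis k 1" by (auto simp: Basis_vec_def)
        have "smooth_off0 (pd k F)"
          using Suc.prems unfolding smooth_off0_def by (metis iter)
        then show ?thesis using Suc.IH b by (simp add: pd_eq_dd)
      qed
      ultimately show ?case by auto
    qed auto
  qed
  show "smooth_off0 F" if "smooth (- {0}) F"
  proof -
    have "smooth (- {0}) (iter_pd ks F)" for ks
    proof (induction ks)
      case Nil then show ?case using that by (simp add: iter_pd_def)
    next
      case (Cons k ks)
      then show ?case unfolding iter1 pd_eq_dd by (intro smooth_dd) (auto simp: axis_in_Basis_iff)
    qed
    then show ?thesis unfolding smooth_off0_def using smooth_differentiable by blast
  qed
qed

section \<open>Flat functions, bumps and an oscillatory integral\<close>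

text \<open>The powers of x in the denominator make the family closed under differentiation, which
  the function \<open>exp (- 1 / x)\<close> alone is not.\<close>

definition flat :: "nat \<Rightarrow> real \<Rightarrow> real" where
  "flat k x = (if x > 0 then exp (- 1 / x) / x ^ k else 0)"

lemma flat_tendsto_0: "(flat k \<longlongrightarrow> 0) (at 0)"
proof -
  have r: "((\<lambda>x::real. inverse x ^ k / exp (inverse x)) \<longlongrightarrow> 0) (at_right 0)"
    by (rule filterlim_compose[OF tendsto_power_div_exp_0 filterlim_inverse_at_top_right])
  have "(flat k \<longlongrightarrow> 0) (at_right 0)"
    by (rule Lim_transform_eventually[OF r])
      (auto simp: flat_def eventually_at_right_field exp_minus divide_simps intro!: exI[of _ 1])
  moreover have "(flat k \<longlongrightarrow> 0) (at_left 0)"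
    by (rule Lim_transform_eventually[OF tendsto_const])
      (auto simp: flat_def eventually_at_left_field intro!: exI[of _ "-1"])
  ultimately show ?thesis by (simp add: filterlim_at_split)
qed

lemma flat_deriv: "(flat k has_real_derivative (flat (k + 2) x - real k * flat (k + 1) x)) (at x)"
proof (cases x "0::real" rule: linorder_cases)
  case less
  have "((\<lambda>_. 0) has_real_derivative 0) (at x)" by simp
  then have "(flat k has_real_derivative 0) (at x)"
    by (rule has_field_derivative_transform_within_open[of _ _ _ "{..<0}"]) (use less in \<open>auto simp: flat_def\<close>)
  then show ?thesis using less by (simp add: flat_def)
next
  case equal
  \<comment> \<open>The difference quotient at 0 is the next member of the family, so
    differentiability at 0 is again \<open>flat_tendsto_0\<close>.\<close>
  have "flat k h / h = flat (Suc k) h" for h by (auto simp: flat_def)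
  then have "((\<lambda>h. (flat k (0 + h) - flat k 0) / h) \<longlongrightarrow> 0) (at 0)"
    using flat_tendsto_0[of "Suc k"] by (simp add: flat_def[of _ 0])
  then show ?thesis using equal by (simp add: DERIV_def flat_def)
next
  case greater
  have "((\<lambda>x. exp (- 1 / x) * inverse (x ^ k)) has_real_derivative
      (exp (- 1 / x) * (1 / x\<^sup>2)) * inverse (x ^ k) + exp (- 1 / x) * (- (inverse (x ^ k) * (real k * x ^ (k - 1)) * inverse (x ^ k)))) (at x)"
    using greater by (auto intro!: derivative_eq_intros simp: power2_eq_square field_simps)
  also have "(exp (- 1 / x) * (1 / x\<^sup>2)) * inverse (x ^ k) + exp (- 1 / x) * (- (inverse (x ^ k) * (real k * x ^ (k - 1)) * inverse (x ^ k)))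
      = flat (k + 2) x - real k * flat (k + 1) x"
    using greater by (cases k) (auto simp: flat_def divide_simps power2_eq_square)
  finally show ?thesis
    by (rule has_field_derivative_transform_within_open[of _ _ _ "{0<..}"]) (use greater in \<open>auto simp: flat_def divide_inverse\<close>)
qed

lemma smooth_flat: "smooth UNIV (flat k)"
proof -
  have "Ck m UNIV (flat k)" for m
  proof (induction m arbitrary: k)
    case (Suc m)
    show ?case
    proof (rule Ck_SucI[where F' = "\<lambda>x r. r *\<^sub>R (flat (k + 2) x + (- real k) * flat (k + 1) x)"])
      show "(flat k has_derivative (\<lambda>r. r *\<^sub>R (flat (k + 2) x + (- real k) * flat (k + 1) x))) (at x)" for x
        using flat_deriv[of k x] by (simp add: has_field_derivative_def mult_commute_abs)
      show "Ck m UNIV (\<lambda>x. b *\<^sub>R (flat (k + 2) x + (- real k) * flat (k + 1) x))" for b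
        by (intro Ck_bounded_linear[OF bounded_linear_scaleR_right] Ck_add Ck_mult Ck_const Suc) auto
    qed auto
  qed auto
  then show ?thesis unfolding smooth_def by auto
qed

lemma flat_nonneg: "flat k x \<ge> 0" by (simp add: flat_def)
lemma flat_pos: "x > 0 \<Longrightarrow> flat k x > 0" by (simp add: flat_def)
lemma flat_0: "x \<le> 0 \<Longrightarrow> flat k x = 0" by (simp add: flat_def)

definition bump :: "real \<Rightarrow> real \<Rightarrow> real \<Rightarrow> real" where
  "bump a c x = flat 0 (x - a) * flat 0 (c - x)"

lemma smooth_id: "smooth S (\<lambda>x::real. x)" by (rule smooth_linear[OF bounded_linear_ident])

lemma smooth_bump: "smooth UNIV (bump a c)"
  unfolding bump_def[abs_def]
  by (intro smooth_mult smooth_compose[OF _ _ smooth_flat] smooth_diff smooth_id smooth_const) auto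

lemma bump_nonneg: "bump a c x \<ge> 0" by (simp add: bump_def flat_nonneg)
lemma bump_pos: "a < x \<Longrightarrow> x < c \<Longrightarrow> bump a c x > 0" by (simp add: bump_def flat_pos)
lemma bump_0: "x \<le> a \<or> c \<le> x \<Longrightarrow> bump a c x = 0" by (auto simp: bump_def flat_0)

text \<open>The step starts at 1/4, not at 0, so that its derivative vanishes at 0: this is the junk value
  of \<open>x\<^sub>i / x\<^sub>j\<close> on the hyperplane \<open>x\<^sub>j = 0\<close>.\<close>
definition step :: "real \<Rightarrow> real" where
  "step y = flat 0 (y - 1/4) / (flat 0 (y - 1/4) + flat 0 (1 - y))"

lemma smooth_step: "smooth UNIV step"
  unfolding step_def[abs_def]
proof (intro smooth_divide smooth_add smooth_compose[OF _ _ smooth_flat] smooth_diff smooth_id smooth_const)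
  show "flat 0 (x - 1/4) + flat 0 (1 - x) \<noteq> 0" for x
  proof (cases "x > 1/4")
    case True
    then have "flat 0 (x - 1/4) > 0" by (intro flat_pos) simp
    then show ?thesis using flat_nonneg[of 0 "1 - x"] by linarith
  next
    case False
    then have "flat 0 (1 - x) > 0" by (intro flat_pos) simp
    then show ?thesis using flat_nonneg[of 0 "x - 1/4"] by linarith
  qed
qed auto

lemma step_0: "y \<le> 1/4 \<Longrightarrow> step y = 0" by (simp add: step_def flat_0)
lemma step_1: "y \<ge> 1 \<Longrightarrow> step y = 1" using flat_pos[of "y - 1/4" 0] by (simp add: step_def flat_0)

lemma dd_step_0: "y < 1/4 \<or> 1 < y \<Longrightarrow> dd 1 step y = 0"
proof -
  assume y: "y < 1/4 \<or> 1 < y"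
  have "dd 1 step y = dd 1 (\<lambda>_. step y) y"
  proof (cases "y < 1/4")
    case True
    then show ?thesis by (intro dd_cong[of "{..<1/4}"]) (auto simp: step_0)
  next
    case False
    then show ?thesis using y by (intro dd_cong[of "{1<..}"]) (auto simp: step_1)
  qed
  then show ?thesis by (simp add: dd_def)
qed

lemma step_deriv: "(step has_vector_derivative dd 1 step y) (at y)"
proof -
  have d: "(step has_derivative (\<lambda>b. dd b step y)) (at y)" by (rule smooth_has_dd[OF smooth_step]) simp
  have "(\<lambda>b. dd b step y) = (\<lambda>b. b *\<^sub>R dd 1 step y)"
  proof
    fix b show "dd b step y = b *\<^sub>R dd 1 step y"
      using linear_scale[OF has_derivative_linear[OF d], of b 1] by simp
  qed
  with d show ?thesis by (simp only: has_vector_derivative_def)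
qed

section \<open>Characters of the multiplicative group of the reals\<close>

definition mc :: "nat \<Rightarrow> bool \<Rightarrow> real \<Rightarrow> real \<Rightarrow> complex" where
  "mc N pm t x = eps_char pm x * complex_of_real (\<bar>x\<bar> powr (- real N / 2)) * cis (- t * ln \<bar>x\<bar>)"

text \<open>Rests on \<open>0 powr a = 0\<close>. Every product with this factor therefore vanishes
  on the hyperplane where its argument is 0, whatever values the quotients take there.\<close>

lemma mc_0 [simp]: "mc N pm t 0 = 0" by (simp add: mc_def)

lemma mc_mult:
  assumes "a \<noteq> 0" "b \<noteq> 0"
  shows "mc N pm t (a * b) = mc N pm t a * mc N pm t b"
proof -
  have "cis (- t * ln \<bar>a * b\<bar>) = cis (- t * ln \<bar>a\<bar>) * cis (- t * ln \<bar>b\<bar>)"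
    using assms by (simp add: cis_mult abs_mult ln_mult algebra_simps)
  then show ?thesis
    unfolding mc_def by (simp add: eps_char_def abs_mult sgn_mult powr_mult)
qed

lemma mc_pos: "x > 0 \<Longrightarrow> mc N pm t x = complex_of_real (x powr (- real N / 2)) * cis (- t * ln x)"
  by (simp add: mc_def eps_char_def)

lemma norm_mc: "x \<noteq> 0 \<Longrightarrow> cmod (mc N pm t x) = \<bar>x\<bar> powr (- real N / 2)"
  by (simp add: mc_def eps_char_def norm_mult)

lemma mc_eq_exp:
  assumes "x > 0"
  shows "mc N pm t x = exp (- (of_real (real N / 2) + \<i> * of_real t) * of_real (ln x))"
proof -
  have "mc N pm t x = exp (of_real (- real N / 2 * ln x)) * exp (\<i> * of_real (- t * ln x))"
    using assms by (simp add: mc_pos powr_def cis_conv_exp exp_of_real[symmetric])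
  also have "\<dots> = exp (- (of_real (real N / 2) + \<i> * of_real t) * of_real (ln x))"
    unfolding mult_exp_exp by (simp add: algebra_simps)
  finally show ?thesis .
qed

lemma mc_deriv_pos:
  assumes "x > 0"
  shows "(mc N pm t has_vector_derivative
    - (of_real (real N / 2) + \<i> * of_real t) * of_real (inverse x) * mc N pm t x) (at x)"
proof -
  let ?c = "- (of_real (real N / 2) + \<i> * of_real t)"
  have "((\<lambda>x. of_real (ln x) :: complex) has_derivative (\<lambda>h. of_real (h * inverse x))) (at x)"
    using assms by (auto intro!: derivative_eq_intros)
  from has_derivative_mult_right[OF this, of ?c]
  have "((\<lambda>x. ?c * of_real (ln x)) has_derivative (\<lambda>h. ?c * of_real (h * inverse x))) (at x)" .
  from has_derivative_cexp[OF this]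
  have "((\<lambda>x. exp (?c * of_real (ln x))) has_vector_derivative (?c * of_real (inverse x) * mc N pm t x)) (at x)"
    using assms by (simp add: has_vector_derivative_def scaleR_conv_of_real mult_ac mc_eq_exp)
  then show ?thesis
    by (rule has_vector_derivative_transform_within_open[of _ _ _ "{0<..}"]) (use assms in \<open>auto simp: mc_eq_exp\<close>)
qed

lemma mc_deriv:
  assumes "x \<noteq> 0"
  shows "(mc N pm t has_vector_derivative
    - (of_real (real N / 2) + \<i> * of_real t) * of_real (inverse x) * mc N pm t x) (at x)"
proof (cases "x > 0")
  case False
  then have x: "- x > 0" using assms by simp
  have eq: "mc N pm t y = mc N pm t (-1) * mc N pm t (- y)" if "y \<noteq> 0" for y
    using mc_mult[of "-1" "- y"] that by simp
  let ?c = "- (of_real (real N / 2) + \<i> * of_real t)"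
  have "((\<lambda>y. mc N pm t (- y)) has_vector_derivative - (?c * of_real (inverse (- x)) * mc N pm t (- x))) (at x)"
    using vector_diff_chain_at[OF has_vector_derivative_minus[OF has_vector_derivative_id] mc_deriv_pos[OF x, of N pm t], of ]
    by (simp add: o_def)
  from has_vector_derivative_mult_right[OF this, of "mc N pm t (-1)"]
  have "((\<lambda>y. mc N pm t (-1) * mc N pm t (- y)) has_vector_derivative (?c * of_real (inverse x) * mc N pm t x)) (at x)"
    using assms by (simp add: eq[of x] mult_ac)
  then show ?thesis
    by (rule has_vector_derivative_transform_within_open[of _ _ _ "- {0}"]) (use assms in \<open>auto simp flip: eq\<close>)
qed (use mc_deriv_pos in auto)

lemma smooth_mc: "smooth (- {0}) (mc N pm t)"
proof (rule smooth_ode[where c = "\<lambda>_. 0" and a = "\<lambda>x. - (of_real (real N / 2) + \<i> * of_real t) * of_real (inverse x)"])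
  show "smooth (- {0}) (\<lambda>x. - (of_real (real N / 2) + \<i> * of_real t) * complex_of_real (inverse x))"
    by (intro smooth_mult smooth_const smooth_of_real smooth_inverse) auto
qed (use mc_deriv smooth_const in auto)

text \<open>At y = \<kappa> x the factor \<open>exp (i \<lambda> y)\<close> is
  \<open>cis (- t * x)\<close>. Multiplying it by this function trades it for
  \<open>cis (- t * ln x)\<close>, the phase of the character, up to the constant
  \<open>cis (- t)\<close>. Subtracting 1 in the phase makes its critical value at x = 1 equal to
  0.\<close>

definition osc :: "real \<Rightarrow> real \<Rightarrow> complex" where
  "osc t x = of_real (bump (3/4) (5/4) x) * cis (t * (x - 1 - ln x))"

lemma smooth_ln: "smooth {0<..} (ln :: real \<Rightarrow> real)"
  by (rule smooth_antiderivative[where c = inverse])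
    (auto intro!: derivative_eq_intros smooth_subset[OF smooth_inverse]
      simp: has_real_derivative_iff_has_vector_derivative[symmetric] inverse_eq_divide)

lemma smooth_cis: "smooth UNIV cis"
  using smooth_exp[of \<i>] by (simp add: cis_conv_exp[abs_def])

lemma smooth_osc: "smooth UNIV (osc t)"
proof -
  have "smooth {1/2<..} (osc t)"
    unfolding osc_def[abs_def]
    by (intro smooth_mult smooth_of_real smooth_subset[OF smooth_bump] smooth_compose[OF _ _ smooth_cis]
        smooth_diff smooth_id smooth_const smooth_subset[OF smooth_ln]) auto
  moreover have "smooth {..<3/4} (osc t)"
    by (rule smooth_cong[OF _ smooth_const[of _ 0]]) (auto simp: osc_def bump_0)
  moreover have "{1/2<..} \<union> {..<3/4} = (UNIV :: real set)" by auto
  ultimately show ?thesis using smooth_Un by metis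
qed

section \<open>The oscillatory integral and its lower bound\<close>

definition oscint :: "real \<Rightarrow> real \<Rightarrow> complex" where
  "oscint t x = integral {1/2..x} (osc t)"

lemma osc_0: "x \<le> 3/4 \<or> 5/4 \<le> x \<Longrightarrow> osc t x = 0"
  by (simp add: osc_def bump_0)

lemma oscint_0: "x \<le> 3/4 \<Longrightarrow> oscint t x = 0"
  unfolding oscint_def
  by (intro integral_unique, intro has_integral_is_0) (auto simp: osc_0)

lemma oscint_deriv: "(oscint t has_vector_derivative osc t x) (at x)"
proof (cases "x < 3/4")
  case True
  have "((\<lambda>_. 0) has_vector_derivative (0::complex)) (at x)" by simp
  then have "(oscint t has_vector_derivative 0) (at x)"
    by (rule has_vector_derivative_transform_within_open[of _ _ _ "{..<3/4}"]) (use True oscint_0 in auto)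
  then show ?thesis using True by (simp add: osc_0)
next
  case False
  have "((\<lambda>u. integral {1/2..u} (osc t)) has_vector_derivative osc t x) (at x within {1/2..x+1})"
    by (rule integral_has_vector_derivative)
      (use False continuous_on_subset[OF smooth_continuous_on[OF smooth_osc]] in auto)
  moreover have "at x within {1/2..x+1} = at x"
    by (rule at_within_Icc_at) (use False in auto)
  ultimately show ?thesis by (simp add: oscint_def[abs_def])
qed

lemma smooth_oscint: "smooth UNIV (oscint t)"
  by (rule smooth_antiderivative[OF _ oscint_deriv smooth_osc]) auto

lemma oscint_const: 
  assumes "x \<ge> 5/4" shows "oscint t x = oscint t 2"
proof -
  have ev: "oscint t y = oscint t z" if "5/4 \<le> y" "y \<le> z" for y z
  proof -
    have "oscint t y + integral {y..z} (osc t) = oscint t z"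
      unfolding oscint_def
      by (rule Henstock_Kurzweil_Integration.integral_combine)
        (use that in \<open>auto intro!: integrable_continuous_real continuous_on_subset[OF smooth_continuous_on[OF smooth_osc]]\<close>)
    moreover have "integral {y..z} (osc t) = 0"
      by (intro integral_unique has_integral_is_0) (use that in \<open>auto simp: osc_0\<close>)
    ultimately show ?thesis by simp
  qed
  show ?thesis
    using ev[of "5/4" x] ev[of "5/4" 2] assms by simp
qed

text \<open>Keeps the phase of \<open>osc\<close> away from 0 to the right of its critical point.
  With 1/4 in place of the Taylor coefficient 1/2, the difference has derivative x (1 - x) / (2 (1 +
  x)), which is nonnegative on all of [0, 1].\<close>

lemma ln_lower_quad: "0 \<le> u \<Longrightarrow> u \<le> 1 \<Longrightarrow> ln (1 + u) \<le> u - u\<^sup>2 / 4" for u :: real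
proof -
  assume u: "0 \<le> u" "u \<le> 1"
  let ?F = "\<lambda>u::real. u - u\<^sup>2 / 4 - ln (1 + u)"
  have "?F 0 \<le> ?F u"
  proof (rule DERIV_nonneg_imp_nondecreasing[OF u(1)])
    fix x assume x: "0 \<le> x" "x \<le> u"
    have "DERIV ?F x :> 1 - x / 2 - 1 / (1 + x)"
      using x by (auto intro!: derivative_eq_intros)
    moreover have "1 - x / 2 - 1 / (1 + x) = x * (1 - x) / (2 * (1 + x))"
      using x by (simp add: field_simps)
    moreover have "\<dots> \<ge> 0" using x u by simp
    ultimately show "\<exists>y. DERIV ?F x :> y \<and> y \<ge> 0" by auto
  qed
  then show ?thesis by simp
qed

lemma one_minus_cos_le: "\<bar>1 - cos x\<bar> \<le> x\<^sup>2 / 2" for x :: real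
proof -
  have "1 - cos x = 2 * (sin (x/2))\<^sup>2"
    using cos_double_sin[of "x/2"] by simp
  moreover have "(sin (x/2))\<^sup>2 \<le> (x/2)\<^sup>2"
    using abs_sin_x_le_abs_x[of "x/2"] abs_le_square_iff by blast
  ultimately show ?thesis by (simp add: power_divide)
qed

text \<open>Both bounds are \<open>ln u \<le> u - 1\<close>, at u = x and at u = 1 / x.\<close>

lemma phase_bounds:
  assumes "(x::real) > 0"
  shows "0 \<le> x - 1 - ln x" "x - 1 - ln x \<le> (x - 1)\<^sup>2 / x"
proof -
  show "0 \<le> x - 1 - ln x" using ln_le_minus_one[OF assms] by simp
  have "1 - 1 / x \<le> ln x" using ln_le_minus_one[of "1/x"] assms by (simp add: ln_div)
  then have "x - 1 - ln x \<le> x - 1 - (1 - 1 / x)" by simp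
  also have "\<dots> = (x - 1)\<^sup>2 / x" using assms by (simp add: field_simps power2_eq_square)
  finally show "x - 1 - ln x \<le> (x - 1)\<^sup>2 / x" .
qed

definition bump' :: "real \<Rightarrow> real" where
  "bump' x = flat 2 (x - 3/4) * flat 0 (5/4 - x) - flat 0 (x - 3/4) * flat 2 (5/4 - x)"

lemma bump_deriv: "(bump (3/4) (5/4) has_real_derivative bump' x) (at x)"
proof -
  have d: "(flat 0 has_real_derivative flat 2 y) (at y)" for y
    using flat_deriv[of 0 y] by (simp add: numeral_2_eq_2)
  have 1: "((\<lambda>x. flat 0 (x - 3/4)) has_real_derivative flat 2 (x - 3/4) * 1) (at x)"
    by (rule DERIV_chain2[OF d]) (auto intro!: derivative_eq_intros)
  have 2: "((\<lambda>x. flat 0 (5/4 - x)) has_real_derivative flat 2 (5/4 - x) * (-1)) (at x)"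
    by (rule DERIV_chain2[OF d]) (auto intro!: derivative_eq_intros)
  show ?thesis
    unfolding bump_def[abs_def] using DERIV_mult[OF 1 2] by (simp add: bump'_def algebra_simps)
qed

text \<open>The ends 3/4 and 5/4 lie symmetrically about 1 and the nearer end dominates the
  logarithmic derivative. So the bump rises up to the critical point of the phase and falls after
  it.\<close>

lemma bump'_sign: "(x - 1) * bump' x \<le> 0"
proof (cases "3/4 < x \<and> x < 5/4")
  case True
  let ?a = "x - 3/4" and ?b = "5/4 - x"
  have pos: "?a > 0" "?b > 0" using True by auto
  have "bump' x = exp (- 1 / ?a) * exp (- 1 / ?b) * (1 / ?a\<^sup>2 - 1 / ?b\<^sup>2)"
    using pos by (simp add: bump'_def flat_def right_diff_distrib)
  moreover have "(x - 1) * (1 / ?a\<^sup>2 - 1 / ?b\<^sup>2) \<le> 0"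
  proof (cases "x \<ge> 1")
    case True
    then have "?b\<^sup>2 \<le> ?a\<^sup>2" using pos by (intro power_mono) auto
    then have "1 / ?a\<^sup>2 \<le> 1 / ?b\<^sup>2" using pos by (intro divide_left_mono) auto
    then show ?thesis using True by (simp add: mult_nonneg_nonpos)
  next
    case False
    then have "?a\<^sup>2 \<le> ?b\<^sup>2" using pos by (intro power_mono) auto
    then have "1 / ?b\<^sup>2 \<le> 1 / ?a\<^sup>2" using pos by (intro divide_left_mono) auto
    then show ?thesis using False by (simp add: mult_nonpos_nonneg)
  qed
  ultimately show ?thesis
    by (simp only: mult.left_commute[of "x - 1"]) (rule mult_nonneg_nonpos; simp)
qed (auto simp: bump'_def flat_0)

text \<open>With \<open>\<chi>\<close> the bump and \<open>p x = x - 1 - ln x\<close>: subtracting the derivative of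
  \<open>\<chi> / (t p') (1 - cos (t p))\<close> from \<open>\<chi> sin (t p)\<close> leaves a nonnegative integrand, because
  \<open>\<chi>\<close> decreases and \<open>\<bar>p'\<bar>\<close> increases away from the critical point 1. It is of order 1 on an
  interval of length of order \<open>1 / sqrt t\<close>.\<close>
lemma osc_sin_lower:
  assumes t: "t \<ge> 144"
  shows "integral {1/2..2} (\<lambda>x. bump (3/4) (5/4) x * sin (t * (x - 1 - ln x)))
    \<ge> (1 - cos (1/4)) * (2/9) * exp (- 12) / sqrt t"
proof -
  let ?\<chi> = "bump (3/4) (5/4)" and ?p = "\<lambda>x::real. x - 1 - ln x"
  define K where "K x = ?\<chi> x * x * (1 - cos (t * ?p x)) / (t * (x - 1))" for x
  define E where "E x = (1 - cos (t * ?p x)) * (?\<chi> x / (t * (x - 1)\<^sup>2) - bump' x * x / (t * (x - 1)))" for x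
  \<comment> \<open>Division by zero supplies the correct limit: the phase is O((x - 1)^2), so 1 -
    cos is O((x - 1)^4) and K is continuous at 1. The factor x / (x - 1) in K is the inverse of the
    derivative of the phase.\<close>
  have K1: "K 1 = 0" by (simp add: K_def)
  have Kd: "(K has_real_derivative (?\<chi> x * sin (t * ?p x) - E x)) (at x)" if x: "x > 0" "x \<noteq> 1" for x
  proof -
    have 1: "((\<lambda>x. 1 - cos (t * ?p x)) has_real_derivative sin (t * ?p x) * (t * (1 - 1 / x))) (at x)"
      using x by (auto intro!: derivative_eq_intros)
    have 2: "((\<lambda>x. x / (t * (x - 1))) has_real_derivative - 1 / (t * (x - 1)\<^sup>2)) (at x)"
      using x t by (auto intro!: derivative_eq_intros simp: divide_simps power2_eq_square) (simp add: algebra_simps)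
    have "K = (\<lambda>x. ?\<chi> x * (x / (t * (x - 1))) * (1 - cos (t * ?p x)))"
      by (auto simp: K_def)
    moreover have "((\<lambda>x. ?\<chi> x * (x / (t * (x - 1))) * (1 - cos (t * ?p x))) has_real_derivative
       (bump' x * (x / (t * (x - 1))) + - 1 / (t * (x - 1)\<^sup>2) * ?\<chi> x) * (1 - cos (t * ?p x))
        + sin (t * ?p x) * (t * (1 - 1 / x)) * (?\<chi> x * (x / (t * (x - 1))))) (at x)"
      by (rule DERIV_mult[OF DERIV_mult[OF bump_deriv 2] 1])
    moreover have "(bump' x * (x / (t * (x - 1))) + - 1 / (t * (x - 1)\<^sup>2) * ?\<chi> x) * (1 - cos (t * ?p x))
        + sin (t * ?p x) * (t * (1 - 1 / x)) * (?\<chi> x * (x / (t * (x - 1)))) = ?\<chi> x * sin (t * ?p x) - E x"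
    proof -
      have "1 - 1 / x = (x - 1) / x" using x by (simp add: field_simps)
      then have c: "(t * (1 - 1 / x)) * (?\<chi> x * (x / (t * (x - 1)))) = ?\<chi> x" using x t by simp
      have e: "(b * c + m * h) * k + s * u * v = h * s - k * (- m * h - b * c)" if "u * v = h" for b c m h k s u v :: real
        using that by (simp add: algebra_simps)
      have E: "E x = (1 - cos (t * ?p x)) * (- (- 1 / (t * (x - 1)\<^sup>2)) * ?\<chi> x - bump' x * (x / (t * (x - 1))))"
        by (simp add: E_def)
      show ?thesis unfolding E by (rule e[OF c])
    qed
    ultimately show ?thesis by simp
  qed
  have Kc: "isCont K x" if "x > 0" for x
  proof (cases "x = 1")
    case True
    have "(K \<longlongrightarrow> 0) (at 1)"
    proof (rule Lim_null_comparison[where g = "\<lambda>x. ?\<chi> x * (t * \<bar>x - 1\<bar> ^ 3 / (2 * x))"])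
      have "norm (K x) \<le> ?\<chi> x * (t * \<bar>x - 1\<bar> ^ 3 / (2 * x))" if x: "x > 0" "x \<noteq> 1" for x
      proof -
        have "\<bar>1 - cos (t * ?p x)\<bar> \<le> (t * ?p x)\<^sup>2 / 2" by (rule one_minus_cos_le)
        also have "\<dots> \<le> (t * ((x - 1)\<^sup>2 / x))\<^sup>2 / 2"
          using phase_bounds[OF x(1)] t by (intro divide_right_mono power_mono mult_left_mono) auto
        finally have "\<bar>K x\<bar> \<le> ?\<chi> x * x * ((t * ((x - 1)\<^sup>2 / x))\<^sup>2 / 2) / (t * \<bar>x - 1\<bar>)"
          using x t bump_nonneg[of "3/4" "5/4" x] unfolding K_def abs_divide abs_mult
          by (intro frac_le mult_mono) auto
        also have "\<dots> = ?\<chi> x * (t * \<bar>x - 1\<bar> ^ 3 / (2 * x))"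
        proof -
          have "(x - 1)\<^sup>2 = \<bar>x - 1\<bar>\<^sup>2" by simp
          moreover have "\<bar>x - 1\<bar> \<noteq> 0" using x by simp
          ultimately show ?thesis using x t
            by (simp only:) (simp add: divide_simps power2_eq_square power3_eq_cube)
        qed
        finally show ?thesis by simp
      qed
      then show "\<forall>\<^sub>F x in at 1. norm (K x) \<le> ?\<chi> x * (t * \<bar>x - 1\<bar> ^ 3 / (2 * x))"
        unfolding eventually_at by (intro exI[of _ 1]) (auto simp: dist_real_def)
      have "isCont (\<lambda>x. ?\<chi> x * (t * \<bar>x - 1\<bar> ^ 3 / (2 * x))) 1"
        using bump_deriv[of 1] by (intro continuous_intros) (auto intro: DERIV_isCont)
      then show "((\<lambda>x. ?\<chi> x * (t * \<bar>x - 1\<bar> ^ 3 / (2 * x))) \<longlongrightarrow> 0) (at 1)"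
        by (simp add: isCont_def)
    qed
    then show ?thesis using True K1 by (simp add: isCont_def)
  qed (use Kd that in \<open>auto intro: DERIV_isCont\<close>)
  have I1: "((\<lambda>x. ?\<chi> x * sin (t * ?p x) - E x) has_integral (K 2 - K (1/2))) {1/2..2}"
    by (rule fundamental_theorem_of_calculus_interior_strong[of "{1}"])
      (use Kc Kd in \<open>auto simp: has_real_derivative_iff_has_vector_derivative[symmetric] intro!: continuous_at_imp_continuous_on\<close>)
  have I2: "(\<lambda>x. ?\<chi> x * sin (t * ?p x)) integrable_on {1/2..2}"
    by (intro integrable_continuous_real continuous_intros continuous_on_subset[OF smooth_continuous_on[OF smooth_bump]]) auto
  have K0: "K 2 - K (1/2) = 0" by (simp add: K_def bump_0)
  have IE: "(E has_integral integral {1/2..2} (\<lambda>x. ?\<chi> x * sin (t * ?p x))) {1/2..2}"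
    using has_integral_diff[OF integrable_integral[OF I2] I1] K0 by simp
  \<comment> \<open>The minimum of the integrand on an interval [1 + r, 1 + 3/2 r] with r of order
    \<open>1 / sqrt t\<close>. There t p lies between 1/4 and pi, t (x - 1)^2 is at most 9/4, and
    the bump is at least exp (- 4) exp (- 8), because x is at least 1/4 from 3/4 and at least 1/8
    from 5/4.\<close>
  define m where "m = (1 - cos (1/4)) * (4/9) * exp (- 12 :: real)"
  have E0: "E x \<ge> (1 - cos (t * ?p x)) * ?\<chi> x / (t * (x - 1)\<^sup>2)" if "x > 0" "x \<noteq> 1" for x
  proof -
    have "bump' x * x / (t * (x - 1)) = ((x - 1) * bump' x) * x / (t * (x - 1)\<^sup>2)"
      using that by (simp add: power2_eq_square)
    also have "\<dots> \<le> 0" 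
      by (rule divide_nonpos_nonneg[OF mult_nonpos_nonneg[OF bump'_sign]]) (use that t in auto)
    finally have "?\<chi> x / (t * (x - 1)\<^sup>2) \<le> ?\<chi> x / (t * (x - 1)\<^sup>2) - bump' x * x / (t * (x - 1))" by simp
    then have "(1 - cos (t * ?p x)) * (?\<chi> x / (t * (x - 1)\<^sup>2)) \<le> E x"
      unfolding E_def by (rule mult_left_mono) simp
    then show ?thesis by simp
  qed
  \<comment> \<open>The bound t \<ge> 144 gives r \<le> 1/12, so the interval ends no later than
    9/8.\<close>
  define r where "r = 1 / sqrt t"
  have r: "0 < r" "r \<le> 1/12" "r\<^sup>2 = 1 / t" 
  proof -
    have s: "12 \<le> sqrt t" by (rule real_le_rsqrt) (use t in simp)
    show "0 < r" unfolding r_def using t by simp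
    show "r \<le> 1/12" unfolding r_def by (rule divide_left_mono) (use s t in auto)
    show "r\<^sup>2 = 1 / t" using t by (simp add: r_def power_divide)
  qed
  have Em: "E x \<ge> m" if x: "x \<in> {1 + r..1 + 3/2 * r}" for x
  proof -
    have x1: "x > 1" "x \<le> 9/8" using x r by auto
    have "\<bar>x - 1\<bar> \<le> \<bar>3/2 * r\<bar>" using x r by auto
    then have sq: "(x - 1)\<^sup>2 \<le> (3/2 * r)\<^sup>2" using abs_le_square_iff by blast
    have sq': "t * (x - 1)\<^sup>2 \<le> 9/4" using mult_left_mono[OF sq, of t] t r(3) by (simp add: power_mult_distrib power_divide)
    have "\<bar>r\<bar> \<le> \<bar>x - 1\<bar>" using x r by auto
    then have sq2: "r\<^sup>2 \<le> (x - 1)\<^sup>2" using abs_le_square_iff by blast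
    have lo: "1/4 \<le> t * ?p x"
    proof -
      have "ln x \<le> (x - 1) - (x - 1)\<^sup>2 / 4" using ln_lower_quad[of "x - 1"] x1 by simp
      then have "r\<^sup>2 / 4 \<le> ?p x" using sq2 by simp
      then have "t * (r\<^sup>2 / 4) \<le> t * ?p x" using t by (intro mult_left_mono) auto
      then show ?thesis using r t by simp
    qed
    have hi: "t * ?p x \<le> pi"
    proof -
      have "?p x \<le> (x - 1)\<^sup>2 / x" using phase_bounds x1 by auto
      also have "\<dots> \<le> (x - 1)\<^sup>2 / 1" using x1 by (intro divide_left_mono) auto
      finally have "t * ?p x \<le> t * (x - 1)\<^sup>2" using t by simp
      then show ?thesis using sq' pi_gt3 by simp
    qed
    have c: "cos (t * ?p x) \<le> cos (1/4)" by (rule cos_monotone_0_pi_le) (use lo hi in auto)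
    have b: "exp (- 12) \<le> ?\<chi> x"
    proof -
      have a1: "- 4 \<le> - 1 / (x - 3/4)" "- 8 \<le> - 1 / (5/4 - x)" using x1 by (auto simp: field_simps)
      have "exp (- 12) = exp (-4) * exp (- 8 :: real)" by (simp add: mult_exp_exp)
      also have "\<dots> \<le> exp (- 1 / (x - 3/4)) * exp (- 1 / (5/4 - x))"
        using a1 by (intro mult_mono) auto
      also have "\<dots> = ?\<chi> x" using x1 by (simp add: bump_def flat_def)
      finally show ?thesis .
    qed
    have "m = ((1 - cos (1/4)) * exp (- 12)) / (9/4)" by (simp add: m_def)
    also have "\<dots> \<le> ((1 - cos (t * ?p x)) * ?\<chi> x) / (t * (x - 1)\<^sup>2)"
    proof (rule frac_le)
      show "(1 - cos (1/4)) * exp (- 12) \<le> (1 - cos (t * ?p x)) * ?\<chi> x"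
        using b c by (intro mult_mono) auto
    qed (use sq' x1 t bump_nonneg in \<open>auto intro!: mult_nonneg_nonneg\<close>)
    also have "\<dots> \<le> E x" using E0[of x] x1 by simp
    finally show ?thesis .
  qed
  have "m * (1/2 * r) = integral {1 + r..1 + 3/2 * r} (\<lambda>x. m)" using r by simp
  also have "\<dots> = integral {1/2..2} (\<lambda>x. if x \<in> {1 + r..1 + 3/2 * r} then m else 0)"
  proof -
    have "{1 + r..1 + 3/2 * r} \<inter> {1/2..2} = {1 + r..1 + 3/2 * r}" using r by auto
    then show ?thesis by (simp only: Henstock_Kurzweil_Integration.integral_restrict_Int)
  qed
  finally have "m * (1/2 * r) = integral {1/2..2} (\<lambda>x. if x \<in> {1 + r..1 + 3/2 * r} then m else 0)" .
  moreover have "\<dots> \<le> integral {1/2..2} (\<lambda>x. ?\<chi> x * sin (t * ?p x))"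
  proof (rule has_integral_le[OF integrable_integral IE])
    show "(\<lambda>x. if x \<in> {1 + r..1 + 3/2 * r} then m else 0) integrable_on {1/2..2}"
    proof -
      have "{1 + r..1 + 3/2 * r} \<inter> {1/2..2} = {1 + r..1 + 3/2 * r}"
        "{1/2..2} \<inter> {1 + r..1 + 3/2 * r} = {1 + r..1 + 3/2 * r}" using r by auto
      then show ?thesis
        by (simp only: Henstock_Kurzweil_Integration.integrable_restrict_Int) (rule integrable_const_ivl)
    qed
    show "(if x \<in> {1 + r..1 + 3/2 * r} then m else 0) \<le> E x" if "x \<in> {1/2..2}" for x
    proof (cases "x \<in> {1 + r..1 + 3/2 * r}")
      case False
      have "0 \<le> E x"
      proof (cases "x = 1")
        case True then show ?thesis by (simp add: E_def)
      next
        case False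
        have "0 \<le> (1 - cos (t * ?p x)) * ?\<chi> x / (t * (x - 1)\<^sup>2)"
          using t bump_nonneg by (intro divide_nonneg_nonneg mult_nonneg_nonneg) auto
        also have "\<dots> \<le> E x" using E0[of x] False that by auto
        finally show ?thesis .
      qed
      then show ?thesis using False by (simp only: if_False)
    qed (use Em in auto)
  qed
  moreover have "m * (1/2 * r) = (1 - cos (1/4)) * (2/9) * exp (- 12) / sqrt t"
    unfolding m_def r_def using t by (simp add: field_simps)
  ultimately show ?thesis by (simp only:)
qed

text \<open>The imaginary part alone is large enough, and it is odd in t, which reduces negative t
  to positive t.\<close>

lemma oscint_lower:
  obtains c where "c > 0" "\<And>t. \<bar>t\<bar> \<ge> 144 \<Longrightarrow> c / sqrt \<bar>t\<bar> \<le> cmod (oscint t 2)"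
proof
  show "(1 - cos (1/4)) * (2/9) * exp (- 12 :: real) > 0"
    using cos_monotone_0_pi[of 0 "1/4"] pi_gt3 by simp
  fix t :: real assume t: "\<bar>t\<bar> \<ge> 144"
  let ?S = "\<lambda>t. integral {1/2..2} (\<lambda>x. bump (3/4) (5/4) x * sin (t * (x - 1 - ln x)))"
  have int: "osc t integrable_on {1/2..2}"
    using integrable_continuous_real continuous_on_subset[OF smooth_continuous_on[OF smooth_osc]] by blast
  have "Im (oscint t 2) = ?S t"
    unfolding oscint_def using integral_linear[OF int bounded_linear_Im]
    by (simp add: o_def osc_def)
  moreover have "?S (- t) = - ?S t" by simp
  moreover have "\<bar>t\<bar> = t \<or> \<bar>t\<bar> = - t" by linarith
  ultimately have "\<bar>Im (oscint t 2)\<bar> = \<bar>?S \<bar>t\<bar>\<bar>" by (elim disjE) (simp_all only: abs_minus_cancel)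
  also have "\<dots> \<ge> (1 - cos (1/4)) * (2/9) * exp (- 12 :: real) / sqrt \<bar>t\<bar>"
    using osc_sin_lower[OF t] by linarith
  finally show "(1 - cos (1/4)) * (2/9) * exp (- 12 :: real) / sqrt \<bar>t\<bar> \<le> cmod (oscint t 2)"
    using abs_Im_le_cmod[of "oscint t 2"] by linarith
qed

section \<open>Real interpolation bounds\<close>

text \<open>The quadratic K-functional of the orders k and k + 1, isolated from the definition of
  \<open>interp\<close>.\<close>

definition kfun where
  "kfun V N k F \<tau> = Inf {(N k v0)\<^sup>2 + \<tau>\<^sup>2 * (N (Suc k) v1)\<^sup>2 | v0 v1.
     v0 \<in> V \<and> v1 \<in> V \<and> (\<lambda>x. v0 x + v1 x) = F}"
  for V :: "(real^'n::finite \<Rightarrow> complex) set" and N :: "nat \<Rightarrow> (real^'n \<Rightarrow> complex) \<Rightarrow> real"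
    and \<tau> :: real

lemma interp_eq:
  "interp V N r F = (let k = nat \<lfloor>r\<rfloor>; \<theta> = r - real k in
     if \<theta> = 0 then N k F
     else sqrt (2 * sin (pi * \<theta>) / pi * enn2real (\<integral>\<^sup>+ \<tau>. ennreal (indicator {0<..} \<tau> * \<tau> powr (- 2 * \<theta> - 1) * kfun V N k F \<tau>) \<partial>lborel)))"
  unfolding interp_def kfun_def Let_def by simp

lemma kfun_le:
  assumes "v0 \<in> V" "v1 \<in> V" "(\<lambda>x. v0 x + v1 x) = F"
  shows "kfun V N k F \<tau> \<le> (N k v0)\<^sup>2 + \<tau>\<^sup>2 * (N (Suc k) v1)\<^sup>2"
  unfolding kfun_def by (rule cInf_lower) (use assms in \<open>auto intro!: bdd_belowI[of _ 0]\<close>)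

text \<open>Membership of F and 0 in V makes the set of decompositions nonempty, without which its
  infimum would be an arbitrary number.\<close>

lemma kfun_ge:
  assumes "F \<in> V" "(\<lambda>_. 0) \<in> V"
    "\<And>v0 v1. v0 \<in> V \<Longrightarrow> v1 \<in> V \<Longrightarrow> (\<lambda>x. v0 x + v1 x) = F \<Longrightarrow> c \<le> (N k v0)\<^sup>2 + \<tau>\<^sup>2 * (N (Suc k) v1)\<^sup>2"
  shows "c \<le> kfun V N k F \<tau>"
  unfolding kfun_def
proof (rule cInf_greatest)
  have "(\<lambda>x. F x + (\<lambda>_. 0) x) = F" by simp
  then show "{(N k v0)\<^sup>2 + \<tau>\<^sup>2 * (N (Suc k) v1)\<^sup>2 |v0 v1. v0 \<in> V \<and> v1 \<in> V \<and> (\<lambda>x. v0 x + v1 x) = F} \<noteq> {}"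
    using assms(1,2) by blast
qed (use assms(3) in auto)

text \<open>The K-method integrand for the model bound min 1 \<tau>^2, which the two trivial
  decompositions F + 0 and 0 + F produce.\<close>

definition kweight :: "real \<Rightarrow> real \<Rightarrow> real" where
  "kweight \<theta> \<tau> = indicator {0<..} \<tau> * \<tau> powr (- 2 * \<theta> - 1) * min 1 (\<tau>\<^sup>2)"

lemma kweight_measurable [measurable]: "kweight \<theta> \<in> borel_measurable borel"
  unfolding kweight_def by measurable

text \<open>Near 0 the exponent 1 - 2 \<theta> exceeds -1, and beyond 1 the exponent - 2 \<theta> -
  1 is below -1; the two strict bounds on \<theta> give one each.\<close>

lemma kweight_finite:
  assumes "0 < \<theta>" "\<theta> < 1"
  shows "(\<integral>\<^sup>+ \<tau>. ennreal (kweight \<theta> \<tau>) \<partial>lborel) < \<infinity>"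
proof -
  let ?f = "\<lambda>\<tau>::real. indicator {0..1} \<tau> * \<tau> powr (1 - 2 * \<theta>)"
  let ?g = "\<lambda>\<tau>::real. indicator {1..} \<tau> * \<tau> powr (- 2 * \<theta> - 1)"
  have restr: "((\<lambda>x. indicator S x * h x) has_integral I) UNIV \<longleftrightarrow> (h has_integral I) S" for S h and I :: real
  proof -
    have "(\<lambda>x. indicator S x * h x) = (\<lambda>x. if x \<in> S then h x else 0)" by (auto simp: indicator_def)
    then show ?thesis by (simp only: has_integral_restrict_UNIV)
  qed
  have "((\<lambda>x. x powr (1 - 2 * \<theta>)) has_integral (1 powr (1 - 2 * \<theta> + 1) / (1 - 2 * \<theta> + 1))) {0..1::real}"
    by (rule has_integral_powr_from_0) (use assms in auto)
  then have "(\<integral>\<^sup>+ \<tau>. ennreal (?f \<tau>) \<partial>lborel) = ennreal (1 powr (1 - 2 * \<theta> + 1) / (1 - 2 * \<theta> + 1))"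
    by (intro nn_integral_has_integral_lborel) (auto simp: restr)
  then have f: "(\<integral>\<^sup>+ \<tau>. ennreal (?f \<tau>) \<partial>lborel) < \<infinity>" by simp
  have "((\<lambda>x. x powr (- 2 * \<theta> - 1)) has_integral (- (1 powr (- 2 * \<theta> - 1 + 1)) / (- 2 * \<theta> - 1 + 1))) {1..}"
    by (rule has_integral_powr_to_inf) (use assms in auto)
  then have "(\<integral>\<^sup>+ \<tau>. ennreal (?g \<tau>) \<partial>lborel) = ennreal (- (1 powr (- 2 * \<theta> - 1 + 1)) / (- 2 * \<theta> - 1 + 1))"
    by (intro nn_integral_has_integral_lborel) (auto simp: restr)
  then have g: "(\<integral>\<^sup>+ \<tau>. ennreal (?g \<tau>) \<partial>lborel) < \<infinity>" by simp
  have "(\<integral>\<^sup>+ \<tau>. ennreal (kweight \<theta> \<tau>) \<partial>lborel) \<le> (\<integral>\<^sup>+ \<tau>. ennreal (?f \<tau>) + ennreal (?g \<tau>) \<partial>lborel)"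
  proof (rule nn_integral_mono)
    fix \<tau> :: real
    have "kweight \<theta> \<tau> \<le> ?f \<tau> + ?g \<tau>"
    proof (cases "0 < \<tau>")
      case True
      have "\<tau> powr (- 2 * \<theta> - 1) * \<tau>\<^sup>2 = \<tau> powr (1 - 2 * \<theta>)"
        using True by (simp add: powr_add[symmetric] flip: powr_numeral)
      moreover have "\<tau> powr (- 2 * \<theta> - 1) * min 1 (\<tau>\<^sup>2) \<le> \<tau> powr (- 2 * \<theta> - 1) * \<tau>\<^sup>2"
        "\<tau> powr (- 2 * \<theta> - 1) * min 1 (\<tau>\<^sup>2) \<le> \<tau> powr (- 2 * \<theta> - 1) * 1"
        by (rule mult_left_mono; simp)+
      ultimately show ?thesis using True
        by (cases "\<tau> \<le> 1") (auto simp: kweight_def indicator_def)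
    qed (simp add: kweight_def indicator_def)
    then have "ennreal (kweight \<theta> \<tau>) \<le> ennreal (?f \<tau> + ?g \<tau>)" by (rule ennreal_leI)
    then show "ennreal (kweight \<theta> \<tau>) \<le> ennreal (?f \<tau>) + ennreal (?g \<tau>)" by (simp flip: ennreal_plus)
  qed
  also have "\<dots> = (\<integral>\<^sup>+ \<tau>. ennreal (?f \<tau>) \<partial>lborel) + (\<integral>\<^sup>+ \<tau>. ennreal (?g \<tau>) \<partial>lborel)"
    by (rule nn_integral_add) auto
  also have "\<dots> < \<infinity>" using f g by (simp add: ennreal_add_less_top)
  finally show ?thesis .
qed

text \<open>The trivial decompositions bound the K-functional by (C T^k)^2 min 1 ((T \<tau>)^2).
  Substituting \<tau> / T for \<tau> then extracts the fractional power of T and leaves an integral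
  that depends on \<theta> only.\<close>

lemma kfun_integral_le:
  assumes "0 < \<theta>" "\<theta> < 1" "F \<in> V" "(\<lambda>_. 0) \<in> V" "N k (\<lambda>_. 0) = 0" "N (Suc k) (\<lambda>_. 0) = 0"
    "0 \<le> N k F" "0 \<le> N (Suc k) F"
    "T > 0" "C \<ge> 0" "N k F \<le> C * T ^ k" "N (Suc k) F \<le> C * T ^ Suc k"
  shows "(\<integral>\<^sup>+ \<tau>. ennreal (indicator {0<..} \<tau> * \<tau> powr (- 2 * \<theta> - 1) * kfun V N k F \<tau>) \<partial>lborel)
    \<le> ennreal (C\<^sup>2 * T powr (2 * (real k + \<theta>))) * (\<integral>\<^sup>+ \<tau>. ennreal (kweight \<theta> \<tau>) \<partial>lborel)"
proof -
  let ?c = "C\<^sup>2 * T powr (2 * (real k + \<theta>))"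
  have "indicator {0<..} \<tau> * \<tau> powr (- 2 * \<theta> - 1) * kfun V N k F \<tau> \<le> (?c * T) * kweight \<theta> (0 + T * \<tau>)" for \<tau>
  proof (cases "\<tau> > 0")
    case True
    have z1: "kfun V N k F \<tau> \<le> (N k F)\<^sup>2"
      using kfun_le[of F V "\<lambda>_. 0" F N k \<tau>] assms by simp
    have z2: "kfun V N k F \<tau> \<le> \<tau>\<^sup>2 * (N (Suc k) F)\<^sup>2"
      using kfun_le[of "\<lambda>_. 0" V F F N k \<tau>] assms by simp
    have b1: "(N k F)\<^sup>2 \<le> (C * T ^ k)\<^sup>2" "(N (Suc k) F)\<^sup>2 \<le> (C * T ^ Suc k)\<^sup>2"
      using assms by (auto intro: power_mono)
    have "kfun V N k F \<tau> \<le> (C * T ^ k)\<^sup>2" using z1 b1 by simp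
    moreover have "kfun V N k F \<tau> \<le> (C * T ^ k)\<^sup>2 * (T * \<tau>)\<^sup>2"
    proof -
      have "\<tau>\<^sup>2 * (N (Suc k) F)\<^sup>2 \<le> \<tau>\<^sup>2 * (C * T ^ Suc k)\<^sup>2" by (rule mult_left_mono[OF b1(2)]) simp
      also have "\<dots> = (C * T ^ k)\<^sup>2 * (T * \<tau>)\<^sup>2" by (simp add: power_mult_distrib algebra_simps)
      finally show ?thesis using z2 by simp
    qed
    ultimately have kf: "kfun V N k F \<tau> \<le> (C * T ^ k)\<^sup>2 * min 1 ((T * \<tau>)\<^sup>2)"
      by (simp add: min_def)
    have Tk: "(T ^ k)\<^sup>2 = T powr (2 * real k)"
      using assms(9) by (simp add: powr_realpow[symmetric] powr_powr mult.commute flip: powr_numeral)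
    have "(?c * T) * (T * \<tau>) powr (- 2 * \<theta> - 1) = C\<^sup>2 * (T powr (2 * (real k + \<theta>)) * T powr 1 * T powr (- 2 * \<theta> - 1)) * \<tau> powr (- 2 * \<theta> - 1)"
      using assms(9) True by (simp add: powr_mult)
    also have "T powr (2 * (real k + \<theta>)) * T powr 1 * T powr (- 2 * \<theta> - 1) = (T ^ k)\<^sup>2"
      unfolding powr_add[symmetric] Tk by (simp add: algebra_simps)
    finally have e: "(?c * T) * (T * \<tau>) powr (- 2 * \<theta> - 1) = (C * T ^ k)\<^sup>2 * \<tau> powr (- 2 * \<theta> - 1)"
      by (simp add: power_mult_distrib)
    have "\<tau> powr (- 2 * \<theta> - 1) * kfun V N k F \<tau> \<le> \<tau> powr (- 2 * \<theta> - 1) * ((C * T ^ k)\<^sup>2 * min 1 ((T * \<tau>)\<^sup>2))"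
      by (rule mult_left_mono[OF kf]) simp
    also have "\<dots> = ((C * T ^ k)\<^sup>2 * \<tau> powr (- 2 * \<theta> - 1)) * min 1 ((T * \<tau>)\<^sup>2)" by simp
    also have "\<dots> = (?c * T) * (T * \<tau>) powr (- 2 * \<theta> - 1) * min 1 ((T * \<tau>)\<^sup>2)" unfolding e ..
    finally show ?thesis using True assms(9) by (simp add: kweight_def algebra_simps)
  qed (use assms(9) in \<open>simp add: kweight_def indicator_def zero_less_mult_iff\<close>)
  then have "(\<integral>\<^sup>+ \<tau>. ennreal (indicator {0<..} \<tau> * \<tau> powr (- 2 * \<theta> - 1) * kfun V N k F \<tau>) \<partial>lborel)
     \<le> (\<integral>\<^sup>+ \<tau>. ennreal (?c * T) * ennreal (kweight \<theta> (0 + T * \<tau>)) \<partial>lborel)"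
    using assms(9) by (intro nn_integral_mono) (auto simp flip: ennreal_mult' intro!: ennreal_leI)
  also have "\<dots> = ennreal (?c * T) * (\<integral>\<^sup>+ \<tau>. ennreal (kweight \<theta> (0 + T * \<tau>)) \<partial>lborel)"
    by (rule nn_integral_cmult) measurable
  also have "\<dots> = ennreal ?c * (ennreal T * (\<integral>\<^sup>+ \<tau>. ennreal (kweight \<theta> (0 + T * \<tau>)) \<partial>lborel))"
    using assms(9) by (simp add: ennreal_mult mult.assoc)
  also have "ennreal T * (\<integral>\<^sup>+ \<tau>. ennreal (kweight \<theta> (0 + T * \<tau>)) \<partial>lborel) = (\<integral>\<^sup>+ \<tau>. ennreal (kweight \<theta> \<tau>) \<partial>lborel)"
    using nn_integral_real_affine[of "\<lambda>\<tau>. ennreal (kweight \<theta> \<tau>)" T 0] assms(9) by simp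
  finally show ?thesis .
qed

lemma nat_floor_bounds:
  assumes "r \<ge> 0" "r - real (nat \<lfloor>r\<rfloor>) \<noteq> 0"
  shows "0 < r - real (nat \<lfloor>r\<rfloor>)" "r - real (nat \<lfloor>r\<rfloor>) < 1"
  using assms by linarith+

definition interp_upper :: "real \<Rightarrow> real" where
  "interp_upper r = (let \<theta> = r - real (nat \<lfloor>r\<rfloor>) in
     if \<theta> = 0 then 1 else sqrt (2 * sin (pi * \<theta>) / pi * enn2real (\<integral>\<^sup>+ \<tau>. ennreal (kweight \<theta> \<tau>) \<partial>lborel)))"

lemma sin_theta:
  assumes "0 < \<theta>" "\<theta> < 1"
  shows "sin (pi * \<theta>) > 0"
  using assms by (intro sin_gt_zero) auto

lemma interp_upper_nonneg: "r \<ge> 0 \<Longrightarrow> interp_upper r \<ge> 0"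
  using sin_theta[OF nat_floor_bounds] by (auto simp: interp_upper_def Let_def less_imp_le)

lemma interp_le:
  fixes V :: "(real^'n::finite \<Rightarrow> complex) set"
  assumes "r \<ge> 0" "F \<in> V" "(\<lambda>_. 0) \<in> V" "\<And>k. N k (\<lambda>_. 0) = 0" "\<And>k. 0 \<le> N k F"
    "T > 0" "C \<ge> 0" "\<And>k. k \<le> Suc (nat \<lfloor>r\<rfloor>) \<Longrightarrow> N k F \<le> C * T ^ k"
  shows "interp V N r F \<le> interp_upper r * C * T powr r"
proof (cases "r - real (nat \<lfloor>r\<rfloor>) = 0")
  case True
  then have "r = real (nat \<lfloor>r\<rfloor>)" by simp
  then have "T powr r = T ^ nat \<lfloor>r\<rfloor>" using assms(6) by (metis powr_realpow)
  then show ?thesis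
    using True assms(8)[of "nat \<lfloor>r\<rfloor>"] by (simp add: interp_eq interp_upper_def Let_def)
next
  case False
  define k where "k = nat \<lfloor>r\<rfloor>"
  define \<theta> where "\<theta> = r - real k"
  have th: "0 < \<theta>" "\<theta> < 1" using nat_floor_bounds[OF assms(1) False] by (auto simp: \<theta>_def k_def)
  have rk: "r \<noteq> real k" using th by (simp add: \<theta>_def)
  define Z where "Z = enn2real (\<integral>\<^sup>+ \<tau>. ennreal (kweight \<theta> \<tau>) \<partial>lborel)"
  have Z: "(\<integral>\<^sup>+ \<tau>. ennreal (kweight \<theta> \<tau>) \<partial>lborel) = ennreal Z"
    using kweight_finite[OF th] by (simp add: Z_def less_top)
  have Z0: "Z \<ge> 0" by (simp add: Z_def)
  note s = sin_theta[OF th]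
  have "(\<integral>\<^sup>+ \<tau>. ennreal (indicator {0<..} \<tau> * \<tau> powr (- 2 * \<theta> - 1) * kfun V N k F \<tau>) \<partial>lborel)
     \<le> ennreal (C\<^sup>2 * T powr (2 * (real k + \<theta>))) * ennreal Z"
    unfolding Z[symmetric] by (rule kfun_integral_le) (use assms th assms(8)[of "Suc k"] in \<open>auto simp: k_def\<close>)
  also have "\<dots> = ennreal (C\<^sup>2 * T powr (2 * r) * Z)"
    using Z0 by (simp add: ennreal_mult \<theta>_def)
  finally have le: "enn2real (\<integral>\<^sup>+ \<tau>. ennreal (indicator {0<..} \<tau> * \<tau> powr (- 2 * \<theta> - 1) * kfun V N k F \<tau>) \<partial>lborel)
     \<le> C\<^sup>2 * T powr (2 * r) * Z"
    using Z0 by (intro enn2real_leI) auto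
  have Tr: "T powr (2 * r) = (T powr r)\<^sup>2" using assms(6) by (simp add: powr_powr mult.commute flip: powr_numeral)
  have "interp V N r F \<le> sqrt (2 * sin (pi * \<theta>) / pi * (C\<^sup>2 * T powr (2 * r) * Z))"
    using rk s le by (simp add: interp_eq Let_def \<theta>_def[symmetric] k_def[symmetric] mult_left_mono divide_right_mono)
  also have "\<dots> = sqrt (2 * sin (pi * \<theta>) / pi * Z) * C * T powr r"
    using assms(7) unfolding Tr by (simp add: real_sqrt_mult real_sqrt_divide)
  also have "sqrt (2 * sin (pi * \<theta>) / pi * Z) = interp_upper r"
    using rk by (simp add: interp_upper_def Let_def Z_def \<theta>_def k_def)
  finally show ?thesis .
qed

text \<open>The constant obtained by restricting the K-method integral to \<open>[1/T, 2/T]\<close>.\<close>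
definition interp_lower :: "real \<Rightarrow> real" where
  "interp_lower r = (let \<theta> = r - real (nat \<lfloor>r\<rfloor>) in
     if \<theta> = 0 then 1 else sqrt (2 * sin (pi * \<theta>) / pi * (2 powr (- 2 * \<theta> - 1) / 2)))"

lemma interp_lower_pos: "r \<ge> 0 \<Longrightarrow> interp_lower r > 0"
  using sin_theta[OF nat_floor_bounds] by (auto simp: interp_lower_def Let_def)

text \<open>A bound on the sum at the one parameter 1 / T suffices: raising \<tau> only raises the
  cost of v1, so the bound persists on the interval up to 2 / T. There the weight is of order
  \<open>T powr (2 * \<theta> + 1)\<close>, and the length 1 / T of the interval leaves the
  fractional power that was missing.\<close>

lemma interp_ge:
  fixes V :: "(real^'n::finite \<Rightarrow> complex) set"
  assumes "r \<ge> 0" "F \<in> V" "(\<lambda>_. 0) \<in> V" "\<And>k. N k (\<lambda>_. 0) = 0" "\<And>k v. 0 \<le> N k v"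
    "T > 0" "A \<ge> 0"
    "\<And>v0 v1. v0 \<in> V \<Longrightarrow> v1 \<in> V \<Longrightarrow> (\<lambda>x. v0 x + v1 x) = F \<Longrightarrow>
        A * T ^ nat \<lfloor>r\<rfloor> \<le> N (nat \<lfloor>r\<rfloor>) v0 + N (Suc (nat \<lfloor>r\<rfloor>)) v1 / T"
  shows "interp_lower r * A * T powr r \<le> interp V N r F"
proof (cases "r - real (nat \<lfloor>r\<rfloor>) = 0")
  case True
  then have "r = real (nat \<lfloor>r\<rfloor>)" by simp
  then have "T powr r = T ^ nat \<lfloor>r\<rfloor>" using assms(6) by (metis powr_realpow)
  moreover have "A * T ^ nat \<lfloor>r\<rfloor> \<le> N (nat \<lfloor>r\<rfloor>) F + N (Suc (nat \<lfloor>r\<rfloor>)) (\<lambda>_. 0) / T"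
    using assms(8)[of F "\<lambda>_. 0"] assms(2,3) by simp
  ultimately show ?thesis
    using True assms(4) by (simp add: interp_eq interp_lower_def Let_def)
next
  case False
  define k where "k = nat \<lfloor>r\<rfloor>"
  define \<theta> where "\<theta> = r - real k"
  have th: "0 < \<theta>" "\<theta> < 1" using nat_floor_bounds[OF assms(1) False] by (auto simp: \<theta>_def k_def)
  have rk: "r \<noteq> real k" using th by (simp add: \<theta>_def)
  define a where "a = 2 powr (- 2 * \<theta> - 1) / (2::real)"
  have a: "a > 0" by (simp add: a_def)
  note s = sin_theta[OF th]
  let ?I = "\<integral>\<^sup>+ \<tau>. ennreal (indicator {0<..} \<tau> * \<tau> powr (- 2 * \<theta> - 1) * kfun V N k F \<tau>) \<partial>lborel"
  \<comment> \<open>The upper bound at T = 1 shows that the integral is finite. For an infinite one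
    \<open>enn2real\<close> would return 0 and the lower bound would be lost.\<close>
  define C where "C = N k F + N (Suc k) F"
  have "?I \<le> ennreal (C\<^sup>2 * 1 powr (2 * (real k + \<theta>))) * (\<integral>\<^sup>+ \<tau>. ennreal (kweight \<theta> \<tau>) \<partial>lborel)"
    by (rule kfun_integral_le) (use assms th in \<open>auto simp: C_def\<close>)
  also have "\<dots> < \<infinity>" using kweight_finite[OF th] by (auto simp: ennreal_mult_less_top)
  finally have fin: "?I < \<infinity>" .
  define c where "c = (2 / T) powr (- 2 * \<theta> - 1) * ((A * T ^ k)\<^sup>2 / 2)"
  have low: "c \<le> \<tau> powr (- 2 * \<theta> - 1) * kfun V N k F \<tau>" if "\<tau> \<in> {1 / T..2 / T}" for \<tau>
  proof -
    have tau: "\<tau> > 0" using that assms(6) by (auto intro: less_le_trans[of _ "1/T"])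
    have "(A * T ^ k)\<^sup>2 / 2 \<le> kfun V N k F \<tau>"
    proof (rule kfun_ge)
      fix v0 v1 assume v: "v0 \<in> V" "v1 \<in> V" "(\<lambda>x. v0 x + v1 x) = F"
      let ?x = "N k v0" and ?y = "N (Suc k) v1 / T"
      have xy: "?x \<ge> 0" "?y \<ge> 0" using assms by auto
      have "A * T ^ k \<le> ?x + ?y" using assms(8) v k_def by auto
      then have "(A * T ^ k)\<^sup>2 \<le> (?x + ?y)\<^sup>2" using assms by (intro power_mono) auto
      also have "\<dots> \<le> 2 * (?x\<^sup>2 + ?y\<^sup>2)" using sum_squares_bound[of ?x ?y] by (simp add: power2_sum)
      also have "?y\<^sup>2 = (1 / T)\<^sup>2 * (N (Suc k) v1)\<^sup>2" by (simp add: power_divide)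
      also have "2 * (?x\<^sup>2 + \<dots>) \<le> 2 * (?x\<^sup>2 + \<tau>\<^sup>2 * (N (Suc k) v1)\<^sup>2)"
        using that assms(6) by (intro mult_left_mono add_left_mono mult_right_mono power_mono) auto
      finally show "(A * T ^ k)\<^sup>2 / 2 \<le> (N k v0)\<^sup>2 + \<tau>\<^sup>2 * (N (Suc k) v1)\<^sup>2" by simp
    qed (use assms in auto)
    moreover have "(2 / T) powr (- 2 * \<theta> - 1) \<le> \<tau> powr (- 2 * \<theta> - 1)"
      using that tau th assms(6) by (intro powr_mono2') auto
    ultimately show ?thesis unfolding c_def by (intro mult_mono) auto
  qed
  have c0: "c \<ge> 0" by (simp add: c_def)
  have "ennreal (c / T) = ennreal c * emeasure lborel {1 / T..2 / T}"
    using assms(6) c0 by (simp add: ennreal_mult[symmetric] divide_right_mono diff_divide_distrib[symmetric])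
  also have "\<dots> = (\<integral>\<^sup>+ \<tau>. ennreal c * indicator {1 / T..2 / T} \<tau> \<partial>lborel)"
    by (rule nn_integral_cmult_indicator[symmetric]) simp
  also have "\<dots> \<le> ?I"
  proof (rule nn_integral_mono)
    fix \<tau> show "ennreal c * indicator {1 / T..2 / T} \<tau> \<le> ennreal (indicator {0<..} \<tau> * \<tau> powr (- 2 * \<theta> - 1) * kfun V N k F \<tau>)"
    proof (cases "\<tau> \<in> {1 / T..2 / T}")
      case True
      then have "\<tau> > 0" using assms(6) by (auto intro: less_le_trans[of _ "1/T"])
      then show ?thesis using low[OF True] True by (auto intro: ennreal_leI)
    qed simp
  qed
  finally have "c / T \<le> enn2real ?I"
    using fin c0 assms(6) by (metis enn2real_ennreal enn2real_mono divide_nonneg_pos infinity_ennreal_def)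
  moreover have "c / T = a * (A * T powr r)\<^sup>2"
  proof -
    have Tk: "(T ^ k)\<^sup>2 = T powr (2 * real k)"
      using assms(6) by (simp add: powr_realpow[symmetric] powr_powr mult.commute flip: powr_numeral)
    have Tr: "(T powr r)\<^sup>2 = T powr (2 * r)" using assms(6) by (simp add: powr_powr mult.commute flip: powr_numeral)
    have "- 2 * \<theta> - 1 = - (2 * \<theta> + 1)" by simp
    then have "T powr (- 2 * \<theta> - 1) = inverse (T powr (2 * \<theta> + 1))" by (simp only: powr_minus)
    then have e: "(2 / T) powr (- 2 * \<theta> - 1) = 2 powr (- 2 * \<theta> - 1) * T powr (2 * \<theta> + 1)"
      using assms(6) by (simp only: powr_divide) (simp add: divide_inverse)
    have iT: "T powr (- 1) = 1 / T" using assms(6) by (simp add: powr_minus divide_inverse)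
    have "c / T = a * A\<^sup>2 * (T powr (2 * \<theta> + 1) * T powr (2 * real k) * T powr (- 1))"
      unfolding c_def a_def power_mult_distrib Tk e iT by simp
    also have "T powr (2 * \<theta> + 1) * T powr (2 * real k) * T powr (- 1) = T powr (2 * r)"
      unfolding powr_add[symmetric] by (simp add: \<theta>_def algebra_simps)
    finally show ?thesis by (simp add: power_mult_distrib Tr)
  qed
  ultimately have "a * (A * T powr r)\<^sup>2 \<le> enn2real ?I" by simp
  then have "sqrt (2 * sin (pi * \<theta>) / pi * (a * (A * T powr r)\<^sup>2)) \<le> interp V N r F"
    using rk s by (simp add: interp_eq Let_def \<theta>_def[symmetric] k_def[symmetric] mult_left_mono divide_right_mono)
  moreover have "sqrt (2 * sin (pi * \<theta>) / pi * (a * (A * T powr r)\<^sup>2)) = sqrt (2 * sin (pi * \<theta>) / pi * a) * A * T powr r"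
    using assms(6,7) by (simp add: real_sqrt_mult real_sqrt_divide)
  moreover have "sqrt (2 * sin (pi * \<theta>) / pi * a) = interp_lower r"
    using rk by (simp add: interp_lower_def Let_def a_def \<theta>_def k_def)
  ultimately show ?thesis by simp
qed

section \<open>The Lie algebra action on conic symbols\<close>

lemma axis_in_Basis [simp]: "axis k (1::real) \<in> (Basis :: (real^'n::finite) set)"
  by (simp add: axis_in_Basis_iff)

lemma dpi_dd: "dpi X F x = - (\<Sum>k\<in>UNIV. \<Sum>l\<in>UNIV. complex_of_real (X$k$l * x$l) * dd (axis k 1) F x)"
  by (simp add: dpi_def pd_eq_dd)

lemma dpi_elem_mat: "dpi (elem_mat a b) F x = - (complex_of_real (x$b) * dd (axis a 1) F x)"
proof -
  have "(\<Sum>l\<in>UNIV. complex_of_real (elem_mat a b$k$l * x$l) * dd (axis k 1) F x)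
      = (if k = a then complex_of_real (x$b) * dd (axis k 1) F x else 0)" for k
    by (simp add: elem_mat_def if_distrib[where f = "\<lambda>u. u * _"] if_distrib[where f = complex_of_real] cong: if_cong)
  then show ?thesis unfolding dpi_dd by simp
qed

lemma smooth_dpi:
  assumes "open S" "smooth S F"
  shows "smooth S (dpi X F)"
proof -
  have "dpi X F = (\<lambda>x. - (\<Sum>k\<in>UNIV. \<Sum>l\<in>UNIV. complex_of_real (X$k$l * x$l) * dd (axis k 1) F x))"
    by (simp add: dpi_dd fun_eq_iff)
  then show ?thesis using assms
    by (auto intro!: smooth_minus smooth_sum smooth_mult smooth_of_real smooth_const smooth_nth smooth_dd)
qed

lemma dpi_cong:
  assumes "open S" "x \<in> S" "\<And>y. y \<in> S \<Longrightarrow> F y = G y"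
  shows "dpi X F x = dpi X G x"
  unfolding dpi_dd using dd_cong[OF assms] by simp

lemma dd_sum:
  fixes c :: "'i \<Rightarrow> complex"
  assumes "\<And>i. i \<in> I \<Longrightarrow> F i differentiable (at x)"
  shows "dd b (\<lambda>x. \<Sum>i\<in>I. c i * F i x) x = (\<Sum>i\<in>I. c i * dd b (F i) x)"
proof -
  have d: "(F i has_derivative (\<lambda>b. dd b (F i) x)) (at x)" if "i \<in> I" for i
    using assms[OF that] dd_eq unfolding differentiable_def by (metis (no_types, lifting) ext)
  have "((\<lambda>x. \<Sum>i\<in>I. c i * F i x) has_derivative (\<lambda>b. \<Sum>i\<in>I. c i * dd b (F i) x)) (at x)"
    by (rule has_derivative_sum) (auto intro!: has_derivative_mult_right d)
  then show ?thesis by (rule dd_eq)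
qed

lemma dpi_sum:
  assumes "\<And>i. i \<in> I \<Longrightarrow> F i differentiable (at x)"
  shows "dpi X (\<lambda>x. \<Sum>i\<in>I. c i * F i x) x = (\<Sum>i\<in>I. c i * dpi X (F i) x)"
proof -
  have D: "dd b (\<lambda>x. \<Sum>i\<in>I. c i * F i x) x = (\<Sum>i\<in>I. c i * dd b (F i) x)" for b
    by (rule dd_sum[OF assms])
  have "(\<Sum>k\<in>UNIV. \<Sum>l\<in>UNIV. complex_of_real (X$k$l * x$l) * (\<Sum>i\<in>I. c i * dd (axis k 1) (F i) x))
    = (\<Sum>k\<in>UNIV. \<Sum>l\<in>UNIV. \<Sum>i\<in>I. c i * (complex_of_real (X$k$l * x$l) * dd (axis k 1) (F i) x))"
    by (simp add: sum_distrib_left algebra_simps)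
  also have "\<dots> = (\<Sum>k\<in>UNIV. \<Sum>i\<in>I. \<Sum>l\<in>UNIV. c i * (complex_of_real (X$k$l * x$l) * dd (axis k 1) (F i) x))"
    by (intro sum.cong refl sum.swap)
  also have "\<dots> = (\<Sum>i\<in>I. c i * (\<Sum>k\<in>UNIV. \<Sum>l\<in>UNIV. complex_of_real (X$k$l * x$l) * dd (axis k 1) (F i) x))"
    by (subst sum.swap) (simp add: sum_distrib_left)
  finally show ?thesis
    unfolding dpi_dd D by (simp only: mult_minus_right sum_negf)
qed

lemma act_word_simps [simp]: "act_word [] F = F" "act_word (X # w) F = dpi X (act_word w F)"
  "act_word (w @ [X]) F = act_word w (dpi X F)"
  by (simp_all add: act_word_def)

lemma smooth_act_word: "open S \<Longrightarrow> smooth S F \<Longrightarrow> smooth S (act_word w F)"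
  by (induction w) (auto intro: smooth_dpi)

lemma act_word_sum:
  assumes "open S" "\<And>i. i \<in> I \<Longrightarrow> smooth S (F i)" "x \<in> S"
  shows "act_word w (\<lambda>x. \<Sum>i\<in>I. c i * F i x) x = (\<Sum>i\<in>I. c i * act_word w (F i) x)"
  using assms(3)
proof (induction w arbitrary: x)
  case (Cons X w)
  have "act_word (X # w) (\<lambda>x. \<Sum>i\<in>I. c i * F i x) x = dpi X (\<lambda>x. \<Sum>i\<in>I. c i * act_word w (F i) x) x"
    unfolding act_word_simps by (rule dpi_cong[OF assms(1) Cons.prems Cons.IH])
  also have "\<dots> = (\<Sum>i\<in>I. c i * dpi X (act_word w (F i)) x)"
    by (rule dpi_sum) (use smooth_differentiable[OF smooth_act_word[OF assms(1,2)]] Cons.prems in auto)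
  finally show ?case by simp
qed simp

section \<open>Dilated symbols supported in a cone\<close>

definition scal :: "('n::finite \<Rightarrow> real) \<Rightarrow> real^'n \<Rightarrow> real^'n" where
  "scal d x = (\<chi> k. d k * x $ k)"

lemma scal_nth [simp]: "scal d x $ k = d k * x $ k" by (simp add: scal_def)

lemma bounded_linear_scal: "bounded_linear (scal d)"
  by (rule linear_conv_bounded_linear[THEN iffD1])
    (auto simp: linear_iff scal_def vec_eq_iff algebra_simps)

lemma scal_axis: "scal d (axis k 1) = d k *\<^sub>R axis k 1"
  by (auto simp: scal_def axis_def vec_eq_iff)

lemma dd_scal:
  assumes "\<Phi> differentiable (at (scal d x))"
  shows "dd (axis k 1) (\<lambda>x. \<Phi> (scal d x)) x = d k *\<^sub>R dd (axis k 1) \<Phi> (scal d x)"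
proof -
  obtain P where P: "(\<Phi> has_derivative P) (at (scal d x))" using assms unfolding differentiable_def by blast
  have "((\<lambda>x. \<Phi> (scal d x)) has_derivative (\<lambda>h. P (scal d h))) (at x)"
    by (rule has_derivative_compose[OF bounded_linear_imp_has_derivative[OF bounded_linear_scal] P])
  from dd_eq[OF this] show ?thesis
    using dd_eq[OF P] has_derivative_bounded_linear[OF P] by (simp add: scal_axis linear_simps)
qed

lemma open_scal: "open S \<Longrightarrow> open {x. scal d x \<in> S}"
  using open_vimage[of S "scal d"] linear_continuous_on[OF bounded_linear_scal, of UNIV d]
  by (simp add: vimage_def)

lemma smooth_scal:
  assumes "open S" "smooth S \<Phi>"
  shows "smooth {x. scal d x \<in> S} (\<lambda>x. \<Phi> (scal d x))"
proof -
  have "Ck m {x. scal d x \<in> S} (\<lambda>x. \<Phi> (scal d x))" if "Ck m S \<Phi>" for m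
    using that
  proof (induction m arbitrary: \<Phi>)
    case (Suc m)
    have 1: "(\<lambda>x. \<Phi> (scal d x)) differentiable (at x)" if "scal d x \<in> S" for x
      using Suc.prems that bounded_linear_imp_differentiable[OF bounded_linear_scal]
      by (metis Ck.simps(2) differentiable_compose)
    have "Ck m {x. scal d x \<in> S} (dd b (\<lambda>x. \<Phi> (scal d x)))" if "b \<in> Basis" for b
    proof -
      from that obtain k where b: "b = axis k 1" by (auto simp: Basis_vec_def)
      have "Ck m {x. scal d x \<in> S} (\<lambda>x. d k *\<^sub>R dd b \<Phi> (scal d x))"
        by (rule Ck_bounded_linear[OF bounded_linear_scaleR_right open_scal[OF assms(1)]])
          (use Suc that in auto)
      then show ?thesis
        by (rule Ck_cong[OF open_scal[OF assms(1)]]) (use Suc.prems in \<open>simp_all add: b dd_scal\<close>)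
    qed
    with 1 show ?case by simp
  qed auto
  then show ?thesis using assms(2) by (simp add: smooth_def)
qed

text \<open>The cone condition makes the symbol vanish near every nonzero point of the hyperplane
  \<open>x $ p = 0\<close>, where the character and the quotients by \<open>x $ p\<close> are
  singular.\<close>

definition cone_supp :: "'n \<Rightarrow> real \<Rightarrow> (real^'n::finite \<Rightarrow> complex) \<Rightarrow> bool" where
  "cone_supp p M \<Phi> \<longleftrightarrow> smooth {x. x $ p \<noteq> 0} \<Phi> \<and> (\<forall>x. (\<exists>k. \<bar>x $ k\<bar> > M * \<bar>x $ p\<bar>) \<longrightarrow> \<Phi> x = 0)"

text \<open>In the norm estimates t enters through the character and the dilation d alone, so that
  finitely many fixed symbols give bounds uniform in t.\<close>

definition wfun :: "'n \<Rightarrow> bool \<Rightarrow> real \<Rightarrow> ('n \<Rightarrow> real) \<Rightarrow> (real^'n::finite \<Rightarrow> complex) \<Rightarrow> real^'n \<Rightarrow> complex" where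
  "wfun p pm t d \<Phi> x = mc CARD('n) pm t (x $ p) * \<Phi> (scal d x)"

lemma open_nth_neq: "open {x::real^'n::finite. x $ p \<noteq> 0}"
  by (intro open_Collect_neq continuous_intros)

lemma open_cone_compl: "open {x::real^'n::finite. \<bar>x $ k\<bar> > M * \<bar>x $ p\<bar>}"
  by (intro open_Collect_less continuous_intros)

lemma wfun_zero_nbhd:
  fixes \<Phi> :: "real^'n::finite \<Rightarrow> complex"
  assumes "cone_supp p M \<Phi>" "d p = 1" "\<And>k. d k \<noteq> 0" "x \<noteq> 0" "x $ p = 0"
  obtains U where "open U" "x \<in> U" "\<And>y. y \<in> U \<Longrightarrow> wfun p pm t d \<Phi> y = 0"
proof -
  obtain k where k: "x $ k \<noteq> 0" using assms(4) by (auto simp: vec_eq_iff)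
  let ?U = "{y. scal d y \<in> {z. \<bar>z $ k\<bar> > M * \<bar>z $ p\<bar>}}"
  show ?thesis
  proof
    show "open ?U" by (rule open_scal[OF open_cone_compl])
    show "x \<in> ?U" using k assms by simp
    show "wfun p pm t d \<Phi> y = 0" if "y \<in> ?U" for y
    proof -
      have "\<exists>k. \<bar>scal d y $ k\<bar> > M * \<bar>scal d y $ p\<bar>" using that by blast
      then show ?thesis using assms(1) by (simp add: cone_supp_def wfun_def)
    qed
  qed
qed

text \<open>The chart \<open>x $ p \<noteq> 0\<close> and the interior of the zero set cover all
  nonzero points, and the function is smooth on each of these two open sets.\<close>

lemma smooth_wfun:
  fixes \<Phi> :: "real^'n::finite \<Rightarrow> complex"
  assumes "cone_supp p M \<Phi>" "d p = 1" "\<And>k. d k \<noteq> 0"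
  shows "smooth (- {0}) (wfun p pm t d \<Phi>)"
proof -
  have s: "{x. scal d x \<in> {x. x $ p \<noteq> 0}} = {x. x $ p \<noteq> 0}" using assms by auto
  have sc: "smooth {x. x $ p \<noteq> 0} (\<lambda>x. \<Phi> (scal d x))"
    using smooth_scal[OF open_nth_neq, of p \<Phi> d] assms(1) unfolding s by (simp add: cone_supp_def)
  have 1: "smooth {x. x $ p \<noteq> 0} (wfun p pm t d \<Phi>)"
    unfolding wfun_def[abs_def]
    by (intro smooth_mult smooth_compose[OF _ _ smooth_mc] smooth_nth open_nth_neq sc) auto
  define Z where "Z = \<Union>{U. open U \<and> (\<forall>y\<in>U. wfun p pm t d \<Phi> y = 0)}"
  have Z: "open Z" "\<And>y. y \<in> Z \<Longrightarrow> wfun p pm t d \<Phi> y = 0" unfolding Z_def by auto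
  have 2: "smooth Z (wfun p pm t d \<Phi>)"
    by (rule smooth_cong[OF Z(1) smooth_const[of Z 0]]) (use Z in auto)
  have "- {0} \<subseteq> {x. x $ p \<noteq> 0} \<union> Z"
  proof
    fix x :: "real^'n" assume "x \<in> - {0}"
    then have x: "x \<noteq> 0" by simp
    show "x \<in> {x. x $ p \<noteq> 0} \<union> Z"
    proof (cases "x $ p = 0")
      case True
      obtain U where "open U" "x \<in> U" "\<And>y. y \<in> U \<Longrightarrow> wfun p pm t d \<Phi> y = 0"
        using wfun_zero_nbhd[where d = d, OF assms x True] by metis
      then have "x \<in> Z" unfolding Z_def by blast
      then show ?thesis ..
    qed simp
  qed
  with smooth_Un[OF 1 2] show ?thesis by (rule smooth_subset)
qed

text \<open>This and \<open>gen_diff\<close> are the two terms of the product rule for a matrix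
  acting on \<open>wfun\<close>: the character contributes a quotient of coordinates, the symbol a
  derivative. Both preserve the supporting cone, so the class of symbols is closed under the
  action.\<close>

definition gen_mult :: "'n \<Rightarrow> 'n \<Rightarrow> (real^'n::finite \<Rightarrow> complex) \<Rightarrow> real^'n \<Rightarrow> complex" where
  "gen_mult p l \<Phi> y = of_real (y $ l / y $ p) * \<Phi> y"

definition gen_diff :: "'n \<Rightarrow> 'n \<Rightarrow> (real^'n::finite \<Rightarrow> complex) \<Rightarrow> real^'n \<Rightarrow> complex" where
  "gen_diff k l \<Phi> y = of_real (- y $ l) * dd (axis k 1) \<Phi> y"

lemma cone_supp_gen_mult: "cone_supp p M \<Phi> \<Longrightarrow> cone_supp p M (gen_mult p l \<Phi>)"
  unfolding cone_supp_def gen_mult_def[abs_def]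
  by (intro conjI smooth_mult smooth_of_real smooth_divide smooth_nth open_nth_neq) auto

lemma cone_supp_gen_diff: "cone_supp p M \<Phi> \<Longrightarrow> cone_supp p M (gen_diff k l \<Phi>)"
  unfolding cone_supp_def gen_diff_def[abs_def]
proof (intro conjI smooth_mult smooth_of_real smooth_minus smooth_nth open_nth_neq smooth_dd allI impI)
  fix x assume H: "smooth {x. x $ p \<noteq> 0} \<Phi> \<and> (\<forall>x. (\<exists>k. \<bar>x $ k\<bar> > M * \<bar>x $ p\<bar>) \<longrightarrow> \<Phi> x = 0)"
    and "\<exists>k. \<bar>x $ k\<bar> > M * \<bar>x $ p\<bar>"
  then obtain q where q: "\<bar>x $ q\<bar> > M * \<bar>x $ p\<bar>" by blast
  have "dd (axis k 1) \<Phi> x = dd (axis k 1) (\<lambda>_. 0) x"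
    by (rule dd_cong[OF open_cone_compl[of M p q]]) (use q H in auto)
  also have "\<dots> = 0" by (simp add: dd_def)
  finally show "of_real (- x $ l) * dd (axis k 1) \<Phi> x = 0" by simp
qed auto

lemma dpi_zero_nbhd:
  assumes "open U" "x \<in> U" "\<And>y. y \<in> U \<Longrightarrow> F y = 0"
  shows "dpi X F x = 0"
proof -
  have "dpi X F x = dpi X (\<lambda>_. 0) x" using assms by (rule dpi_cong)
  then show ?thesis by (simp add: dpi_dd dd_def)
qed

text \<open>A derivative in the k-th coordinate brings out \<open>d k\<close>, and writing
  \<open>x $ l\<close> in dilated coordinates brings out 1 / \<open>d l\<close>. The factor n/2 + i
  t comes from the derivative of the character.\<close>

lemma dpi_wfun:
  fixes \<Phi> :: "real^'n::finite \<Rightarrow> complex"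
  assumes "cone_supp p M \<Phi>" "d p = 1" "\<And>k. d k \<noteq> 0"
  shows "dpi X (wfun p pm t d \<Phi>) =
    (\<lambda>x. (\<Sum>l\<in>UNIV. ((of_real (CARD('n) / 2) + \<i> * of_real t) * of_real (X$p$l / d l)) * wfun p pm t d (gen_mult p l \<Phi>) x)
      + (\<Sum>(k, l)\<in>UNIV. of_real (X$k$l * (d k / d l)) * wfun p pm t d (gen_diff k l \<Phi>) x))"
    (is "_ = ?R")
proof
  fix x :: "real^'n"
  show "dpi X (wfun p pm t d \<Phi>) x = ?R x"
  proof (cases "x $ p = 0")
    case True
    have "dpi X (wfun p pm t d \<Phi>) x = 0"
    proof (cases "x = 0")
      case False
      then show ?thesis using wfun_zero_nbhd[where d = d, OF assms False True, of pm t] dpi_zero_nbhd by metis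
    qed (simp add: dpi_dd)
    then show ?thesis using True by (simp add: wfun_def case_prod_unfold)
  next
    case False
    let ?m = "mc CARD('n) pm t" and ?c = "of_real (CARD('n) / 2) + \<i> * of_real t :: complex"
    have P: "\<Phi> differentiable (at (scal d x))"
      using assms(1,2) False unfolding cone_supp_def by (intro smooth_differentiable[of "{x. x $ p \<noteq> 0}"]) auto
    have PD: "((\<lambda>x. \<Phi> (scal d x)) has_derivative (\<lambda>b. dd b (\<lambda>x. \<Phi> (scal d x)) x)) (at x)"
    proof -
      have "(\<lambda>x. \<Phi> (scal d x)) differentiable (at x)"
        using P bounded_linear_imp_differentiable[OF bounded_linear_scal] differentiable_compose by metis
      then show ?thesis using dd_eq unfolding differentiable_def by (metis (no_types, lifting) ext)
    qed
    have MD: "((\<lambda>x. ?m (x $ p)) has_derivative (\<lambda>b. of_real (b $ p) * (- ?c * of_real (inverse (x $ p)) * ?m (x $ p)))) (at x)"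
      using has_derivative_compose[OF bounded_linear_imp_has_derivative[OF bounded_linear_vec_nth[of p]]
          mc_deriv[OF False, of "CARD('n)" pm t, unfolded has_vector_derivative_def]]
      by (simp add: scaleR_conv_of_real)
    have D: "dd (axis k 1) (wfun p pm t d \<Phi>) x =
        (if k = p then - ?c * of_real (inverse (x $ p)) * ?m (x $ p) * \<Phi> (scal d x) else 0)
        + ?m (x $ p) * (of_real (d k) * dd (axis k 1) \<Phi> (scal d x))" for k
      using dd_eq[OF has_derivative_mult[OF MD PD], of "axis k 1"] dd_scal[OF P, of k]
      by (simp add: wfun_def[abs_def] axis_def scaleR_conv_of_real)
    let ?e = "- ?c * of_real (inverse (x $ p)) * ?m (x $ p) * \<Phi> (scal d x)"
    have "dpi X (wfun p pm t d \<Phi>) x =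
       - (\<Sum>k\<in>UNIV. \<Sum>l\<in>UNIV. complex_of_real (X$k$l * x$l) * (if k = p then ?e else 0))
       - (\<Sum>k\<in>UNIV. \<Sum>l\<in>UNIV. complex_of_real (X$k$l * x$l) * (?m (x $ p) * (of_real (d k) * dd (axis k 1) \<Phi> (scal d x))))"
      unfolding dpi_dd D by (simp add: distrib_left sum.distrib)
    moreover have "- (\<Sum>k\<in>UNIV. \<Sum>l\<in>UNIV. complex_of_real (X$k$l * x$l) * (if k = p then ?e else 0))
      = (\<Sum>l\<in>UNIV. (?c * of_real (X$p$l / d l)) * wfun p pm t d (gen_mult p l \<Phi>) x)"
    proof -
      have "(\<Sum>k\<in>UNIV. \<Sum>l\<in>UNIV. complex_of_real (X$k$l * x$l) * (if k = p then ?e else 0))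
        = (\<Sum>k\<in>UNIV. if k = p then \<Sum>l\<in>UNIV. complex_of_real (X$k$l * x$l) * ?e else 0)"
        by (intro sum.cong refl) auto
      also have "\<dots> = (\<Sum>l\<in>UNIV. complex_of_real (X$p$l * x$l) * ?e)"
        by simp
      finally have e: "(\<Sum>k\<in>UNIV. \<Sum>l\<in>UNIV. complex_of_real (X$k$l * x$l) * (if k = p then ?e else 0))
        = (\<Sum>l\<in>UNIV. complex_of_real (X$p$l * x$l) * ?e)" .
      show ?thesis
        unfolding e sum_negf[symmetric]
        by (intro sum.cong refl) (use assms(2,3) False in \<open>simp add: wfun_def gen_mult_def field_simps\<close>)
    qed
    moreover have "- (\<Sum>k\<in>UNIV. \<Sum>l\<in>UNIV. complex_of_real (X$k$l * x$l) * (?m (x $ p) * (of_real (d k) * dd (axis k 1) \<Phi> (scal d x))))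
      = (\<Sum>(k, l)\<in>UNIV. of_real (X$k$l * (d k / d l)) * wfun p pm t d (gen_diff k l \<Phi>) x)"
    proof -
      have "(\<Sum>(k, l)\<in>UNIV. of_real (X$k$l * (d k / d l)) * wfun p pm t d (gen_diff k l \<Phi>) x)
         = (\<Sum>k\<in>UNIV. \<Sum>l\<in>UNIV. of_real (X$k$l * (d k / d l)) * wfun p pm t d (gen_diff k l \<Phi>) x)"
        unfolding UNIV_Times_UNIV[symmetric] by (rule sum.cartesian_product[symmetric])
      then show ?thesis
        unfolding sum_negf[symmetric]
        by (simp only:) (intro sum.cong refl, use assms(3) in \<open>simp add: wfun_def gen_diff_def field_simps\<close>)
    qed
    ultimately show ?thesis by simp
  qed
qed

definition annulus :: "(real^'n::finite) set" where
  "annulus = {x. 1 \<le> norm x \<and> norm x \<le> exp 1}"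

text \<open>In the support each \<bar>x $ k\<bar> is at most M \<bar>x $ p\<bar>, since dilation
  does not shrink coordinates. With norm at least 1 this keeps \<bar>x $ p\<bar> above 1 / (n M).
  The dilated points then stay in a fixed compact subset of the chart, so the bound does not depend
  on t or d.\<close>

lemma wfun_bound:
  fixes \<Phi> :: "real^'n::finite \<Rightarrow> complex"
  assumes "cone_supp p M \<Phi>" "M \<ge> 1"
  obtains C where "C \<ge> 0" "\<And>pm t d x. d p = 1 \<Longrightarrow> (\<And>k. \<bar>d k\<bar> \<ge> 1) \<Longrightarrow> x \<in> annulus \<Longrightarrow>
    cmod (wfun p pm t d \<Phi> x) \<le> C \<and> (wfun p pm t d \<Phi> x \<noteq> 0 \<longrightarrow> (\<forall>k. \<bar>d k * x $ k\<bar> \<le> M * exp 1))"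
proof -
  let ?N = "real CARD('n)"
  define a where "a = 1 / (?N * M)"
  have a: "a > 0" using assms(2) by (simp add: a_def)
  define Y where "Y = {y::real^'n. a \<le> \<bar>y $ p\<bar>} \<inter> cbox (\<chi> k. - (M * exp 1)) (\<chi> k. M * exp 1)"
  have "compact Y" unfolding Y_def
    by (intro closed_Int_compact compact_cbox closed_Collect_le continuous_intros)
  moreover have "continuous_on Y \<Phi>"
    by (rule continuous_on_subset[OF smooth_continuous_on[of "{x. x $ p \<noteq> 0}"]])
      (use assms(1) a in \<open>auto simp: Y_def cone_supp_def\<close>)
  ultimately obtain C0 where C0: "\<And>y. y \<in> Y \<Longrightarrow> cmod (\<Phi> y) \<le> C0"
    using compact_imp_bounded[OF compact_continuous_image] by (force simp: bounded_iff)
  define C where "C = (a powr (- ?N / 2)) * max C0 0"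
  show ?thesis
  proof
    show "C \<ge> 0" by (simp add: C_def)
    fix pm t and d :: "'n \<Rightarrow> real" and x :: "real^'n"
    assume d: "d p = 1" "\<And>k. \<bar>d k\<bar> \<ge> 1" and x: "x \<in> annulus"
    show "cmod (wfun p pm t d \<Phi> x) \<le> C \<and> (wfun p pm t d \<Phi> x \<noteq> 0 \<longrightarrow> (\<forall>k. \<bar>d k * x $ k\<bar> \<le> M * exp 1))"
    proof (cases "wfun p pm t d \<Phi> x = 0")
      case False
      then have "\<Phi> (scal d x) \<noteq> 0" and xp: "x $ p \<noteq> 0" by (auto simp: wfun_def)
      then have cone: "\<bar>d k * x $ k\<bar> \<le> M * \<bar>x $ p\<bar>" for k
        using assms(1) d(1) unfolding cone_supp_def by (metis linorder_not_less mult_1 scal_nth)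
      have xe: "\<bar>x $ p\<bar> \<le> exp 1" using x component_le_norm_cart[of x p] by (auto simp: annulus_def)
      have box: "\<bar>d k * x $ k\<bar> \<le> M * exp 1" for k
      proof -
        have "M * \<bar>x $ p\<bar> \<le> M * exp 1" by (rule mult_left_mono[OF xe]) (use assms(2) in simp)
        then show ?thesis using cone[of k] by linarith
      qed
      have xk: "\<bar>x $ k\<bar> \<le> M * \<bar>x $ p\<bar>" for k
      proof -
        have "1 * \<bar>x $ k\<bar> \<le> \<bar>d k\<bar> * \<bar>x $ k\<bar>" by (rule mult_right_mono[OF d(2)]) simp
        then show ?thesis using cone[of k] by (simp add: abs_mult)
      qed
      have "1 \<le> norm x" using x by (simp add: annulus_def)
      also have "\<dots> \<le> (\<Sum>k\<in>UNIV. \<bar>x $ k\<bar>)" by (rule norm_le_l1_cart)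
      also have "\<dots> \<le> (\<Sum>k\<in>(UNIV::'n set). M * \<bar>x $ p\<bar>)" by (rule sum_mono) (rule xk)
      finally have ax: "a \<le> \<bar>x $ p\<bar>" using assms(2) by (simp add: a_def field_simps)
      have "scal d x \<in> Y" using ax box d(1) by (auto simp: Y_def mem_box_cart abs_le_iff minus_le_iff)
      then have "cmod (\<Phi> (scal d x)) \<le> max C0 0" using C0 by force
      moreover have "cmod (mc CARD('n) pm t (x $ p)) \<le> a powr (- ?N / 2)"
        using norm_mc[OF xp] powr_mono2'[of "- ?N / 2" a "\<bar>x $ p\<bar>"] a ax by simp
      ultimately have "cmod (wfun p pm t d \<Phi> x) \<le> C"
        unfolding wfun_def norm_mult C_def by (intro mult_mono) auto
      with box show ?thesis by blast
    qed (simp add: C_def)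
  qed
qed

text \<open>The bound on the ratios \<open>d k / d l\<close> is what makes a Lie algebra element
  cost one factor t.\<close>

definition scaling :: "'n \<Rightarrow> real \<Rightarrow> real \<Rightarrow> ('n::finite \<Rightarrow> real) \<Rightarrow> bool" where
  "scaling p A t d \<longleftrightarrow> d p = 1 \<and> (\<forall>k. \<bar>d k\<bar> \<ge> 1) \<and> \<bar>t\<bar> \<ge> 1 \<and> (\<forall>k l. \<bar>d k / d l\<bar> \<le> A * \<bar>t\<bar>)"

definition wfun_est :: "'n \<Rightarrow> real \<Rightarrow> real \<Rightarrow> (real^'n^'n) list \<Rightarrow> (real^'n::finite \<Rightarrow> complex) \<Rightarrow> real \<Rightarrow> bool" where
  "wfun_est p M A w \<Phi> C \<longleftrightarrow> (\<forall>pm t d x. scaling p A t d \<and> x \<in> annulus \<longrightarrow>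
    cmod (act_word w (wfun p pm t d \<Phi>) x) \<le> C * \<bar>t\<bar> ^ length w \<and>
    (act_word w (wfun p pm t d \<Phi>) x \<noteq> 0 \<longrightarrow> (\<forall>k. \<bar>d k * x $ k\<bar> \<le> M * exp 1)))"

lemma wfun_estD:
  assumes "wfun_est p M A w \<Phi> C" "scaling p A t d" "x \<in> annulus"
  shows "cmod (act_word w (wfun p pm t d \<Phi>) x) \<le> C * \<bar>t\<bar> ^ length w \<and>
    (act_word w (wfun p pm t d \<Phi>) x \<noteq> 0 \<longrightarrow> (\<forall>k. \<bar>d k * x $ k\<bar> \<le> M * exp 1))"
  using assms unfolding wfun_est_def by blast

text \<open>Induction on the innermost letter: by \<open>dpi_wfun\<close> it turns a symbol into finitely many symbols
  that depend neither on \<open>t\<close> nor on \<open>d\<close>, with scalar coefficients \<open>O(t)\<close>.\<close>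
lemma word_wfun_bound:
  fixes \<Phi> :: "real^'n::finite \<Rightarrow> complex"
  assumes "cone_supp p M \<Phi>" "M \<ge> 1" "A \<ge> 0"
  shows "\<exists>C\<ge>0. wfun_est p M A w \<Phi> C"
  using assms(1)
proof (induction w arbitrary: \<Phi> rule: rev_induct)
  case Nil
  show ?case
    by (rule wfun_bound[OF Nil assms(2)]) (auto simp: wfun_est_def scaling_def)
next
  case (snoc X w)
  let ?N = "real CARD('n)"
  let ?ok = "\<lambda>t d x. scaling p A t d \<and> x \<in> annulus"
  obtain C1 where C10: "\<And>l. C1 l \<ge> 0" and "\<And>l. wfun_est p M A w (gen_mult p l \<Phi>) (C1 l)"
    using snoc.IH[OF cone_supp_gen_mult[OF snoc.prems]] by metis
  note C1 = C10 wfun_estD[OF this(2)]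
  obtain C2 where C20: "\<And>k l. C2 k l \<ge> 0" and "\<And>k l. wfun_est p M A w (gen_diff k l \<Phi>) (C2 k l)"
    using snoc.IH[OF cone_supp_gen_diff[OF snoc.prems]] by metis
  note C2 = C20 wfun_estD[OF this(2)]
  define C where "C = (\<Sum>l\<in>UNIV. (?N / 2 + 1) * \<bar>X$p$l\<bar> * C1 l) + (\<Sum>(k, l)\<in>UNIV. \<bar>X$k$l\<bar> * A * C2 k l)"
  have C0: "C \<ge> 0" unfolding C_def using C1(1) C2(1) assms(3)
    by (intro add_nonneg_nonneg sum_nonneg) (auto intro!: mult_nonneg_nonneg)
  have main: "cmod (act_word (w @ [X]) (wfun p pm t d \<Phi>) x) \<le> C * \<bar>t\<bar> ^ length (w @ [X]) \<and>
    (act_word (w @ [X]) (wfun p pm t d \<Phi>) x \<noteq> 0 \<longrightarrow> (\<forall>k. \<bar>d k * x $ k\<bar> \<le> M * exp 1))"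
    if ok: "?ok t d x" for pm t d x
  proof -
    have d1: "d p = 1" "\<And>k. \<bar>d k\<bar> \<ge> 1" "\<bar>t\<bar> \<ge> 1" "\<And>k l. \<bar>d k / d l\<bar> \<le> A * \<bar>t\<bar>"
      using ok by (auto simp: scaling_def)
    have d0: "d p = 1" "\<And>k. d k \<noteq> 0" using d1(1,2) by (auto, metis abs_zero not_one_le_zero)
    have x0: "x \<in> - {0}" using ok by (auto simp: annulus_def)
    let ?I = "(UNIV :: ('n + 'n \<times> 'n) set)"
    let ?c = "\<lambda>i. case i of Inl l \<Rightarrow> (of_real (CARD('n) / 2) + \<i> * of_real t) * of_real (X$p$l / d l)
       | Inr (k, l) \<Rightarrow> complex_of_real (X$k$l * (d k / d l))"
    let ?F = "\<lambda>i. case i of Inl l \<Rightarrow> wfun p pm t d (gen_mult p l \<Phi>) | Inr (k, l) \<Rightarrow> wfun p pm t d (gen_diff k l \<Phi>)"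
    have split: "(\<Sum>i\<in>?I. h i) = (\<Sum>l\<in>UNIV. h (Inl l)) + (\<Sum>kl\<in>UNIV. h (Inr kl))" for h :: "'n + 'n \<times> 'n \<Rightarrow> complex"
      unfolding UNIV_Plus_UNIV[symmetric] by (subst sum.Plus) auto
    have "dpi X (wfun p pm t d \<Phi>) = (\<lambda>x. \<Sum>i\<in>?I. ?c i * ?F i x)"
      unfolding split dpi_wfun[where d = d, OF snoc.prems d0] by (simp add: case_prod_unfold)
    then have "act_word (w @ [X]) (wfun p pm t d \<Phi>) x = (\<Sum>i\<in>?I. ?c i * act_word w (?F i) x)"
      unfolding act_word_simps
      by (simp only:, intro act_word_sum[of "- {0}"] x0)
        (auto split: sum.split intro!: smooth_wfun[where d = d, OF _ d0] cone_supp_gen_mult cone_supp_gen_diff snoc.prems)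
    then have e: "act_word (w @ [X]) (wfun p pm t d \<Phi>) x =
      (\<Sum>l\<in>UNIV. ((of_real (CARD('n) / 2) + \<i> * of_real t) * of_real (X$p$l / d l)) * act_word w (wfun p pm t d (gen_mult p l \<Phi>)) x)
      + (\<Sum>kl\<in>UNIV. of_real (X$(fst kl)$(snd kl) * (d (fst kl) / d (snd kl))) * act_word w (wfun p pm t d (gen_diff (fst kl) (snd kl) \<Phi>)) x)"
      unfolding split by (simp add: case_prod_unfold)
    let ?T = "\<bar>t\<bar> ^ length w"
    have t1: "\<bar>t\<bar> \<ge> 1" by (rule d1)
    have b1: "cmod (((of_real (CARD('n) / 2) + \<i> * of_real t) * of_real (X$p$l / d l)) * act_word w (wfun p pm t d (gen_mult p l \<Phi>)) x)
      \<le> ((?N / 2 + 1) * \<bar>t\<bar>) * \<bar>X$p$l\<bar> * (C1 l * ?T)" for l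
      unfolding norm_mult
    proof (intro mult_mono)
      have "cmod (of_real (CARD('n) / 2) + \<i> * of_real t) \<le> cmod (of_real (CARD('n) / 2)) + cmod (\<i> * of_real t)"
        by (rule norm_triangle_ineq)
      also have "\<dots> = ?N / 2 * 1 + 1 * \<bar>t\<bar>" by (simp add: norm_mult)
      also have "\<dots> \<le> ?N / 2 * \<bar>t\<bar> + 1 * \<bar>t\<bar>" using t1 by (intro add_right_mono mult_left_mono) auto
      finally show "cmod (of_real (CARD('n) / 2) + \<i> * of_real t) \<le> (?N / 2 + 1) * \<bar>t\<bar>" by (simp add: distrib_right)
      have "\<bar>X$p$l\<bar> / \<bar>d l\<bar> \<le> \<bar>X$p$l\<bar> / 1" by (rule divide_left_mono) (use d1(2)[of l] d0 in auto)
      then show "cmod (of_real (X$p$l / d l)) \<le> \<bar>X$p$l\<bar>" by (simp add: norm_divide)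
    qed (use C1 ok in auto)
    have b2: "cmod (of_real (X$k$l * (d k / d l)) * act_word w (wfun p pm t d (gen_diff k l \<Phi>)) x)
      \<le> (\<bar>X$k$l\<bar> * (A * \<bar>t\<bar>)) * (C2 k l * ?T)" for k l
      unfolding norm_mult norm_of_real abs_mult by (intro mult_mono) (use C2 ok d1(4)[of k l] assms(3) in auto)
    have "cmod (act_word (w @ [X]) (wfun p pm t d \<Phi>) x) \<le>
      (\<Sum>l\<in>UNIV. ((?N / 2 + 1) * \<bar>t\<bar>) * \<bar>X$p$l\<bar> * (C1 l * ?T)) + (\<Sum>kl\<in>UNIV. (\<bar>X$(fst kl)$(snd kl)\<bar> * (A * \<bar>t\<bar>)) * (C2 (fst kl) (snd kl) * ?T))"
      unfolding e by (intro norm_triangle_mono sum_norm_le b1 b2)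
    also have "\<dots> = C * \<bar>t\<bar> ^ length (w @ [X])"
      unfolding C_def by (simp add: case_prod_unfold distrib_right distrib_left sum_distrib_left mult_ac sum_distrib_right)
    finally have 1: "cmod (act_word (w @ [X]) (wfun p pm t d \<Phi>) x) \<le> C * \<bar>t\<bar> ^ length (w @ [X])" .
    have 2: "\<forall>k. \<bar>d k * x $ k\<bar> \<le> M * exp 1" if "act_word (w @ [X]) (wfun p pm t d \<Phi>) x \<noteq> 0"
    proof (rule ccontr)
      assume "\<not> ?thesis"
      then have "act_word w (wfun p pm t d (gen_mult p l \<Phi>)) x = 0" "act_word w (wfun p pm t d (gen_diff k l \<Phi>)) x = 0" for k l
        using C1(2) C2(2) ok by blast+
      then show False using that e by simp
    qed
    from 1 2 show ?thesis by blast
  qed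
  show ?case unfolding wfun_est_def by (intro exI[of _ C] conjI C0 allI impI main[THEN conjunct1] main[THEN conjunct2, rule_format]) auto
qed

section \<open>Hilbert and Sobolev norms of localized families\<close>

lemma L2n_annulus: "L2n F = sqrt (integral annulus (\<lambda>x. (cmod (F x))\<^sup>2))"
  by (simp add: L2n_def annulus_def)

lemma L2n_nonneg: "0 \<le> L2n F"
proof -
  have "0 \<le> integral annulus (\<lambda>x. (cmod (F x))\<^sup>2)"
    by (cases "(\<lambda>x. (cmod (F x))\<^sup>2) integrable_on annulus")
      (auto intro!: integral_nonneg simp: not_integrable_integral)
  then show ?thesis by (simp add: L2n_annulus)
qed

text \<open>A non-integrable f has integral 0 by convention, and the right-hand side is nonnegative,
  so the bound holds in that case too.\<close>

lemma integral_le_boxes: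
  fixes f :: "real^'n::finite \<Rightarrow> real"
  assumes "\<And>x. x \<in> S \<Longrightarrow> f x \<le> B1 * indicator (cbox a1 b1) x + B2 * indicator (cbox a2 b2) x" "B1 \<ge> 0" "B2 \<ge> 0"
  shows "integral S f \<le> B1 * measure lborel (cbox a1 b1) + B2 * measure lborel (cbox a2 b2)"
proof (cases "f integrable_on S")
  case True
  have *: "((\<lambda>x. B * indicator (cbox a b) x) has_integral (B * measure lborel (cbox a b))) UNIV" for B :: real and a b :: "real^'n"
  proof -
    have "((\<lambda>x. if x \<in> cbox a b then B else 0) has_integral (measure lborel (cbox a b) *\<^sub>R B)) UNIV"
      using has_integral_const[of B a b] by (simp add: has_integral_restrict_UNIV)
    moreover have "(\<lambda>x. if x \<in> cbox a b then B else 0) = (\<lambda>x. B * indicator (cbox a b) x)" by (auto simp: indicator_def)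
    ultimately show ?thesis by (simp add: mult.commute)
  qed
  have "((\<lambda>x. if x \<in> S then f x else 0) has_integral integral S f) UNIV"
    using integrable_integral[OF True] by (simp add: has_integral_restrict_UNIV)
  then show ?thesis
    by (rule has_integral_le[OF _ has_integral_add[OF * *]]) (use assms in \<open>auto intro: add_nonneg_nonneg\<close>)
qed (use assms in \<open>simp add: not_integrable_integral\<close>)

definition sbox :: "('n \<Rightarrow> real) \<Rightarrow> real \<Rightarrow> (real^'n::finite) set" where
  "sbox d r = cbox (\<chi> k. - (r / \<bar>d k\<bar>)) (\<chi> k. r / \<bar>d k\<bar>)"

lemma mem_sbox:
  assumes "\<And>k. d k \<noteq> 0"
  shows "x \<in> sbox d r \<longleftrightarrow> (\<forall>k. \<bar>d k * x $ k\<bar> \<le> r)"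
proof -
  have "(- (r / \<bar>d k\<bar>) \<le> x $ k \<and> x $ k \<le> r / \<bar>d k\<bar>) \<longleftrightarrow> \<bar>d k * x $ k\<bar> \<le> r" for k
  proof -
    have "\<bar>x $ k\<bar> \<le> r / \<bar>d k\<bar> \<longleftrightarrow> \<bar>d k * x $ k\<bar> \<le> r"
      using assms[of k] by (simp add: abs_mult pos_le_divide_eq mult.commute)
    then show ?thesis by (simp only: abs_le_iff) linarith
  qed
  then show ?thesis by (simp add: sbox_def mem_box_cart)
qed

lemma content_sbox:
  fixes d :: "'n::finite \<Rightarrow> real"
  assumes "\<And>k. d k \<noteq> 0" "r \<ge> 0"
  shows "measure lborel (sbox d r :: (real^'n) set) = (2 * r) ^ CARD('n) / (\<Prod>k\<in>UNIV. \<bar>d k\<bar>)"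
proof -
  have "(0::real^'n) \<in> sbox d r" using assms by (simp add: mem_sbox)
  then have "measure lborel (sbox d r :: (real^'n) set) = (\<Prod>k\<in>UNIV. 2 * r / \<bar>d k\<bar>)"
    unfolding sbox_def by (subst content_cbox_cart) auto
  then show ?thesis by (simp add: prod_dividef)
qed

lemma act_word_add:
  assumes "open S" "smooth S F" "smooth S G" "x \<in> S"
  shows "act_word w (\<lambda>x. a * F x + b * G x) x = a * act_word w F x + b * act_word w G x"
  using act_word_sum[of S "UNIV :: bool set" "\<lambda>i. if i then F else G" x w "\<lambda>i. if i then a else b"] assms
  by (simp add: UNIV_bool add.commute)

definition tame :: "real \<Rightarrow> (bool \<Rightarrow> real \<Rightarrow> real^'n::finite \<Rightarrow> complex) \<Rightarrow> bool" where
  "tame t0 G \<longleftrightarrow> (\<forall>w. \<exists>C\<ge>0. \<forall>pm t. \<bar>t\<bar> \<ge> t0 \<longrightarrow> L2n (act_word w (G pm t)) \<le> C * \<bar>t\<bar> ^ length w)"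

text \<open>A dilated symbol lives on a box whose volume is a constant over the product of the
  \<bar>d k\<bar>. A coefficient whose square is of the order of that product therefore still gives
  a bounded norm. The Boolean index allows a symbol to depend on the sign of \<kappa>, which takes
  only two values.\<close>

lemma tame_wfun_add:
  fixes \<Phi>1 \<Phi>2 :: "bool \<Rightarrow> real^'n::finite \<Rightarrow> complex"
  assumes M: "M \<ge> 1" and A: "A \<ge> 0"
    and F1: "\<And>b. cone_supp p1 M (\<Phi>1 b)" and F2: "\<And>b. cone_supp p2 M (\<Phi>2 b)"
    and s1: "\<And>t. \<bar>t\<bar> \<ge> t0 \<Longrightarrow> scaling p1 A t (d1 t)" and s2: "\<And>t. \<bar>t\<bar> \<ge> t0 \<Longrightarrow> scaling p2 A t (d2 t)"
    and c1: "\<And>pm t. \<bar>t\<bar> \<ge> t0 \<Longrightarrow> (cmod (c1 pm t))\<^sup>2 \<le> K * (\<Prod>k\<in>UNIV. \<bar>d1 t k\<bar>)"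
    and c2: "\<And>pm t. \<bar>t\<bar> \<ge> t0 \<Longrightarrow> (cmod (c2 pm t))\<^sup>2 \<le> K * (\<Prod>k\<in>UNIV. \<bar>d2 t k\<bar>)"
  shows "tame t0 (\<lambda>pm t x. c1 pm t * wfun p1 pm t (d1 t) (\<Phi>1 (e t)) x + c2 pm t * wfun p2 pm t (d2 t) (\<Phi>2 (e t)) x)"
  unfolding tame_def
proof
  fix w
  let ?r = "M * exp 1"
  obtain C1 where C10: "\<And>b. C1 b \<ge> 0" and "\<And>b. wfun_est p1 M A w (\<Phi>1 b) (C1 b)"
    using word_wfun_bound[OF F1 M A] by metis
  note C1 = C10 wfun_estD[OF this(2)]
  obtain C2 where C20: "\<And>b. C2 b \<ge> 0" and "\<And>b. wfun_est p2 M A w (\<Phi>2 b) (C2 b)"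
    using word_wfun_bound[OF F2 M A] by metis
  note C2 = C20 wfun_estD[OF this(2)]
  define D1 where "D1 = C1 True + C1 False"
  define D2 where "D2 = C2 True + C2 False"
  have D: "0 \<le> C1 b" "C1 b \<le> D1" "0 \<le> C2 b" "C2 b \<le> D2" for b
    using C1(1) C2(1) unfolding D1_def D2_def by (cases b; simp)+
  define Q where "Q = 2 * K * (2 * ?r) ^ CARD('n) * (D1\<^sup>2 + D2\<^sup>2)"
  have main: "L2n (act_word w (\<lambda>x. c1 pm t * wfun p1 pm t (d1 t) (\<Phi>1 (e t)) x + c2 pm t * wfun p2 pm t (d2 t) (\<Phi>2 (e t)) x))
     \<le> sqrt \<bar>Q\<bar> * \<bar>t\<bar> ^ length w" if t: "\<bar>t\<bar> \<ge> t0" for pm t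
  proof -
    note S1 = s1[OF t] and S2 = s2[OF t]
    have ne1: "d1 t k \<noteq> 0" and ne2: "d2 t k \<noteq> 0" for k
      using S1 S2 unfolding scaling_def by (metis abs_zero not_one_le_zero)+
    have p: "d1 t p1 = 1" "d2 t p2 = 1" using S1 S2 by (auto simp: scaling_def)
    let ?T = "\<bar>t\<bar> ^ length w"
    let ?F1 = "wfun p1 pm t (d1 t) (\<Phi>1 (e t))" and ?F2 = "wfun p2 pm t (d2 t) (\<Phi>2 (e t))"
    have pw: "(cmod (act_word w (\<lambda>x. c1 pm t * ?F1 x + c2 pm t * ?F2 x) x))\<^sup>2
       \<le> (2 * ((cmod (c1 pm t))\<^sup>2 * (D1 * ?T)\<^sup>2)) * indicator (sbox (d1 t) ?r) x
         + (2 * ((cmod (c2 pm t))\<^sup>2 * (D2 * ?T)\<^sup>2)) * indicator (sbox (d2 t) ?r) x" if x: "x \<in> annulus" for x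
    proof -
      have x0: "x \<in> - {0}" using x by (auto simp: annulus_def)
      let ?a = "act_word w ?F1 x" and ?b = "act_word w ?F2 x"
      have "act_word w (\<lambda>x. c1 pm t * ?F1 x + c2 pm t * ?F2 x) x = c1 pm t * ?a + c2 pm t * ?b"
        by (rule act_word_add[of "- {0}"]) (use x0 in \<open>auto intro!: smooth_wfun F1 F2 p ne1 ne2\<close>)
      then have "(cmod (act_word w (\<lambda>x. c1 pm t * ?F1 x + c2 pm t * ?F2 x) x))\<^sup>2
        \<le> (cmod (c1 pm t * ?a) + cmod (c2 pm t * ?b))\<^sup>2"
        using norm_triangle_ineq by (simp add: power_mono)
      also have "\<dots> \<le> 2 * (cmod (c1 pm t * ?a))\<^sup>2 + 2 * (cmod (c2 pm t * ?b))\<^sup>2"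
        using sum_squares_bound[of "cmod (c1 pm t * ?a)" "cmod (c2 pm t * ?b)"] by (simp add: power2_sum)
      also have "\<dots> = 2 * ((cmod (c1 pm t))\<^sup>2 * (cmod ?a)\<^sup>2) + 2 * ((cmod (c2 pm t))\<^sup>2 * (cmod ?b)\<^sup>2)"
        by (simp add: norm_mult power_mult_distrib)
      also have "\<dots> \<le> 2 * ((cmod (c1 pm t))\<^sup>2 * ((D1 * ?T)\<^sup>2 * indicator (sbox (d1 t) ?r) x))
         + 2 * ((cmod (c2 pm t))\<^sup>2 * ((D2 * ?T)\<^sup>2 * indicator (sbox (d2 t) ?r) x))"
      proof (intro add_mono mult_left_mono)
        show "(cmod ?a)\<^sup>2 \<le> (D1 * ?T)\<^sup>2 * indicator (sbox (d1 t) ?r) x"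
        proof (cases "?a = 0")
          case False
          have "cmod ?a \<le> C1 (e t) * ?T" using C1(2)[OF S1 x] by blast
          also have "\<dots> \<le> D1 * ?T" by (intro mult_right_mono D) simp
          finally show ?thesis
            using C1(2)[OF S1 x] False ne1 by (simp add: mem_sbox power_mono)
        qed simp
        show "(cmod ?b)\<^sup>2 \<le> (D2 * ?T)\<^sup>2 * indicator (sbox (d2 t) ?r) x"
        proof (cases "?b = 0")
          case False
          have "cmod ?b \<le> C2 (e t) * ?T" using C2(2)[OF S2 x] by blast
          also have "\<dots> \<le> D2 * ?T" by (intro mult_right_mono D) simp
          finally show ?thesis
            using C2(2)[OF S2 x] False ne2 by (simp add: mem_sbox power_mono)
        qed simp
      qed auto
      finally show ?thesis by (simp add: mult.assoc)
    qed
    have "integral annulus (\<lambda>x. (cmod (act_word w (\<lambda>x. c1 pm t * ?F1 x + c2 pm t * ?F2 x) x))\<^sup>2)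
      \<le> (2 * ((cmod (c1 pm t))\<^sup>2 * (D1 * ?T)\<^sup>2)) * measure lborel (sbox (d1 t) ?r :: (real^'n) set)
        + (2 * ((cmod (c2 pm t))\<^sup>2 * (D2 * ?T)\<^sup>2)) * measure lborel (sbox (d2 t) ?r :: (real^'n) set)"
      unfolding sbox_def by (rule integral_le_boxes) (use pw in \<open>auto simp: sbox_def\<close>)
    also have "\<dots> \<le> (2 * K * (2 * ?r) ^ CARD('n) * D1\<^sup>2) * ?T\<^sup>2 + (2 * K * (2 * ?r) ^ CARD('n) * D2\<^sup>2) * ?T\<^sup>2"
    proof -
      have r0: "?r \<ge> 0" using M by simp
      have "(2 * ((cmod c)\<^sup>2 * (D * ?T)\<^sup>2)) * measure lborel (sbox d ?r :: (real^'n) set) \<le> (2 * K * (2 * ?r) ^ CARD('n) * D\<^sup>2) * ?T\<^sup>2"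
        if "\<And>k. d k \<noteq> 0" "(cmod c)\<^sup>2 \<le> K * (\<Prod>k\<in>UNIV. \<bar>d k\<bar>)" for c D and d :: "'n \<Rightarrow> real"
      proof -
        let ?P = "\<Prod>k\<in>UNIV. \<bar>d k\<bar>"
        have P: "?P > 0" using that(1) by (intro prod_pos) simp
        have "(2 * ((cmod c)\<^sup>2 * (D * ?T)\<^sup>2)) * measure lborel (sbox d ?r :: (real^'n) set)
          = (cmod c)\<^sup>2 * (2 * (D * ?T)\<^sup>2 * ((2 * ?r) ^ CARD('n) / ?P))"
          by (subst content_sbox[OF that(1) r0]) (simp_all add: mult_ac)
        also have "\<dots> \<le> (K * ?P) * (2 * (D * ?T)\<^sup>2 * ((2 * ?r) ^ CARD('n) / ?P))"
          using r0 P by (intro mult_right_mono that) auto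
        also have "\<dots> = (2 * K * (2 * ?r) ^ CARD('n) * D\<^sup>2) * ?T\<^sup>2"
        proof -
          have "(K * q) * (2 * u * (v / q)) = 2 * K * v * u" if "q > 0" for q u v :: real
            using that by simp
          from this[OF P] show ?thesis by (simp add: power_mult_distrib)
        qed
        finally show ?thesis .
      qed
      then show ?thesis by (intro add_mono) (use ne1 ne2 c1[OF t] c2[OF t] in auto)
    qed
    also have "\<dots> = Q * ?T\<^sup>2" by (simp add: Q_def algebra_simps)
    also have "\<dots> \<le> \<bar>Q\<bar> * ?T\<^sup>2" by (intro mult_right_mono) auto
    finally have "L2n (act_word w (\<lambda>x. c1 pm t * ?F1 x + c2 pm t * ?F2 x)) \<le> sqrt (\<bar>Q\<bar> * ?T\<^sup>2)"
      unfolding L2n_annulus by simp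
    then show ?thesis by (simp add: real_sqrt_mult)
  qed
  show "\<exists>C\<ge>0. \<forall>pm t. \<bar>t\<bar> \<ge> t0 \<longrightarrow>
    L2n (act_word w (\<lambda>x. c1 pm t * wfun p1 pm t (d1 t) (\<Phi>1 (e t)) x + c2 pm t * wfun p2 pm t (d2 t) (\<Phi>2 (e t)) x)) \<le> C * \<bar>t\<bar> ^ length w"
    by (rule exI[of _ "sqrt \<bar>Q\<bar>"]) (use main in auto)
qed

lemma sob_int_bound:
  fixes G :: "bool \<Rightarrow> real \<Rightarrow> real^'n::finite \<Rightarrow> complex"
  assumes "tame t0 G" "t0 \<ge> 1"
  shows "\<exists>C\<ge>0. \<forall>pm t. \<bar>t\<bar> \<ge> t0 \<longrightarrow> sob_int B k (G pm t) \<le> C * \<bar>t\<bar> ^ k"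
proof -
  obtain C where C: "\<And>w. C w \<ge> 0" "\<And>w pm t. \<bar>t\<bar> \<ge> t0 \<Longrightarrow> L2n (act_word w (G pm t)) \<le> C w * \<bar>t\<bar> ^ length w"
    using assms(1) unfolding tame_def by metis
  define Q where "Q = (C [])\<^sup>2 + (\<Sum>m\<in>{1..k}. \<Sum>w\<in>{w. length w = m \<and> set w \<subseteq> B}. (C w)\<^sup>2)"
  have Q: "Q \<ge> 0" unfolding Q_def by (intro add_nonneg_nonneg sum_nonneg) auto
  have "sob_int B k (G pm t) \<le> sqrt Q * \<bar>t\<bar> ^ k" if t: "\<bar>t\<bar> \<ge> t0" for pm t
  proof -
    have t1: "\<bar>t\<bar> \<ge> 1" using t assms(2) by simp
    have b: "(L2n (act_word w (G pm t)))\<^sup>2 \<le> (C w)\<^sup>2 * (\<bar>t\<bar> ^ k)\<^sup>2" if "length w \<le> k" for w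
    proof -
      have "L2n (act_word w (G pm t)) \<le> C w * \<bar>t\<bar> ^ length w" using C(2)[OF t] .
      also have "\<dots> \<le> C w * \<bar>t\<bar> ^ k" by (intro mult_left_mono power_increasing that t1 C(1))
      finally show ?thesis unfolding power_mult_distrib[symmetric] by (rule power_mono[OF _ L2n_nonneg])
    qed
    have "(L2n (G pm t))\<^sup>2 + (\<Sum>m\<in>{1..k}. \<Sum>w\<in>{w. length w = m \<and> set w \<subseteq> B}. (L2n (act_word w (G pm t)))\<^sup>2)
      \<le> (C [])\<^sup>2 * (\<bar>t\<bar> ^ k)\<^sup>2 + (\<Sum>m\<in>{1..k}. \<Sum>w\<in>{w. length w = m \<and> set w \<subseteq> B}. (C w)\<^sup>2 * (\<bar>t\<bar> ^ k)\<^sup>2)"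
      using b[of "[]"] by (intro add_mono sum_mono b) auto
    also have "\<dots> = Q * (\<bar>t\<bar> ^ k)\<^sup>2" by (simp add: Q_def distrib_right sum_distrib_right)
    finally have "sob_int B k (G pm t) \<le> sqrt (Q * (\<bar>t\<bar> ^ k)\<^sup>2)" unfolding sob_int_def by simp
    then show ?thesis by (simp add: real_sqrt_mult)
  qed
  then show ?thesis using Q by (intro exI[of _ "sqrt Q"]) simp
qed

lemma zero_in_ind_smooth: "(\<lambda>_. 0) \<in> ind_smooth pm t"
  by (simp add: ind_smooth_def smooth_off0_iff smooth_const)

lemma L2n_zero [simp]: "L2n (\<lambda>_. 0) = 0"
  by (simp add: L2n_def)

lemma dpi_zero [simp]: "dpi X (\<lambda>_. 0) = (\<lambda>_. 0)"
  by (simp add: fun_eq_iff dpi_dd dd_def)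

lemma act_word_zero [simp]: "act_word w (\<lambda>_. 0) = (\<lambda>_. 0)"
  by (induction w) simp_all

lemma sob_int_zero: "sob_int B k (\<lambda>_. 0) = 0"
  by (simp add: sob_int_def)

lemma sob_int_nonneg: "0 \<le> sob_int B k F"
  unfolding sob_int_def by (intro real_sqrt_ge_zero add_nonneg_nonneg sum_nonneg) auto

lemma sob_bound:
  fixes G :: "bool \<Rightarrow> real \<Rightarrow> real^'n::finite \<Rightarrow> complex"
  assumes "tame t0 G" "t0 \<ge> 1" "r \<ge> 0" "\<And>pm t. \<bar>t\<bar> \<ge> t0 \<Longrightarrow> G pm t \<in> ind_smooth pm t"
  shows "\<exists>C\<ge>0. \<forall>pm t. \<bar>t\<bar> \<ge> t0 \<longrightarrow> sob B pm t r (G pm t) \<le> C * \<bar>t\<bar> powr r"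
proof -
  obtain C where C: "\<And>k. C k \<ge> 0" "\<And>k pm t. \<bar>t\<bar> \<ge> t0 \<Longrightarrow> sob_int B k (G pm t) \<le> C k * \<bar>t\<bar> ^ k"
    using sob_int_bound[OF assms(1,2), of B] by metis
  define D where "D = (\<Sum>k\<le>Suc (nat \<lfloor>r\<rfloor>). C k)"
  have D: "C k \<le> D" if "k \<le> Suc (nat \<lfloor>r\<rfloor>)" for k
    unfolding D_def by (rule member_le_sum) (use that C in auto)
  have D0: "D \<ge> 0" unfolding D_def by (intro sum_nonneg C)
  have "sob B pm t r (G pm t) \<le> (interp_upper r * D) * \<bar>t\<bar> powr r" if t: "\<bar>t\<bar> \<ge> t0" for pm t
    unfolding sob_def
  proof (rule interp_le[OF assms(3)])
    show "sob_int B k (G pm t) \<le> D * \<bar>t\<bar> ^ k" if "k \<le> Suc (nat \<lfloor>r\<rfloor>)" for k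
      using C(2)[OF t] D[OF that] by (meson mult_right_mono order_trans zero_le_power abs_ge_zero)
  qed (use assms t D0 zero_in_ind_smooth sob_int_zero sob_int_nonneg in auto)
  then show ?thesis using interp_upper_nonneg[OF assms(3)] D0 by (intro exI[of _ "interp_upper r * D"]) auto
qed

section \<open>The solution and its right-hand side\<close>

text \<open>This cutoff does not involve \<open>x $ i\<close>, so \<open>u\<^sub>i\<^sub>j\<close>
  does not see it and the equation stays an ordinary differential equation in y. Being built from
  ratios of the other coordinates, it is also unchanged when these are dilated together by
  \<kappa>.\<close>

definition tail :: "'n \<Rightarrow> 'n \<Rightarrow> real^'n::finite \<Rightarrow> real" where
  "tail i j x = (\<Prod>k\<in>-{i, j}. bump (-1) 1 (x $ k / x $ j))"

lemma smooth_tail: "smooth {x. x $ j \<noteq> 0} (tail i j)"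
  unfolding tail_def[abs_def]
  by (intro smooth_prod smooth_compose[OF _ _ smooth_bump] smooth_divide smooth_nth open_nth_neq) auto

lemma tail_0:
  assumes "k \<notin> {i, j}" "\<bar>x $ k\<bar> \<ge> \<bar>x $ j\<bar>" "x $ j \<noteq> 0"
  shows "tail i j x = 0"
proof -
  have "\<bar>x $ k / x $ j\<bar> \<ge> 1" using assms by (simp add: abs_divide)
  then have "bump (-1) 1 (x $ k / x $ j) = 0" by (intro bump_0) linarith
  then show ?thesis unfolding tail_def using assms(1) by (intro prod_zero) auto
qed

lemma smooth_ratio: "smooth {x::real^'n::finite. x $ j \<noteq> 0} (\<lambda>x. x $ i / x $ j)"
  by (intro smooth_divide smooth_nth open_nth_neq) auto

lemma wfun_ind_smooth:
  fixes \<Phi> :: "real^'n::finite \<Rightarrow> complex"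
  assumes "cone_supp p M \<Phi>" "d p = 1" "\<And>k. d k \<noteq> 0" "\<And>a x. a \<noteq> 0 \<Longrightarrow> \<Phi> (a *\<^sub>R x) = \<Phi> x"
  shows "wfun p pm t d \<Phi> \<in> ind_smooth pm t"
proof -
  have "wfun p pm t d \<Phi> (a *\<^sub>R x) = eps_char pm a * complex_of_real (\<bar>a\<bar> powr (- real CARD('n) / 2))
     * cis (- t * ln \<bar>a\<bar>) * wfun p pm t d \<Phi> x" if a: "a \<noteq> 0" for a x
  proof -
    have "scal d (a *\<^sub>R x) = a *\<^sub>R scal d x" by (simp add: vec_eq_iff)
    moreover have "mc CARD('n) pm t (a * x $ p) = mc CARD('n) pm t a * mc CARD('n) pm t (x $ p)"
      using mc_mult[OF a] by (cases "x $ p = 0") auto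
    ultimately show ?thesis using assms(4)[OF a] by (simp add: wfun_def mc_def)
  qed
  then show ?thesis
    using smooth_wfun[where d = d, OF assms(1-3)] by (simp add: ind_smooth_def smooth_off0_iff wfun_def)
qed

lemma ind_smooth_add: "F \<in> ind_smooth pm t \<Longrightarrow> G \<in> ind_smooth pm t \<Longrightarrow> (\<lambda>x. a * F x + b * G x) \<in> ind_smooth pm t"
  by (auto simp: ind_smooth_def smooth_off0_iff algebra_simps intro!: smooth_add smooth_mult smooth_const)

text \<open>The profile Q. The sign makes the step rise on the side of \<kappa>; the quotient runs
  from 0 to 1 while y / \<kappa> passes from 3/4 to 5/4, and so takes the step back exactly.\<close>

definition amp :: "real \<Rightarrow> real \<Rightarrow> real \<Rightarrow> complex" where
  "amp lam t y = of_real (step (sgn (- t / lam) * y)) - oscint t (y / (- t / lam)) / oscint t 2"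

definition sol_sym :: "'n \<Rightarrow> 'n \<Rightarrow> real \<Rightarrow> real \<Rightarrow> real^'n::finite \<Rightarrow> complex" where
  "sol_sym i j lam t x = cis (lam * (x $ i / x $ j)) * amp lam t (x $ i / x $ j) * of_real (tail i j x)"

definition sol :: "'n \<Rightarrow> 'n \<Rightarrow> real \<Rightarrow> bool \<Rightarrow> real \<Rightarrow> real^'n::finite \<Rightarrow> complex" where
  "sol i j lam pm t = wfun j pm t (\<lambda>_. 1) (sol_sym i j lam t)"

text \<open>The right-hand side has a near part, from the rise of \<open>amp\<close> at bounded \<open>y = x\<^sub>i / x\<^sub>j\<close>, and
  a far part, from its return to 0 around \<open>y = \<kappa> = - t / lam\<close>. Rewriting the far part with the
  multiplier in \<open>x\<^sub>i\<close> cancels its oscillation.\<close>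
definition near_sym :: "'n \<Rightarrow> 'n \<Rightarrow> real \<Rightarrow> bool \<Rightarrow> real^'n::finite \<Rightarrow> complex" where
  "near_sym i j lam b x = cis (lam * (x $ i / x $ j)) *
     of_real ((if b then -1 else 1) * dd 1 step ((if b then 1 else -1) * (x $ i / x $ j)) * tail i j x)"

text \<open>With a = n/2 the power undoes the modulus \<open>z powr (- n / 2)\<close> that appears
  when the multiplier is moved from \<open>x\<^sub>j\<close> to \<open>x\<^sub>i\<close>.\<close>

definition qbump :: "real \<Rightarrow> real \<Rightarrow> real" where
  "qbump a z = bump (3/4) (5/4) z * z powr a"

definition far_sym :: "'n \<Rightarrow> 'n \<Rightarrow> real^'n::finite \<Rightarrow> complex" where
  "far_sym i j x = of_real (qbump (CARD('n) / 2) (x $ i / x $ j) * tail i j x)"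

text \<open>In the support of the far part, normalized by \<open>x $ i\<close> = 1,
  \<open>x $ j\<close> is of size 1 / \<kappa> and the remaining coordinates are at most of that
  size. The dilation brings them to unit scale.\<close>

definition far_scal :: "'n \<Rightarrow> real \<Rightarrow> 'n \<Rightarrow> real" where
  "far_scal i \<kappa> k = (if k = i then 1 else \<kappa>)"

text \<open>The character at \<kappa> comes from splitting \<open>x $ i\<close> as \<kappa> times a
  number of the size of \<open>x $ j\<close>, the factor \<open>cis (- t)\<close> from the
  normalized critical value in \<open>osc\<close>, and the rest of the denominator from the
  derivative of the second term of \<open>amp\<close>.\<close>

definition far_coeff :: "nat \<Rightarrow> real \<Rightarrow> bool \<Rightarrow> real \<Rightarrow> complex" where
  "far_coeff N lam pm t = cis (- t) / (mc N pm t (- t / lam) * of_real (- t / lam) * oscint t 2)"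

text \<open>The factor 1 gives the combination of two terms the shape that
  \<open>tame_wfun_add\<close> and \<open>ind_smooth_add\<close> expect.\<close>

definition rhs :: "'n \<Rightarrow> 'n \<Rightarrow> real \<Rightarrow> bool \<Rightarrow> real \<Rightarrow> real^'n::finite \<Rightarrow> complex" where
  "rhs i j lam pm t x = 1 * wfun j pm t (\<lambda>_. 1) (near_sym i j lam (- t / lam > 0)) x
     + far_coeff CARD('n) lam pm t * wfun i pm t (far_scal i (- t / lam)) (far_sym i j) x"

section \<open>Smoothness and supports of the pieces\<close>

lemma smooth_dd1: "smooth S F \<Longrightarrow> smooth S (dd (1::real) F)"
  by (rule smooth_dd) simp_all

lemma smooth_ratio_compose:
  fixes h :: "real \<Rightarrow> 'b::real_normed_algebra_1"
  assumes "smooth UNIV h"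
  shows "smooth {x::real^'n::finite. x $ j \<noteq> 0} (\<lambda>x. h (c * (x $ i / x $ j)))"
  by (rule smooth_compose[OF open_nth_neq open_UNIV assms])
    (intro smooth_mult smooth_const smooth_ratio open_nth_neq | simp)+

lemma cone_supp_near:
  assumes "i \<noteq> j"
  shows "cone_supp j 2 (near_sym i j lam b)"
  unfolding cone_supp_def
proof (intro conjI allI impI)
  show "smooth {x. x $ j \<noteq> 0} (near_sym i j lam b)"
    unfolding near_sym_def[abs_def]
    by (intro smooth_mult smooth_of_real smooth_const smooth_tail open_nth_neq
        smooth_ratio_compose[OF smooth_cis] smooth_ratio_compose[OF smooth_dd1[OF smooth_step]])
  fix x :: "real^'a" assume "\<exists>k. 2 * \<bar>x $ j\<bar> < \<bar>x $ k\<bar>"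
  then obtain k where k: "2 * \<bar>x $ j\<bar> < \<bar>x $ k\<bar>" by blast
  show "near_sym i j lam b x = 0"
  proof (cases "x $ j = 0")
    case True
    then show ?thesis by (simp add: near_sym_def dd_step_0)
  next
    case False
    have kj: "k \<noteq> j" using k by auto
    show ?thesis
    proof (cases "k = i")
      case True
      have "\<bar>x $ i / x $ j\<bar> > 2" using k True False by (simp add: abs_divide field_simps)
      then have "dd 1 step ((if b then 1 else -1) * (x $ i / x $ j)) = 0"
      proof (intro dd_step_0)
        show "(if b then 1 else -1) * r < 1/4 \<or> 1 < (if b then 1 else -1) * r" if "\<bar>r\<bar> > 2" for r :: real
          using that by (cases b) auto
      qed
      then show ?thesis by (simp add: near_sym_def)
    next
      case False
      then have "tail i j x = 0" using kj k \<open>x $ j \<noteq> 0\<close> by (intro tail_0[of k]) auto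
      then show ?thesis by (simp add: near_sym_def)
    qed
  qed
qed

lemma qbump_0: "z \<le> 3/4 \<or> 5/4 \<le> z \<Longrightarrow> qbump a z = 0"
  by (simp add: qbump_def bump_0)

lemma smooth_qbump: "smooth UNIV (qbump a)"
proof -
  have p: "smooth {0<..} (\<lambda>z::real. z powr a)"
  proof (rule smooth_ode[where a = "\<lambda>z. a * inverse z" and c = "\<lambda>_. 0"])
    show "((\<lambda>z. z powr a) has_vector_derivative (a * inverse z * z powr a + 0)) (at z)" if "z \<in> {0<..}" for z :: real
      using that by (auto intro!: derivative_eq_intros
          simp: has_real_derivative_iff_has_vector_derivative[symmetric] powr_diff divide_inverse)
  qed (auto intro!: smooth_mult smooth_const smooth_subset[OF smooth_inverse])
  have "smooth {1/2<..} (qbump a)"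
    unfolding qbump_def[abs_def]
    by (intro smooth_mult smooth_subset[OF smooth_bump] smooth_subset[OF p]) auto
  moreover have "smooth {..<3/4} (qbump a)"
    by (rule smooth_cong[OF _ smooth_const[of _ 0]]) (auto simp: qbump_0)
  moreover have "{1/2<..} \<union> {..<3/4} = (UNIV :: real set)" by auto
  ultimately show ?thesis using smooth_Un by metis
qed

text \<open>The symbol is written with denominators \<open>x $ j\<close> but belongs to the chart of
  \<open>x $ i\<close>. Where \<bar>x $ j\<bar> is below half of \<bar>x $ i\<bar> the bump
  vanishes, which gives smoothness across \<open>x $ j = 0\<close>. In its support \<bar>x $ j\<bar>
  is below 4/3 \<bar>x $ i\<bar>, and \<open>tail\<close> keeps the other coordinates below \<bar>x
  $ j\<bar>, so the aperture 2 suffices.\<close>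

lemma cone_supp_far:
  fixes i j :: "'n::finite"
  assumes "i \<noteq> j"
  shows "cone_supp i 2 (far_sym i j)"
  unfolding cone_supp_def
proof (intro conjI allI impI)
  let ?q = "qbump (CARD('n) / 2)"
  have 1: "smooth {x. x $ j \<noteq> 0} (far_sym i j)"
    unfolding far_sym_def[abs_def]
    by (intro smooth_mult smooth_of_real smooth_tail open_nth_neq
        smooth_ratio_compose[OF smooth_qbump, of j "CARD('n) / 2" 1 i, simplified])
  have z: "far_sym i j x = 0" if "\<bar>x $ j\<bar> < \<bar>x $ i\<bar> / 2" for x :: "real^'n"
  proof -
    have "?q (x $ i / x $ j) = 0"
    proof (cases "x $ j = 0")
      case False
      then have "\<bar>x $ i / x $ j\<bar> > 2" using that by (simp add: abs_divide field_simps)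
      then show ?thesis by (intro qbump_0) linarith
    qed (simp add: qbump_0)
    then show ?thesis by (simp add: far_sym_def)
  qed
  have o: "open {x::real^'n. \<bar>x $ j\<bar> < \<bar>x $ i\<bar> / 2}"
    by (intro open_Collect_less continuous_intros) auto
  have 2: "smooth {x. \<bar>x $ j\<bar> < \<bar>x $ i\<bar> / 2} (far_sym i j)"
    by (rule smooth_cong[OF o smooth_const[of _ 0]]) (use z in auto)
  show "smooth {x. x $ i \<noteq> 0} (far_sym i j)"
    by (rule smooth_subset[OF smooth_Un[OF 1 2]]) auto
  fix x :: "real^'n" assume "\<exists>k. 2 * \<bar>x $ i\<bar> < \<bar>x $ k\<bar>"
  then obtain k where k: "2 * \<bar>x $ i\<bar> < \<bar>x $ k\<bar>" by blast
  show "far_sym i j x = 0"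
  proof (cases "?q (x $ i / x $ j) = 0")
    case False
    then have r: "3/4 < x $ i / x $ j" "x $ i / x $ j < 5/4" using qbump_0 by (meson linorder_not_less)+
    then have xj: "x $ j \<noteq> 0" by auto
    have "\<bar>x $ i / x $ j\<bar> > 3/4" using r by linarith
    then have "3/4 * \<bar>x $ j\<bar> < \<bar>x $ i\<bar>" using xj by (simp add: abs_divide field_simps)
    then have kk: "\<bar>x $ j\<bar> < \<bar>x $ k\<bar>" "k \<noteq> i" "k \<noteq> j" using k by auto
    then have "tail i j x = 0" using xj by (intro tail_0[of k]) auto
    then show ?thesis by (simp add: far_sym_def)
  qed (simp add: far_sym_def)
qed

text \<open>On the side away from \<kappa> both terms are 0; far beyond \<kappa> both are 1. The
  value at y = 0 is included because it is the value of the ratio on the hyperplane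
  \<open>x $ j = 0\<close>.\<close>

lemma amp_0:
  assumes "- t / lam \<noteq> 0" "oscint t 2 \<noteq> 0" "y = 0 \<or> \<bar>y\<bar> > max 1 (2 * \<bar>- t / lam\<bar>)"
  shows "amp lam t y = 0"
proof -
  define \<kappa> where "\<kappa> = - t / lam"
  have k: "\<kappa> \<noteq> 0" using assms(1) \<kappa>_def by simp
  have a3: "y = 0 \<or> \<bar>y\<bar> > max 1 (2 * \<bar>\<kappa>\<bar>)" using assms(3) unfolding \<kappa>_def .
  consider "y / \<kappa> \<le> 0" | "y / \<kappa> \<ge> 2" "\<bar>y\<bar> > 1"
  proof -
    have "\<bar>y / \<kappa>\<bar> \<ge> 2" if "y \<noteq> 0"
      using a3 that k by (simp add: abs_divide field_simps)
    then show ?thesis using that a3 by fastforce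
  qed
  then show ?thesis
  proof cases
    case 1
    then have "sgn \<kappa> * y \<le> 0" by (auto simp: divide_le_0_iff sgn_if)
    moreover have "y / \<kappa> \<le> 3/4" using 1 by linarith
    ultimately show ?thesis unfolding amp_def \<kappa>_def[symmetric] by (simp add: step_0 oscint_0)
  next
    case 2
    then have "\<bar>y\<bar> = sgn \<kappa> * y" by (auto simp: le_divide_eq sgn_if zero_le_mult_iff abs_if split: if_splits)
    then have "step (sgn \<kappa> * y) = 1" using 2 by (intro step_1) simp
    then show ?thesis unfolding amp_def \<kappa>_def[symmetric]

    proof -
      have "5/4 \<le> y / \<kappa>" using 2 by linarith
      then have "oscint t (y / \<kappa>) = oscint t 2" by (rule oscint_const)
      then show "of_real (step (sgn \<kappa> * y)) - oscint t (y / \<kappa>) / oscint t 2 = 0"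
        using \<open>step (sgn \<kappa> * y) = 1\<close> assms(2) by simp
    qed
  qed
qed

lemma smooth_amp: "smooth UNIV (amp lam t)"
proof -
  have "oscint t (y / c) = oscint t ((1 / c) * y)" for y c by simp
  then have "amp lam t = (\<lambda>y. of_real (step (sgn (- t / lam) * y)) + (- 1 / oscint t 2) * oscint t ((1 / (- t / lam)) * y))"
    unfolding amp_def[abs_def] by (simp only: fun_eq_iff) simp
  moreover have "smooth UNIV (\<lambda>y. of_real (step (sgn (- t / lam) * y)) + (- 1 / oscint t 2) * oscint t ((1 / (- t / lam)) * y))"
    by (intro smooth_add smooth_mult smooth_of_real smooth_const smooth_id
        smooth_compose[OF _ _ smooth_step] smooth_compose[OF _ _ smooth_oscint]) auto
  ultimately show ?thesis by simp
qed

text \<open>The aperture grows with t. This is harmless, because the cone is used for the solution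
  only to establish that it is a smooth vector; its size is read off pointwise in
  \<open>sol_on_box\<close>.\<close>

lemma cone_supp_sol:
  assumes "i \<noteq> j" "- t / lam \<noteq> 0" "oscint t 2 \<noteq> 0"
  shows "cone_supp j (max 1 (2 * \<bar>- t / lam\<bar>)) (sol_sym i j lam t)"
  unfolding cone_supp_def
proof (intro conjI allI impI)
  let ?M = "max 1 (2 * \<bar>- t / lam\<bar>)"
  show "smooth {x. x $ j \<noteq> 0} (sol_sym i j lam t)"
    unfolding sol_sym_def[abs_def]
    by (intro smooth_mult smooth_of_real smooth_tail open_nth_neq
        smooth_ratio_compose[OF smooth_cis] smooth_ratio_compose[OF smooth_amp, of j lam t 1 i, simplified])
  fix x :: "real^'a" assume "\<exists>k. ?M * \<bar>x $ j\<bar> < \<bar>x $ k\<bar>"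
  then obtain k where k: "?M * \<bar>x $ j\<bar> < \<bar>x $ k\<bar>" by blast
  show "sol_sym i j lam t x = 0"
  proof (cases "x $ j = 0")
    case True
    then show ?thesis using amp_0[OF assms(2,3), of 0] by (simp add: sol_sym_def)
  next
    case False
    have m: "1 * \<bar>x $ j\<bar> \<le> ?M * \<bar>x $ j\<bar>" by (rule mult_right_mono) auto
    have kj: "k \<noteq> j" using k m by auto
    have km: "\<bar>x $ k\<bar> \<ge> \<bar>x $ j\<bar>" using k m by linarith
    show ?thesis
    proof (cases "k = i")
      case True
      have "\<bar>x $ i / x $ j\<bar> > ?M" 
      proof -
        have p: "0 < \<bar>x $ j\<bar>" using False by simp
        show ?thesis unfolding abs_divide[of "x $ i"] pos_less_divide_eq[OF p] using k by (simp only: True)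
      qed
      then have "amp lam t (x $ i / x $ j) = 0" by (intro amp_0 assms) auto
      then show ?thesis by (simp add: sol_sym_def)
    next
      case False
      then have "tail i j x = 0" using kj km \<open>x $ j \<noteq> 0\<close> by (intro tail_0[of k]) auto
      then show ?thesis by (simp add: sol_sym_def)
    qed
  qed
qed

lemma tail_scale: "a \<noteq> 0 \<Longrightarrow> tail i j (a *\<^sub>R x) = tail i j x"
  by (simp add: tail_def)

lemma sol_ind_smooth:
  assumes "i \<noteq> j" "- t / lam \<noteq> 0" "oscint t 2 \<noteq> 0"
  shows "sol i j lam pm t \<in> ind_smooth pm t"
  unfolding sol_def by (rule wfun_ind_smooth[OF cone_supp_sol[OF assms]]) (simp_all add: sol_sym_def tail_scale)

lemma rhs_ind_smooth:
  assumes "i \<noteq> j" "- t / lam \<noteq> 0"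
  shows "rhs i j lam pm t \<in> ind_smooth pm t"
  unfolding rhs_def[abs_def]
proof (rule ind_smooth_add)
  show "wfun j pm t (\<lambda>_. 1) (near_sym i j lam (- t / lam > 0)) \<in> ind_smooth pm t"
    by (rule wfun_ind_smooth[OF cone_supp_near[OF assms(1)]]) (simp_all add: near_sym_def tail_scale)
  show "wfun i pm t (far_scal i (- t / lam)) (far_sym i j) \<in> ind_smooth pm t"
    by (rule wfun_ind_smooth[OF cone_supp_far[OF assms(1)]])
      (use assms in \<open>simp_all add: far_sym_def tail_scale far_scal_def\<close>)
qed

section \<open>The equation and the size of its right-hand side\<close>

lemma amp_deriv:
  "(amp lam t has_vector_derivative (of_real (sgn (- t / lam) * dd 1 step (sgn (- t / lam) * y))
     - osc t (y / (- t / lam)) / (of_real (- t / lam) * oscint t 2))) (at y)"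
proof -
  define \<kappa> where "\<kappa> = - t / lam"
  have p: "((\<lambda>y. c * y) has_vector_derivative c) (at y)" for c :: real
    by (auto simp: has_vector_derivative_def intro!: derivative_eq_intros)
  have 1: "((\<lambda>y. step (sgn \<kappa> * y)) has_vector_derivative (sgn \<kappa> * dd 1 step (sgn \<kappa> * y))) (at y)"
    using vector_diff_chain_at[OF p[of "sgn \<kappa>"] step_deriv] unfolding o_def real_scaleR_def .
  have 2: "((\<lambda>y. oscint t (y / \<kappa>)) has_vector_derivative ((1 / \<kappa>) *\<^sub>R osc t (y / \<kappa>))) (at y)"
    using vector_diff_chain_at[OF p[of "1 / \<kappa>"] oscint_deriv] by (simp add: o_def)
  have "((\<lambda>y. of_real (step (sgn \<kappa> * y)) - oscint t (y / \<kappa>) / oscint t 2) has_vector_derivative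
    (of_real (sgn \<kappa> * dd 1 step (sgn \<kappa> * y)) - ((1 / \<kappa>) *\<^sub>R osc t (y / \<kappa>)) / oscint t 2)) (at y)"
    by (intro has_vector_derivative_diff has_vector_derivative_divide 2
        has_vector_derivative_of_real[OF 1[folded has_real_derivative_iff_has_vector_derivative]])
  then show ?thesis
    unfolding amp_def[abs_def] \<kappa>_def[symmetric] by (simp add: scaleR_conv_of_real)
qed

lemma solution_equation:
  fixes i j :: "'n::finite"
  assumes "i \<noteq> j" "t \<noteq> 0" "lam \<noteq> 0" "oscint t 2 \<noteq> 0"
  shows "rhs i j lam pm t = (\<lambda>x. dpi (elem_mat i j) (sol i j lam pm t) x + \<i> * complex_of_real lam * sol i j lam pm t x)"
proof
  fix x :: "real^'n"
  define \<kappa> where "\<kappa> = - t / lam"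
  have k: "\<kappa> \<noteq> 0" using assms by (simp add: \<kappa>_def)
  have lk: "lam * \<kappa> = - t" using assms by (simp add: \<kappa>_def)
  let ?m = "mc CARD('n) pm t" and ?I = "oscint t 2"
  show "rhs i j lam pm t x = dpi (elem_mat i j) (sol i j lam pm t) x + \<i> * complex_of_real lam * sol i j lam pm t x"
  proof (cases "x $ j = 0")
    \<comment> \<open>On this hyperplane the derivative carries the factor \<open>x $ j\<close>, the
      solution and the near part carry the character at 0, and the far part is evaluated at the
      ratio 0, where \<open>qbump\<close> vanishes. Both sides are 0.\<close>
    case True
    have "far_sym i j (scal (far_scal i \<kappa>) x) = 0" using True by (simp add: far_sym_def qbump_0)
    then show ?thesis using True by (simp add: rhs_def dpi_elem_mat sol_def wfun_def \<kappa>_def)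
  next
    case xj: False
    define y where "y = x $ i / x $ j"
    define D where "D = of_real (sgn \<kappa> * dd 1 step (sgn \<kappa> * y)) - osc t (y / \<kappa>) / (of_real \<kappa> * ?I)"
    have ad: "(amp lam t has_vector_derivative D) (at y)"
      using amp_deriv[of lam t y] by (simp add: D_def \<kappa>_def)
    have cd: "((\<lambda>y. cis (lam * y)) has_vector_derivative (\<i> * of_real lam * cis (lam * y))) (at y)"
    proof -
      have "((\<lambda>y. exp (\<i> * of_real (lam * y))) has_derivative (\<lambda>h. exp (\<i> * of_real (lam * y)) * (\<i> * of_real (lam * h)))) (at y)"
        by (rule has_derivative_cexp) (auto intro!: derivative_eq_intros)
      then show ?thesis by (simp add: has_vector_derivative_def cis_conv_exp scaleR_conv_of_real mult_ac)
    qed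
    let ?h = "\<lambda>y. cis (lam * y) * amp lam t y"
    let ?h' = "cis (lam * y) * D + \<i> * of_real lam * cis (lam * y) * amp lam t y"
    have hd: "(?h has_vector_derivative ?h') (at y)"
      by (rule has_vector_derivative_mult[OF cd ad])
    have rd: "((\<lambda>\<tau>. (x $ i + \<tau>) / x $ j) has_vector_derivative (1 / x $ j)) (at 0)"
      using xj by (auto simp: has_vector_derivative_def intro!: derivative_eq_intros)
    have ch: "((\<lambda>\<tau>. ?h ((x $ i + \<tau>) / x $ j)) has_vector_derivative ((1 / x $ j) *\<^sub>R ?h')) (at 0)"
      using vector_diff_chain_at[OF rd, of ?h ?h'] hd by (simp add: o_def y_def)
    have tl: "tail i j (x + \<tau> *\<^sub>R axis i 1) = tail i j x" for \<tau>
      unfolding tail_def using assms(1) by (intro prod.cong refl) (auto simp: axis_def)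
    have eq: "sol i j lam pm t (x + \<tau> *\<^sub>R axis i 1) = ?m (x $ j) * of_real (tail i j x) * ?h ((x $ i + \<tau>) / x $ j)" for \<tau>
    proof -
      have "(x + \<tau> *\<^sub>R axis i 1) $ j = x $ j" "(x + \<tau> *\<^sub>R axis i 1) $ i = x $ i + \<tau>"
        using assms(1) by (auto simp: axis_def)
      moreover have "scal (\<lambda>_. 1) z = z" for z :: "real^'n" by (simp add: vec_eq_iff)
      ultimately show ?thesis by (simp only: sol_def wfun_def sol_sym_def tl mult_ac)
    qed
    have "dd (axis i 1) (sol i j lam pm t) x = ?m (x $ j) * of_real (tail i j x) * ((1 / x $ j) *\<^sub>R ?h')"
      unfolding dd_def eq by (rule vector_derivative_at[OF has_vector_derivative_mult_right[OF ch]])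
    moreover have "sol i j lam pm t x = ?m (x $ j) * of_real (tail i j x) * ?h y"
      using eq[of 0] by (simp add: y_def)
    ultimately have R: "dpi (elem_mat i j) (sol i j lam pm t) x + \<i> * complex_of_real lam * sol i j lam pm t x
       = - ?m (x $ j) * of_real (tail i j x) * cis (lam * y) * D"
      using xj by (simp add: dpi_elem_mat scaleR_conv_of_real algebra_simps)
    have near: "wfun j pm t (\<lambda>_. 1) (near_sym i j lam (\<kappa> > 0)) x
       = - ?m (x $ j) * of_real (tail i j x) * cis (lam * y) * of_real (sgn \<kappa> * dd 1 step (sgn \<kappa> * y))"
    proof -
      have "scal (\<lambda>_. 1) x = x" by (simp add: vec_eq_iff)
      then show ?thesis using k by (simp add: wfun_def near_sym_def y_def sgn_if)
    qed
    have far: "far_coeff CARD('n) lam pm t * wfun i pm t (far_scal i \<kappa>) (far_sym i j) x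
      = ?m (x $ j) * of_real (tail i j x) * cis (lam * y) * (osc t (y / \<kappa>) / (of_real \<kappa> * ?I))"
    proof -
      define \<eta> where "\<eta> = y / \<kappa>"
      have rat: "scal (far_scal i \<kappa>) x $ i / scal (far_scal i \<kappa>) x $ j = \<eta>"
        using assms(1) by (simp add: far_scal_def \<eta>_def y_def)
      have tl': "tail i j (scal (far_scal i \<kappa>) x) = tail i j x"
        unfolding tail_def using assms(1) k by (intro prod.cong refl) (auto simp: far_scal_def)
      have W: "wfun i pm t (far_scal i \<kappa>) (far_sym i j) x = ?m (x $ i) * of_real (qbump (CARD('n) / 2) \<eta> * tail i j x)"
        unfolding wfun_def far_sym_def rat tl' ..
      show ?thesis
      proof (cases "3/4 < \<eta> \<and> \<eta> < 5/4")
        case False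
        then show ?thesis unfolding W \<eta>_def[symmetric] by (simp add: qbump_0 osc_0 not_less)
      next
        case True
        then have e: "\<eta> > 0" by simp
        \<comment> \<open>The character splits along this factorization: its value at \<kappa>
          cancels in \<open>far_coeff\<close>, the modulus of its value at \<eta> cancels against
          the power in \<open>qbump\<close>, and the phase at \<eta> is the one that
          \<open>osc\<close> was built to produce.\<close>
        have xi: "x $ i = \<kappa> * (\<eta> * x $ j)" using k xj by (simp add: \<eta>_def y_def)
        have mi: "?m (x $ i) = ?m \<kappa> * (?m \<eta> * ?m (x $ j))"
          unfolding xi using mc_mult k e xj by (metis less_numeral_extra(3) mult_eq_0_iff)
        have mk: "?m \<kappa> \<noteq> 0" using norm_mc[OF k, of "CARD('n)" pm t] k by auto
        have "lam * y = (lam * \<kappa>) * \<eta>" using k by (simp add: \<eta>_def)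
        then have y: "lam * y = - t * \<eta>" unfolding lk .
        have "cis (- t) * ?m \<eta> * of_real (qbump (CARD('n) / 2) \<eta>) = of_real (bump (3/4) (5/4) \<eta>) * (cis (- t) * cis (- t * ln \<eta>))"
          using e by (simp add: mc_pos qbump_def powr_minus field_simps)
        also have "cis (- t) * cis (- t * ln \<eta>) = cis (lam * y) * cis (t * (\<eta> - 1 - ln \<eta>))"
          unfolding cis_mult y by (simp add: algebra_simps)
        finally have key: "cis (- t) * ?m \<eta> * of_real (qbump (CARD('n) / 2) \<eta>) = cis (lam * y) * osc t \<eta>"
          by (simp add: osc_def)
        have "far_coeff CARD('n) lam pm t * wfun i pm t (far_scal i \<kappa>) (far_sym i j) x
          = (cis (- t) * ?m \<eta> * of_real (qbump (CARD('n) / 2) \<eta>)) * (?m (x $ j) * of_real (tail i j x) / (of_real \<kappa> * ?I))"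
          unfolding W mi far_coeff_def \<kappa>_def[symmetric] using mk by simp
        then show ?thesis unfolding key \<eta>_def[symmetric] by simp
      qed
    qed
    show ?thesis
      unfolding R rhs_def \<kappa>_def[symmetric] near far D_def by (simp add: algebra_simps)
  qed
qed

lemma tame_rhs:
  fixes i j :: "'n::finite"
  assumes "i \<noteq> j" "lam \<noteq> 0"
  obtains t0 where "t0 \<ge> 1" "\<And>t0'. t0' \<ge> t0 \<Longrightarrow> tame t0' (rhs i j lam)"
    "\<And>t. \<bar>t\<bar> \<ge> t0 \<Longrightarrow> oscint t 2 \<noteq> 0" "\<And>t. \<bar>t\<bar> \<ge> t0 \<Longrightarrow> \<bar>- t / lam\<bar> \<ge> 10 * real CARD('n)"
proof -
  obtain c where c: "c > 0" "\<And>t. \<bar>t\<bar> \<ge> 144 \<Longrightarrow> c / sqrt \<bar>t\<bar> \<le> cmod (oscint t 2)"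
    using oscint_lower by metis
  \<comment> \<open>144 is the threshold of the oscillatory integral; the second entry gives
    \<bar>\<kappa>\<bar> \<ge> 10 n, which later places the test box inside the annulus.\<close>
  define t0 where "t0 = max 144 (10 * real CARD('n) * \<bar>lam\<bar>)"
  have osc: "oscint t 2 \<noteq> 0" if "\<bar>t\<bar> \<ge> t0" for t
  proof -
    have "\<bar>t\<bar> \<ge> 144" using that by (simp add: t0_def)
    then have "0 < cmod (oscint t 2)" using c by (intro less_le_trans[OF _ c(2)]) auto
    then show ?thesis by auto
  qed
  have kap: "\<bar>- t / lam\<bar> \<ge> 10 * real CARD('n)" if "\<bar>t\<bar> \<ge> t0" for t
    using that assms(2) by (simp add: t0_def abs_divide pos_le_divide_eq)
  have kap1: "\<bar>- t / lam\<bar> \<ge> 1" if "\<bar>t\<bar> \<ge> t0" for t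
  proof -
    have "real CARD('n) \<ge> 1" by (simp add: Suc_leI)
    then show ?thesis using kap[OF that] by linarith
  qed
  \<comment> \<open>A dominates 1 and \<bar>\<kappa> / t\<bar> = 1 / \<bar>lam\<bar>. The constant K
    below comes from the square of the far coefficient: it is \<bar>\<kappa>\<bar>^(n - 2) over the
    squared oscillatory integral, and with \<bar>t\<bar> = \<bar>lam \<kappa>\<bar> the bound c /
    \<open>sqrt \<bar>t\<bar>\<close> turns this into at most (\<bar>lam\<bar> / c^2)
    \<bar>\<kappa>\<bar>^(n - 1), the product of the dilations.\<close>
  define A where "A = max 1 (1 / \<bar>lam\<bar>)"
  define K where "K = max 1 (\<bar>lam\<bar> / c\<^sup>2)"
  have "tame t0' (rhs i j lam)" if t0': "t0' \<ge> t0" for t0'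
    unfolding rhs_def[abs_def]
  proof (rule tame_wfun_add[where M = 2 and A = A and K = K and ?e = "\<lambda>t. - t / lam > 0"
        and ?\<Phi>1.0 = "near_sym i j lam" and ?\<Phi>2.0 = "\<lambda>_. far_sym i j" and ?c1.0 = "\<lambda>_ _. 1"
        and ?c2.0 = "far_coeff CARD('n) lam" and ?d1.0 = "\<lambda>_ _. 1" and ?d2.0 = "\<lambda>t. far_scal i (- t / lam)"])
    show "cone_supp j 2 (near_sym i j lam b)" "cone_supp i 2 (far_sym i j)" for b
      by (rule cone_supp_near[OF assms(1)] cone_supp_far[OF assms(1)])+
    show "A \<ge> 0" by (simp add: A_def)
    fix t pm assume t': "\<bar>t\<bar> \<ge> t0'"
    then have t: "\<bar>t\<bar> \<ge> t0" using t0' by simp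
    have t1: "\<bar>t\<bar> \<ge> 1" using t by (simp add: t0_def)
    define \<kappa> where "\<kappa> = - t / lam"
    have k1: "\<bar>\<kappa>\<bar> \<ge> 1" using kap1[OF t] by (simp add: \<kappa>_def)
    have At: "1 \<le> A * \<bar>t\<bar>" using mult_mono[of 1 A 1 "\<bar>t\<bar>"] t1 by (simp add: A_def)
    have Ak: "\<bar>\<kappa>\<bar> \<le> A * \<bar>t\<bar>"
    proof -
      have "\<bar>\<kappa>\<bar> = (1 / \<bar>lam\<bar>) * \<bar>t\<bar>" by (simp add: \<kappa>_def abs_divide)
      also have "\<dots> \<le> A * \<bar>t\<bar>" by (rule mult_right_mono) (auto simp: A_def)
      finally show ?thesis .
    qed
    show "scaling j A t (\<lambda>_. 1)" using t1 At by (simp add: scaling_def)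
    have "\<bar>1 / \<kappa>\<bar> \<le> 1" using k1 by (simp add: abs_divide divide_le_eq_1)
    then have "\<bar>1 / \<kappa>\<bar> \<le> A * \<bar>t\<bar>" using At by linarith
    then show "scaling i A t (far_scal i (- t / lam))"
      using t1 At Ak k1 unfolding scaling_def far_scal_def \<kappa>_def[symmetric] by auto
    show "(cmod 1)\<^sup>2 \<le> K * (\<Prod>k\<in>(UNIV::'n set). \<bar>1\<bar>)" by (simp add: K_def)
    have P: "(\<Prod>k\<in>UNIV. \<bar>far_scal i \<kappa> k\<bar>) = \<bar>\<kappa>\<bar> ^ (CARD('n) - 1)"
    proof -
      have "(\<Prod>k\<in>UNIV. \<bar>far_scal i \<kappa> k\<bar>) = \<bar>far_scal i \<kappa> i\<bar> * (\<Prod>k\<in>UNIV - {i}. \<bar>far_scal i \<kappa> k\<bar>)"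
        by (rule prod.remove) auto
      also have "(\<Prod>k\<in>UNIV - {i}. \<bar>far_scal i \<kappa> k\<bar>) = (\<Prod>k\<in>UNIV - {i}. \<bar>\<kappa>\<bar>)"
        by (intro prod.cong) (auto simp: far_scal_def)
      finally show ?thesis by (simp add: far_scal_def card_Diff_singleton)
    qed
    have "(cmod (far_coeff CARD('n) lam pm t))\<^sup>2 = \<bar>\<kappa>\<bar> ^ CARD('n) / (\<kappa>\<^sup>2 * (cmod (oscint t 2))\<^sup>2)"
    proof -
      have "(\<bar>\<kappa>\<bar> powr (- real CARD('n) / 2))\<^sup>2 = \<bar>\<kappa>\<bar> powr (- real CARD('n))"
        by (simp add: power2_eq_square powr_add[symmetric])
      also have "\<dots> = 1 / \<bar>\<kappa>\<bar> ^ CARD('n)" using k1 by (simp add: powr_minus powr_realpow divide_inverse)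
      finally show ?thesis
        unfolding far_coeff_def \<kappa>_def[symmetric]
        using k1 by (subst norm_divide) (simp add: norm_mult norm_mc power_divide power_mult_distrib)
    qed
    also have "\<dots> \<le> \<bar>\<kappa>\<bar> ^ CARD('n) / (\<kappa>\<^sup>2 * (c\<^sup>2 / \<bar>t\<bar>))"
    proof -
      have "(c / sqrt \<bar>t\<bar>)\<^sup>2 \<le> (cmod (oscint t 2))\<^sup>2"
        using c t by (intro power_mono) (auto simp: t0_def)
      then have "c\<^sup>2 / \<bar>t\<bar> \<le> (cmod (oscint t 2))\<^sup>2" by (simp add: power_divide)
      then show ?thesis using k1 c t1 osc[OF t]
        by (intro divide_left_mono mult_left_mono mult_pos_pos divide_pos_pos) auto
    qed
    also have "\<dots> = (\<bar>lam\<bar> / c\<^sup>2) * \<bar>\<kappa>\<bar> ^ (CARD('n) - 1)"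
    proof -
      have e1: "\<bar>\<kappa>\<bar> ^ CARD('n) = \<bar>\<kappa>\<bar> * \<bar>\<kappa>\<bar> ^ (CARD('n) - 1)"
        by (metis power_Suc Suc_diff_1 zero_less_card_finite)
      have e2: "\<bar>t\<bar> = \<bar>lam\<bar> * \<bar>\<kappa>\<bar>" using assms(2) by (simp add: \<kappa>_def abs_divide)
      have e3: "\<kappa>\<^sup>2 = \<bar>\<kappa>\<bar> * \<bar>\<kappa>\<bar>" by (simp add: power2_eq_square)
      have gen: "(k * q) / ((k * k) * (d / (l * k))) = (l / d) * q" if "k > 0" "d > 0" for k q d l :: real
        using that by simp
      show ?thesis unfolding e1 e2 e3 by (rule gen) (use k1 c(1) in auto)
    qed
    also have "\<dots> \<le> K * \<bar>\<kappa>\<bar> ^ (CARD('n) - 1)" by (rule mult_right_mono) (auto simp: K_def)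
    finally show "(cmod (far_coeff CARD('n) lam pm t))\<^sup>2 \<le> K * (\<Prod>k\<in>UNIV. \<bar>far_scal i (- t / lam) k\<bar>)"
      unfolding \<kappa>_def[symmetric] P .
  qed simp
  then show ?thesis using that[of t0] osc kap by (auto simp: t0_def)
qed

section \<open>Integration by parts and test functions\<close>

abbreviation uword :: "'n \<Rightarrow> 'n \<Rightarrow> nat \<Rightarrow> (real^'n::finite \<Rightarrow> complex) \<Rightarrow> real^'n \<Rightarrow> complex" where
  "uword i j m \<equiv> act_word (replicate m (elem_mat j i))"

abbreviation dilate :: "'n \<Rightarrow> real \<Rightarrow> real^'n::finite \<Rightarrow> real^'n" where
  "dilate i \<kappa> \<equiv> scal (far_scal i \<kappa>)"

text \<open>Translation invariance: over an enlarged box the integral of the shifted function does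
  not depend on a small shift, and its derivative at shift 0 is the integral of the directional
  derivative.\<close>

lemma integral_dd_zero:
  fixes w :: "real^'n::finite \<Rightarrow> complex"
  assumes w: "smooth UNIV w" and z: "\<And>x. x \<notin> cbox a b \<Longrightarrow> w x = 0"
  shows "integral (cbox a b) (dd (axis j 1) w) = 0"
proof -
  let ?e = "axis j 1 :: real^'n"
  define c d where "c = (\<chi> k. a $ k - 1)" and "d = (\<chi> k. b $ k + 1)"
  define I where "I = integral (cbox a b) w"
  have ax: "\<bar>?e $ k\<bar> \<le> 1" for k by (simp add: axis_def)
  have sub: "cbox (a - \<tau> *\<^sub>R ?e) (b - \<tau> *\<^sub>R ?e) \<subseteq> cbox c d" if "\<bar>\<tau>\<bar> \<le> 1" for \<tau>
  proof -
    have "\<bar>\<tau> * ?e $ k\<bar> \<le> 1" for k using mult_mono[OF that ax] by (simp add: abs_mult)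
    then have "- 1 \<le> \<tau> * ?e $ k" "\<tau> * ?e $ k \<le> 1" for k by (auto simp: abs_le_iff minus_le_iff)
    then show ?thesis
      by (intro subsetI) (simp add: mem_box_cart c_def d_def, smt (verit))
  qed
  have wI: "(w has_integral I) (cbox a b)"
    unfolding I_def by (intro integrable_integral integrable_continuous continuous_on_subset[OF smooth_continuous_on[OF w]]) auto
  have const: "integral (cbox c d) (\<lambda>x. w (x + \<tau> *\<^sub>R ?e)) = I" if "\<bar>\<tau>\<bar> \<le> 1" for \<tau>
  proof (rule integral_unique, rule has_integral_on_superset[OF has_integral_shift_cbox[OF wI, of "\<tau> *\<^sub>R ?e"] _ sub[OF that]])
    fix x assume "x \<notin> cbox (a - \<tau> *\<^sub>R ?e) (b - \<tau> *\<^sub>R ?e)"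
    then have "x + \<tau> *\<^sub>R ?e \<notin> cbox a b" by (auto simp: mem_box_cart algebra_simps)
    then show "w (x + \<tau> *\<^sub>R ?e) = 0" by (rule z)
  qed
  have sd: "smooth UNIV (dd ?e w)" by (rule smooth_dd[OF w]) simp
  have "((\<lambda>\<tau>. integral (cbox c d) (\<lambda>x. w (x + \<tau> *\<^sub>R ?e))) has_vector_derivative
      integral (cbox c d) (\<lambda>x. dd ?e w (x + 0 *\<^sub>R ?e))) (at 0 within {-1..1})"
  proof (rule leibniz_rule_vector_derivative[where fx = "\<lambda>\<tau> x. dd ?e w (x + \<tau> *\<^sub>R ?e)"])
    fix \<tau> :: real and x :: "real^'n"
    have "((\<lambda>\<tau>. x + \<tau> *\<^sub>R ?e) has_derivative (\<lambda>h. h *\<^sub>R ?e)) (at \<tau> within {-1..1})"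
      by (auto intro!: derivative_eq_intros)
    from has_derivative_compose[OF this smooth_has_dd[OF w UNIV_I]]
    have D: "((\<lambda>\<tau>. w (x + \<tau> *\<^sub>R ?e)) has_derivative (\<lambda>h. dd (h *\<^sub>R ?e) w (x + \<tau> *\<^sub>R ?e))) (at \<tau> within {-1..1})" .
    moreover have "dd (h *\<^sub>R ?e) w (x + \<tau> *\<^sub>R ?e) = h *\<^sub>R dd ?e w (x + \<tau> *\<^sub>R ?e)" for h
      using linear_scale[OF has_derivative_linear[OF smooth_has_dd[OF w UNIV_I]]] by simp
    ultimately show "((\<lambda>\<tau>. w (x + \<tau> *\<^sub>R ?e)) has_vector_derivative dd ?e w (x + \<tau> *\<^sub>R ?e)) (at \<tau> within {-1..1})"
      by (simp add: has_vector_derivative_def)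
  next
    fix \<tau> :: real
    show "(\<lambda>x. w (x + \<tau> *\<^sub>R ?e)) integrable_on cbox c d"
      by (intro integrable_continuous continuous_on_compose2[OF smooth_continuous_on[OF w]] continuous_intros) auto
  next
    show "continuous_on ({-1..1} \<times> cbox c d) (\<lambda>(\<tau>, x). dd ?e w (x + \<tau> *\<^sub>R ?e))"
      unfolding case_prod_unfold
      by (intro continuous_on_compose2[OF smooth_continuous_on[OF sd]] continuous_intros) auto
  qed auto
  moreover have "((\<lambda>\<tau>. integral (cbox c d) (\<lambda>x. w (x + \<tau> *\<^sub>R ?e))) has_vector_derivative 0) (at 0 within {-1..1})"
    by (rule has_vector_derivative_transform[of 0 _ _ "\<lambda>_. I"]) (use const in auto)
  ultimately have "integral (cbox c d) (\<lambda>x. dd ?e w (x + 0 *\<^sub>R ?e)) = 0"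
    by (intro vector_derivative_unique_within_closed_interval[of "-1" 1 0]) (simp_all only: cbox_interval, auto)
  then have 0: "integral (cbox c d) (dd ?e w) = 0" by simp
  have "((dd ?e w) has_integral integral (cbox a b) (dd ?e w)) (cbox a b)"
    by (intro integrable_integral integrable_continuous continuous_on_subset[OF smooth_continuous_on[OF sd]]) auto
  then have "((dd ?e w) has_integral integral (cbox a b) (dd ?e w)) (cbox c d)"
  proof (rule has_integral_on_superset)
    show "cbox a b \<subseteq> cbox c d" using sub[of 0] by simp
    show "dd ?e w x = 0" if "x \<notin> cbox a b" for x
    proof -
      have "dd ?e w x = dd ?e (\<lambda>_. 0) x"
        by (rule dd_cong[of "- cbox a b"]) (use that z in \<open>auto simp: open_Compl closed_cbox\<close>)
      then show ?thesis by (simp add: dd_def)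
    qed
  qed
  with 0 show ?thesis by (simp add: integral_unique)
qed

text \<open>\<open>u\<^sub>j\<^sub>i\<close> is the field - \<open>x\<^sub>i\<close> times the
  derivative in direction j, whose coefficient is constant in that direction, so it is skew for
  Lebesgue measure. Working with test functions supported in a box off the origin avoids integration
  on the sphere and lets v be singular at 0.\<close>

lemma dpi_parts:
  fixes v \<psi> :: "real^'n::finite \<Rightarrow> complex"
  assumes "i \<noteq> j" and v: "smooth (- {0}) v" and \<psi>: "smooth UNIV \<psi>"
    and z: "\<And>x. x \<notin> cbox a b \<Longrightarrow> \<psi> x = 0" and n0: "0 \<notin> cbox a b"
  shows "integral (cbox a b) (\<lambda>x. dpi (elem_mat j i) v x * \<psi> x) = - integral (cbox a b) (\<lambda>x. v x * dpi (elem_mat j i) \<psi> x)"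
proof -
  let ?U = "elem_mat j i :: real^'n^'n" and ?e = "axis j 1 :: real^'n"
  define w where "w x = of_real (x $ i) * (v x * \<psi> x)" for x
  have w1: "smooth (- {0}) w"
    unfolding w_def[abs_def] by (intro smooth_mult smooth_of_real smooth_nth v smooth_subset[OF \<psi>]) auto
  have w2: "smooth (- cbox a b) w"
    by (rule smooth_cong[OF _ smooth_const[of _ 0]]) (auto simp: w_def z open_Compl closed_cbox)
  have "- {0} \<union> - cbox a b = UNIV" using n0 by auto
  then have w: "smooth UNIV w" using smooth_Un[OF w1 w2] by simp
  have eq: "dpi ?U v x * \<psi> x + v x * dpi ?U \<psi> x = - dd ?e w x" if "x \<in> cbox a b" for x
  proof -
    have x: "x \<in> - {0}" using that n0 by auto
    have "((\<lambda>x. complex_of_real (x $ i)) has_derivative (\<lambda>h. complex_of_real (h $ i))) (at x)"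
      by (intro bounded_linear_imp_has_derivative bounded_linear_compose[OF bounded_linear_of_real bounded_linear_vec_nth])
    from dd_eq[OF has_derivative_mult[OF this has_derivative_mult[OF smooth_has_dd[OF v x] smooth_has_dd[OF \<psi> UNIV_I]]], of ?e]
    have "dd ?e w x = of_real (x $ i) * (v x * dd ?e \<psi> x + dd ?e v x * \<psi> x)"
      using assms(1) by (simp add: w_def[abs_def] axis_def)
    then show ?thesis by (simp add: dpi_elem_mat algebra_simps)
  qed
  have cv: "continuous_on (cbox a b) v" "continuous_on (cbox a b) (dpi ?U v)"
    using n0 by (auto intro!: continuous_on_subset[OF smooth_continuous_on[of "- {0}"]] v smooth_dpi)
  have cp: "continuous_on (cbox a b) \<psi>" "continuous_on (cbox a b) (dpi ?U \<psi>)"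
    by (auto intro!: continuous_on_subset[OF smooth_continuous_on[of UNIV]] \<psi> smooth_dpi)
  have "integral (cbox a b) (\<lambda>x. dpi ?U v x * \<psi> x) + integral (cbox a b) (\<lambda>x. v x * dpi ?U \<psi> x)
      = integral (cbox a b) (\<lambda>x. dpi ?U v x * \<psi> x + v x * dpi ?U \<psi> x)"
    by (rule integral_add[symmetric]) (intro integrable_continuous continuous_intros cv cp)+
  also have "\<dots> = integral (cbox a b) (\<lambda>x. - dd ?e w x)" by (rule integral_cong) (rule eq)
  also have "\<dots> = 0" using integral_dd_zero[OF w, of a b j] z by (simp add: w_def)
  finally show ?thesis by (simp add: add_eq_0_iff)
qed

text \<open>Cauchy-Schwarz against the constant 1, obtained by integrating the square of
  \<open>cmod (v x) - m\<close> with m the mean.\<close>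

lemma integral_norm_le_sqrt:
  fixes v :: "real^'n::finite \<Rightarrow> complex"
  assumes "continuous_on (cbox a b) v" "measure lborel (cbox a b) > 0"
  shows "integral (cbox a b) (\<lambda>x. cmod (v x)) \<le> sqrt (integral (cbox a b) (\<lambda>x. (cmod (v x))\<^sup>2)) * sqrt (measure lborel (cbox a b))"
proof -
  let ?V = "measure lborel (cbox a b)" and ?A = "integral (cbox a b) (\<lambda>x. cmod (v x))"
    and ?Q = "integral (cbox a b) (\<lambda>x. (cmod (v x))\<^sup>2)"
  define m where "m = ?A / ?V"
  have i: "(\<lambda>x. cmod (v x)) integrable_on cbox a b" "(\<lambda>x. (cmod (v x))\<^sup>2) integrable_on cbox a b"
    by (intro integrable_continuous continuous_intros assms)+
  have "((\<lambda>x. (cmod (v x))\<^sup>2 - (2 * m) * cmod (v x) + m\<^sup>2) has_integral (?Q - (2 * m) * ?A + ?V *\<^sub>R m\<^sup>2)) (cbox a b)"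
    by (intro has_integral_add has_integral_diff has_integral_mult_right has_integral_const integrable_integral i)
  then have "0 \<le> ?Q - (2 * m) * ?A + ?V *\<^sub>R m\<^sup>2"
  proof (rule has_integral_nonneg)
    fix x
    have "(cmod (v x))\<^sup>2 - (2 * m) * cmod (v x) + m\<^sup>2 = (cmod (v x) - m)\<^sup>2" by (simp add: power2_diff algebra_simps)
    then show "0 \<le> (cmod (v x))\<^sup>2 - (2 * m) * cmod (v x) + m\<^sup>2" by simp
  qed
  then have "?A\<^sup>2 \<le> ?Q * ?V" using assms(2) by (simp add: m_def field_simps power2_eq_square)
  then have "\<bar>?A\<bar> \<le> sqrt (?Q * ?V)" using real_le_rsqrt real_sqrt_abs real_sqrt_le_iff by metis
  then show ?thesis by (simp add: real_sqrt_mult)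
qed

lemma L2n_ge_cbox:
  fixes v :: "real^'n::finite \<Rightarrow> complex"
  assumes "smooth (- {0}) v" "cbox a b \<subseteq> annulus"
  shows "sqrt (integral (cbox a b) (\<lambda>x. (cmod (v x))\<^sup>2)) \<le> L2n v"
proof -
  have ann: "annulus \<subseteq> - {0::real^'n}" by (auto simp: annulus_def)
  have c: "continuous_on annulus (\<lambda>x. (cmod (v x))\<^sup>2)"
    by (intro continuous_intros continuous_on_subset[OF smooth_continuous_on[OF assms(1)] ann])
  have "annulus = cball (0::real^'n) (exp 1) \<inter> {x. 1 \<le> norm x}" by (auto simp: annulus_def)
  moreover have "compact (cball (0::real^'n) (exp 1) \<inter> {x. 1 \<le> norm x})"
    by (intro compact_Int_closed compact_cball closed_Collect_le continuous_intros)
  ultimately have "compact (annulus :: (real^'n) set)" by simp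
  from borel_integrable_compact[OF this c]
  have "(\<lambda>x. indicator annulus x *\<^sub>R (cmod (v x))\<^sup>2) integrable_on UNIV" by (rule integrable_on_lborel)
  moreover have "(\<lambda>x. indicator annulus x *\<^sub>R (cmod (v x))\<^sup>2) = (\<lambda>x. if x \<in> annulus then (cmod (v x))\<^sup>2 else 0)"
    by (auto simp: indicator_def)
  ultimately have i: "(\<lambda>x. (cmod (v x))\<^sup>2) integrable_on annulus" by (simp only: integrable_restrict_UNIV)
  have "(\<lambda>x. (cmod (v x))\<^sup>2) integrable_on cbox a b"
    by (intro integrable_continuous continuous_on_subset[OF c assms(2)])
  then show ?thesis unfolding L2n_annulus
    by (intro real_sqrt_le_mono integral_subset_le assms(2) i) auto
qed

lemma pairing_bound:
  fixes v \<phi> :: "real^'n::finite \<Rightarrow> complex"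
  assumes "smooth (- {0}) v" "cbox a b \<subseteq> annulus" "measure lborel (cbox a b) > 0"
    "continuous_on (cbox a b) \<phi>" "\<And>x. cmod (\<phi> x) \<le> C"
  shows "cmod (integral (cbox a b) (\<lambda>x. v x * \<phi> x)) \<le> L2n v * sqrt (measure lborel (cbox a b)) * C"
proof -
  have ann: "cbox a b \<subseteq> - {0}" using assms(2) by (auto simp: annulus_def)
  have cv: "continuous_on (cbox a b) v"
    by (rule continuous_on_subset[OF smooth_continuous_on[OF assms(1)] ann])
  have C: "C \<ge> 0" using assms(5) by (meson norm_ge_zero order_trans)
  have "cmod (integral (cbox a b) (\<lambda>x. v x * \<phi> x)) \<le> integral (cbox a b) (\<lambda>x. cmod (v x) * C)"
    by (rule integral_norm_bound_integral)
      (auto intro!: integrable_continuous continuous_intros cv assms(4) simp: norm_mult mult_left_mono assms(5))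
  also have "\<dots> = integral (cbox a b) (\<lambda>x. cmod (v x)) * C" by simp
  also have "\<dots> \<le> (sqrt (integral (cbox a b) (\<lambda>x. (cmod (v x))\<^sup>2)) * sqrt (measure lborel (cbox a b))) * C"
    by (rule mult_right_mono[OF integral_norm_le_sqrt[OF cv assms(3)] C])
  also have "\<dots> \<le> (L2n v * sqrt (measure lborel (cbox a b))) * C"
    by (intro mult_right_mono L2n_ge_cbox assms C) auto
  finally show ?thesis .
qed

text \<open>A negative \<open>d k\<close> reverses the interval, and \<kappa> may have either sign;
  hence \<open>min\<close> and \<open>max\<close>.\<close>

definition dbox :: "('n \<Rightarrow> real) \<Rightarrow> ('n \<Rightarrow> real) \<Rightarrow> ('n \<Rightarrow> real) \<Rightarrow> (real^'n::finite) set" where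
  "dbox d lo hi = cbox (\<chi> k. min (lo k / d k) (hi k / d k)) (\<chi> k. max (lo k / d k) (hi k / d k))"

lemma mem_dbox:
  assumes "\<And>k. d k \<noteq> 0" "\<And>k. lo k \<le> hi k"
  shows "x \<in> dbox d lo hi \<longleftrightarrow> (\<forall>k. lo k \<le> d k * x $ k \<and> d k * x $ k \<le> hi k)"
proof -
  have "(min (l / e) (h / e) \<le> y \<and> y \<le> max (l / e) (h / e)) \<longleftrightarrow> (l \<le> e * y \<and> e * y \<le> h)"
    if "e \<noteq> 0" "l \<le> h" for e l h y :: real
  proof (cases "e > 0")
    case True
    then have "l / e \<le> h / e" using that by (simp add: divide_right_mono)
    then show ?thesis using True by (simp add: min_absorb1 max_absorb2 field_simps)
  next
    case False
    then have e: "e < 0" using that by simp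
    then have "h / e \<le> l / e" using that by (simp add: divide_right_mono_neg)
    then show ?thesis using e by (simp add: min_absorb2 max_absorb1 field_simps) blast
  qed
  then show ?thesis using assms by (simp add: dbox_def mem_box_cart)
qed

lemma measure_dbox:
  fixes d :: "'n::finite \<Rightarrow> real"
  assumes "\<And>k. d k \<noteq> 0" "\<And>k. lo k \<le> hi k"
  shows "measure lborel (dbox d lo hi :: (real^'n) set) = (\<Prod>k\<in>UNIV. (hi k - lo k) / \<bar>d k\<bar>)"
proof -
  have "(\<chi> k. lo k / d k) \<in> dbox d lo hi" using assms by (simp add: mem_dbox)
  then have "measure lborel (dbox d lo hi :: (real^'n) set)
     = (\<Prod>k\<in>UNIV. max (lo k / d k) (hi k / d k) - min (lo k / d k) (hi k / d k))"
    unfolding dbox_def by (subst content_cbox_cart) auto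
  also have "\<dots> = (\<Prod>k\<in>UNIV. (hi k - lo k) / \<bar>d k\<bar>)"
  proof (rule prod.cong[OF refl])
    fix k
    have "max p q - min p q = \<bar>q - p\<bar>" for p q :: real by (simp add: max_def min_def)
    then show "max (lo k / d k) (hi k / d k) - min (lo k / d k) (hi k / d k) = (hi k - lo k) / \<bar>d k\<bar>"
      using assms by (simp add: diff_divide_distrib[symmetric] abs_divide)
  qed
  finally show ?thesis .
qed

text \<open>The ratio of coordinate i to coordinate j lies in [1/5, 1/2]: away from the zeros 0 and
  1 of the phase speed and below 3/4, where the return of \<open>amp\<close> to 0 starts. The
  remaining coordinates stay below coordinate j, so that \<open>tail\<close> is positive.\<close>

definition blo :: "'n \<Rightarrow> 'n \<Rightarrow> 'n \<Rightarrow> real" where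
  "blo i j k = (if k = i then 1 else if k = j then 4 else - 1)"

definition bhi :: "'n \<Rightarrow> 'n \<Rightarrow> 'n \<Rightarrow> real" where
  "bhi i j k = (if k = i then 2 else if k = j then 5 else 1)"

section \<open>The model box and amplitudes supported in it\<close>

definition tbox :: "'n \<Rightarrow> 'n \<Rightarrow> (real^'n::finite) set" where
  "tbox i j = {x. \<forall>k. blo i j k \<le> x $ k \<and> x $ k \<le> bhi i j k}"

definition cls :: "'n \<Rightarrow> 'n \<Rightarrow> (real^'n::finite \<Rightarrow> complex) \<Rightarrow> bool" where
  "cls i j \<beta> \<longleftrightarrow> smooth UNIV \<beta> \<and> (\<forall>x. x \<notin> tbox i j \<longrightarrow> \<beta> x = 0)"

lemma cls_smooth: "cls i j \<beta> \<Longrightarrow> smooth S \<beta>"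
  unfolding cls_def using smooth_subset by blast

lemma blo_less_bhi: "blo i j k < bhi i j k"
  by (simp add: blo_def bhi_def)

lemma tbox_cbox: "tbox i j = cbox (\<chi> k. blo i j k) (\<chi> k. bhi i j k)"
  by (auto simp: tbox_def mem_box_cart)

lemma compact_tbox: "compact (tbox i j)"
  by (simp add: tbox_cbox compact_cbox)

lemma open_compl_tbox: "open (- tbox i j)"
  by (simp add: tbox_cbox open_Compl closed_cbox)

lemma tbox_nth:
  assumes "x \<in> tbox i j" "i \<noteq> j"
  shows "1 \<le> x $ i" "x $ i \<le> 2" "4 \<le> x $ j" "x $ j \<le> 5" "k \<notin> {i, j} \<Longrightarrow> \<bar>x $ k\<bar> \<le> 1"
proof -
  have *: "\<And>k. blo i j k \<le> x $ k" "\<And>k. x $ k \<le> bhi i j k" using assms by (auto simp: tbox_def)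
  show "1 \<le> x $ i" "x $ i \<le> 2" "4 \<le> x $ j" "x $ j \<le> 5"
    using *[of i] *[of j] assms(2) by (auto simp: blo_def bhi_def)
  show "\<bar>x $ k\<bar> \<le> 1" if "k \<notin> {i, j}"
    using *[of k] that by (auto simp: blo_def bhi_def)
qed

lemma open_nth_pos: "open {x::real^'n::finite. x $ j > 0}"
  by (intro open_Collect_less continuous_intros)

lemma pos_Un_compl_tbox: "i \<noteq> j \<Longrightarrow> {x. x $ j > 0} \<union> - tbox i j = UNIV"
  using tbox_nth(3) by fastforce

lemma smooth_cls_glue:
  assumes "i \<noteq> j" "smooth {x. x $ j > 0} F" "\<And>x. x \<notin> tbox i j \<Longrightarrow> F x = 0"
  shows "smooth UNIV (F :: real^'n::finite \<Rightarrow> complex)"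
proof -
  have "smooth (- tbox i j) F"
    by (rule smooth_cong[OF open_compl_tbox smooth_const[of _ 0]]) (use assms in auto)
  from smooth_Un[OF assms(2) this] show ?thesis by (simp only: pos_Un_compl_tbox[OF assms(1)])
qed

lemma cls_bounded:
  assumes "cls i j \<beta>"
  obtains C where "C \<ge> 0" "\<And>x. cmod (\<beta> x) \<le> C"
proof -
  have "compact (\<beta> ` tbox i j)"
    using assms by (intro compact_continuous_image compact_tbox continuous_on_subset[OF smooth_continuous_on[of UNIV]])
      (auto simp: cls_def)
  then obtain C where "\<And>x. x \<in> tbox i j \<Longrightarrow> cmod (\<beta> x) \<le> C"
    using compact_imp_bounded by (force simp: bounded_iff)
  then have "cmod (\<beta> x) \<le> max C 0" for x
    using assms by (cases "x \<in> tbox i j") (auto simp: cls_def le_max_iff_disj)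
  then show ?thesis using that[of "max C 0"] by simp
qed

text \<open>Times - t this is, up to a constant, the phase of the solution in dilated coordinates:
  the logarithm comes from the character and the ratio from \<open>exp (i \<lambda> y)\<close>,
  because \<lambda> \<kappa> = - t.\<close>

definition phase :: "'n \<Rightarrow> 'n \<Rightarrow> real^'n::finite \<Rightarrow> real" where
  "phase i j x = ln (x $ j) + x $ i / x $ j"

text \<open>The derivative of the phase along \<open>x\<^sub>i\<close> times the direction j. With z
  the ratio of the two coordinates it equals z (1 - z); its zeros are the points y = 0 and y =
  \<kappa>.\<close>

definition speed :: "'n \<Rightarrow> 'n \<Rightarrow> real^'n::finite \<Rightarrow> real" where
  "speed i j x = x $ i * (1 / x $ j - x $ i / (x $ j)\<^sup>2)"

text \<open>The phase is opposite to that of the solution, so the product with the solution does not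
  oscillate.\<close>

definition testf :: "'n \<Rightarrow> 'n \<Rightarrow> real \<Rightarrow> real \<Rightarrow> (real^'n::finite \<Rightarrow> complex) \<Rightarrow> real^'n \<Rightarrow> complex" where
  "testf i j t \<kappa> \<beta> x = cis (t * phase i j (dilate i \<kappa> x)) * \<beta> (dilate i \<kappa> x)"

lemma smooth_phase: "smooth {x::real^'n::finite. x $ j > 0} (phase i j)"
  unfolding phase_def[abs_def]
  by (intro smooth_add smooth_compose[OF _ _ smooth_ln] smooth_divide smooth_nth open_nth_pos) auto

lemma smooth_speed: "smooth {x::real^'n::finite. x $ j > 0} (speed i j)"
  unfolding speed_def[abs_def] power2_eq_square
  by (intro smooth_mult smooth_diff smooth_divide smooth_nth smooth_const open_nth_pos) auto

lemma smooth_testf_base: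
  assumes "i \<noteq> j" "cls i j \<beta>"
  shows "smooth UNIV (\<lambda>X. cis (t * phase i j X) * \<beta> X)"
proof (rule smooth_cls_glue[OF assms(1)])
  show "smooth {x. x $ j > 0} (\<lambda>X. cis (t * phase i j X) * \<beta> X)"
    by (intro smooth_mult smooth_compose[OF _ _ smooth_cis] smooth_const smooth_phase open_nth_pos cls_smooth[OF assms(2)]) auto
qed (use assms(2) in \<open>auto simp: cls_def\<close>)

lemma smooth_testf:
  assumes "i \<noteq> j" "cls i j \<beta>"
  shows "smooth UNIV (testf i j t \<kappa> \<beta>)"
  unfolding testf_def[abs_def]
  using smooth_scal[OF open_UNIV smooth_testf_base[OF assms], of "far_scal i \<kappa>" t] by simp

definition tgen_diff :: "'n \<Rightarrow> 'n \<Rightarrow> (real^'n::finite \<Rightarrow> complex) \<Rightarrow> real^'n \<Rightarrow> complex" where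
  "tgen_diff i j \<beta> X = of_real (X $ i) * dd (axis j 1) \<beta> X"

definition tgen_mult :: "'n \<Rightarrow> 'n \<Rightarrow> (real^'n::finite \<Rightarrow> complex) \<Rightarrow> real^'n \<Rightarrow> complex" where
  "tgen_mult i j \<beta> X = \<i> * of_real (speed i j X) * \<beta> X"

lemma cls_tgen_diff: "cls i j \<beta> \<Longrightarrow> cls i j (tgen_diff i j \<beta>)"
  unfolding cls_def tgen_diff_def[abs_def]
proof (intro conjI smooth_mult smooth_of_real smooth_nth smooth_dd allI impI)
  fix x assume H: "smooth UNIV \<beta> \<and> (\<forall>x. x \<notin> tbox i j \<longrightarrow> \<beta> x = 0)" and x: "x \<notin> tbox i j"
  have "dd (axis j 1) \<beta> x = dd (axis j 1) (\<lambda>_. 0) x"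
    by (rule dd_cong[OF open_compl_tbox]) (use x H in auto)
  also have "\<dots> = 0" by (simp add: dd_def)
  finally show "of_real (x $ i) * dd (axis j 1) \<beta> x = 0" by simp
qed auto

lemma cls_tgen_mult:
  assumes "i \<noteq> j" "cls i j \<beta>"
  shows "cls i j (tgen_mult i j \<beta>)"
  unfolding cls_def
proof
  show "smooth UNIV (tgen_mult i j \<beta>)"
  proof (rule smooth_cls_glue[OF assms(1)])
    show "smooth {x. x $ j > 0} (tgen_mult i j \<beta>)"
      unfolding tgen_mult_def[abs_def]
      by (intro smooth_mult smooth_of_real smooth_const smooth_speed open_nth_pos cls_smooth[OF assms(2)])
  qed (use assms(2) in \<open>auto simp: cls_def tgen_mult_def\<close>)
qed (use assms(2) in \<open>auto simp: cls_def tgen_mult_def\<close>)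

lemma has_derivative_phase:
  fixes Y :: "real^'n::finite"
  assumes "Y $ j > 0"
  shows "(phase i j has_derivative (\<lambda>h. h $ j / Y $ j + (h $ i * Y $ j - Y $ i * h $ j) / (Y $ j * Y $ j))) (at Y)"
proof -
  have 1: "((\<lambda>X. X $ k) has_derivative (\<lambda>h. h $ k)) (at Y)" for k
    by (rule bounded_linear_imp_has_derivative[OF bounded_linear_vec_nth])
  have "((\<lambda>X. ln (X $ j)) has_derivative (\<lambda>h. h $ j / Y $ j)) (at Y)"
    using has_derivative_compose[OF 1[of j] DERIV_ln_divide[OF assms, unfolded has_field_derivative_def]] by simp
  moreover have "((\<lambda>X. X $ i / X $ j) has_derivative (\<lambda>h. (h $ i * Y $ j - Y $ i * h $ j) / (Y $ j * Y $ j))) (at Y)"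
    by (rule has_derivative_divide'[OF 1 1]) (use assms in simp)
  ultimately show ?thesis unfolding phase_def[abs_def] by (rule has_derivative_add)
qed

text \<open>Coordinate j is dilated by \<kappa>, so its derivative costs \<kappa>; if it falls on
  the phase it costs a further t. Only that second term matters in the limit.\<close>

lemma dpi_testf:
  fixes i j :: "'n::finite"
  assumes "i \<noteq> j" "cls i j \<beta>"
  shows "dpi (elem_mat j i) (testf i j t \<kappa> \<beta>)
    = (\<lambda>x. of_real (- \<kappa>) * testf i j t \<kappa> (tgen_diff i j \<beta>) x + of_real (- \<kappa> * t) * testf i j t \<kappa> (tgen_mult i j \<beta>) x)"
proof
  fix x :: "real^'n"
  let ?d = "far_scal i \<kappa>"
  let ?X = "scal ?d x"
  let ?F = "\<lambda>X. cis (t * phase i j X) * \<beta> X"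
  have dj: "?d j = \<kappa>" and di: "?d i = 1" using assms(1) by (auto simp: far_scal_def)
  have "?F differentiable (at ?X)"
    by (rule smooth_differentiable[OF smooth_testf_base[OF assms]]) simp
  from dd_scal[OF this, of j]
  have A: "dd (axis j 1) (testf i j t \<kappa> \<beta>) x = \<kappa> *\<^sub>R dd (axis j 1) ?F ?X"
    by (simp add: testf_def[abs_def] dj)
  have B: "of_real (?X $ i) * dd (axis j 1) ?F ?X
     = cis (t * phase i j ?X) * (tgen_diff i j \<beta> ?X + of_real t * tgen_mult i j \<beta> ?X)"
  proof (cases "?X $ j > 0")
    case True
    note ph = has_derivative_phase[OF True, of i]
    let ?p = "\<lambda>h. h $ j / ?X $ j + (h $ i * ?X $ j - ?X $ i * h $ j) / (?X $ j * ?X $ j)"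
    have "((\<lambda>X. \<i> * of_real (t * phase i j X)) has_derivative (\<lambda>h. \<i> * of_real (t * ?p h))) (at ?X)"
      by (intro has_derivative_mult_right has_derivative_of_real ph)
    from has_derivative_cexp[OF this]
    have ci: "((\<lambda>X. cis (t * phase i j X)) has_derivative (\<lambda>h. cis (t * phase i j ?X) * (\<i> * of_real (t * ?p h)))) (at ?X)"
      by (simp add: cis_conv_exp)
    have b: "(\<beta> has_derivative (\<lambda>h. dd h \<beta> ?X)) (at ?X)"
      by (rule smooth_has_dd[of UNIV]) (use assms(2) in \<open>auto simp: cls_def\<close>)
    define v where "v = 1 / ?X $ j - ?X $ i / (?X $ j)\<^sup>2"
    have p: "?p (axis j 1) = v"
      using assms(1) by (simp add: axis_def power2_eq_square v_def)
    have D: "dd (axis j 1) ?F ?X = cis (t * phase i j ?X) * dd (axis j 1) \<beta> ?X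
       + cis (t * phase i j ?X) * (\<i> * of_real (t * v)) * \<beta> ?X"
      using dd_eq[OF has_derivative_mult[OF ci b], of "axis j 1"] unfolding p .
    show ?thesis
      unfolding D tgen_diff_def tgen_mult_def speed_def v_def[symmetric] of_real_mult
      by (simp only: algebra_simps)
  next
    case False
    then have X: "?X \<notin> tbox i j" using tbox_nth(3)[OF _ assms(1), of ?X] by force
    have "dd (axis j 1) ?F ?X = dd (axis j 1) (\<lambda>_. 0) ?X"
      by (rule dd_cong[OF open_compl_tbox]) (use X assms(2) in \<open>auto simp: cls_def\<close>)
    also have "\<dots> = 0" by (simp add: dd_def)
    finally show ?thesis
      using X cls_tgen_diff[OF assms(2)] cls_tgen_mult[OF assms] by (simp add: cls_def)
  qed
  have "dpi (elem_mat j i) (testf i j t \<kappa> \<beta>) x = - of_real \<kappa> * (of_real (?X $ i) * dd (axis j 1) ?F ?X)"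
    by (simp add: dpi_elem_mat A di scaleR_conv_of_real)
  then show "dpi (elem_mat j i) (testf i j t \<kappa> \<beta>) x = of_real (- \<kappa>) * testf i j t \<kappa> (tgen_diff i j \<beta>) x + of_real (- \<kappa> * t) * testf i j t \<kappa> (tgen_mult i j \<beta>) x"
    unfolding B by (simp add: testf_def algebra_simps)
qed

text \<open>Up to a relative error \<open>O(1/t)\<close>, each application of \<open>u\<^sub>j\<^sub>i\<close> to a test function multiplies
  it by the derivative of the phase.\<close>
definition word_est :: "'n \<Rightarrow> 'n \<Rightarrow> nat \<Rightarrow> (real^'n::finite \<Rightarrow> complex) \<Rightarrow> real \<Rightarrow> bool" where
  "word_est i j m \<beta> C \<longleftrightarrow> (\<forall>t \<kappa> x. \<bar>t\<bar> \<ge> 1 \<longrightarrow>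
    cmod (uword i j m (testf i j t \<kappa> \<beta>) x
      - of_real ((- \<kappa> * t) ^ m) * testf i j t \<kappa> (\<lambda>X. (\<i> * of_real (speed i j X)) ^ m * \<beta> X) x) \<le> C * \<bar>\<kappa> * t\<bar> ^ m / \<bar>t\<bar>
    \<and> cmod (uword i j m (testf i j t \<kappa> \<beta>) x) \<le> C * \<bar>\<kappa> * t\<bar> ^ m
    \<and> (dilate i \<kappa> x \<notin> tbox i j \<longrightarrow> uword i j m (testf i j t \<kappa> \<beta>) x = 0))"

lemma word_estD:
  assumes "word_est i j m \<beta> C" "\<bar>t\<bar> \<ge> 1"
  shows "cmod (uword i j m (testf i j t \<kappa> \<beta>) x
      - of_real ((- \<kappa> * t) ^ m) * testf i j t \<kappa> (\<lambda>X. (\<i> * of_real (speed i j X)) ^ m * \<beta> X) x) \<le> C * \<bar>\<kappa> * t\<bar> ^ m / \<bar>t\<bar>"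
    "cmod (uword i j m (testf i j t \<kappa> \<beta>) x) \<le> C * \<bar>\<kappa> * t\<bar> ^ m"
    "dilate i \<kappa> x \<notin> tbox i j \<Longrightarrow> uword i j m (testf i j t \<kappa> \<beta>) x = 0"
  using assms unfolding word_est_def by blast+

text \<open>Expanding letter by letter, only the choice of \<open>tgen_mult\<close> at each letter
  reaches the full size \<bar>\<kappa> t\<bar>^m; each \<open>tgen_diff\<close> loses a factor t.
  The error bound uses the approximation for the \<open>tgen_mult\<close> part and the size bound
  alone for the other.\<close>

lemma testf_word:
  fixes i j :: "'n::finite"
  assumes "i \<noteq> j" "cls i j \<beta>"
  shows "\<exists>C\<ge>0. word_est i j m \<beta> C"
  using assms(2)
proof (induction m arbitrary: \<beta>)
  case 0
  obtain C where "C \<ge> 0" "\<And>x. cmod (\<beta> x) \<le> C" using cls_bounded[OF 0] by metis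
  then show ?case using 0 by (intro exI[of _ C]) (auto simp: word_est_def testf_def norm_mult cls_def)
next
  case (Suc m)
  let ?U = "elem_mat j i :: real^'n^'n"
  let ?W = "uword i j m"
  obtain C1 where C10: "C1 \<ge> 0" and "word_est i j m (tgen_diff i j \<beta>) C1"
    using Suc.IH[OF cls_tgen_diff[OF Suc.prems]] by blast
  note C1 = C10 word_estD(2,3)[OF this(2)]
  obtain C2 where C20: "C2 \<ge> 0" and "word_est i j m (tgen_mult i j \<beta>) C2"
    using Suc.IH[OF cls_tgen_mult[OF assms(1) Suc.prems]] by blast
  note C2 = C20 word_estD(2,3,1)[OF this(2)]
  show ?case
    unfolding word_est_def
  proof (intro exI[of _ "C1 + C2"] conjI allI impI)
    show "0 \<le> C1 + C2" using C1 C2 by simp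
    fix t \<kappa> :: real and x :: "real^'n" assume t: "1 \<le> \<bar>t\<bar>"
    let ?a = "?W (testf i j t \<kappa> (tgen_diff i j \<beta>)) x" and ?b = "?W (testf i j t \<kappa> (tgen_mult i j \<beta>)) x"
    have e: "uword i j (Suc m) (testf i j t \<kappa> \<beta>) x = of_real (- \<kappa>) * ?a + of_real (- \<kappa> * t) * ?b"
    proof -
      have "uword i j (Suc m) (testf i j t \<kappa> \<beta>) x = ?W (dpi ?U (testf i j t \<kappa> \<beta>)) x"
        by (metis act_word_simps(3) replicate_Suc replicate_append_same)
      then show ?thesis
        unfolding dpi_testf[OF assms(1) Suc.prems]
        by (simp only:, intro act_word_add[of UNIV] smooth_testf assms(1) cls_tgen_diff cls_tgen_mult Suc.prems) auto
    qed
    have kt: "\<bar>\<kappa>\<bar> = \<bar>\<kappa> * t\<bar> / \<bar>t\<bar>" using t by (auto simp: abs_mult)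
    have na: "cmod (of_real (- \<kappa>) * ?a) \<le> C1 * \<bar>\<kappa> * t\<bar> ^ Suc m / \<bar>t\<bar>"
    proof -
      have "cmod (of_real (- \<kappa>) * ?a) \<le> \<bar>\<kappa>\<bar> * (C1 * \<bar>\<kappa> * t\<bar> ^ m)"
        unfolding norm_mult by (intro mult_mono C1(2)[OF t]) auto
      also have "\<dots> = C1 * \<bar>\<kappa> * t\<bar> ^ Suc m / \<bar>t\<bar>" by (subst kt) simp
      finally show ?thesis .
    qed
    have nb: "cmod (of_real (- \<kappa> * t) * ?b) \<le> C2 * \<bar>\<kappa> * t\<bar> ^ Suc m"
    proof -
      have "cmod (of_real (- \<kappa> * t) * ?b) \<le> \<bar>\<kappa> * t\<bar> * (C2 * \<bar>\<kappa> * t\<bar> ^ m)"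
        unfolding norm_mult norm_of_real by (intro mult_mono C2(2)[OF t]) auto
      also have "\<dots> = C2 * \<bar>\<kappa> * t\<bar> ^ Suc m" by simp
      finally show ?thesis .
    qed
    have c1: "C1 * \<bar>\<kappa> * t\<bar> ^ Suc m / \<bar>t\<bar> \<le> C1 * \<bar>\<kappa> * t\<bar> ^ Suc m"
    proof -
      have "C1 * \<bar>\<kappa> * t\<bar> ^ Suc m / \<bar>t\<bar> \<le> C1 * \<bar>\<kappa> * t\<bar> ^ Suc m / 1"
        using t C1(1) by (intro divide_left_mono) auto
      then show ?thesis by simp
    qed
    show "cmod (uword i j (Suc m) (testf i j t \<kappa> \<beta>) x) \<le> (C1 + C2) * \<bar>\<kappa> * t\<bar> ^ Suc m"
      
      unfolding e distrib_right by (rule norm_triangle_le) (use na nb c1 in linarith)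
    show "uword i j (Suc m) (testf i j t \<kappa> \<beta>) x = 0" if "dilate i \<kappa> x \<notin> tbox i j"
      unfolding e using C1(3)[OF t that] C2(3)[OF t that] by simp
    let ?main = "of_real ((- \<kappa> * t) ^ m) * testf i j t \<kappa> (\<lambda>X. (\<i> * of_real (speed i j X)) ^ m * tgen_mult i j \<beta> X) x"
    have main: "of_real ((- \<kappa> * t) ^ Suc m) * testf i j t \<kappa> (\<lambda>X. (\<i> * of_real (speed i j X)) ^ Suc m * \<beta> X) x
       = of_real (- \<kappa> * t) * ?main"
      by (simp add: testf_def tgen_mult_def mult_ac)
    have "uword i j (Suc m) (testf i j t \<kappa> \<beta>) x
      - of_real ((- \<kappa> * t) ^ Suc m) * testf i j t \<kappa> (\<lambda>X. (\<i> * of_real (speed i j X)) ^ Suc m * \<beta> X) x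
      = of_real (- \<kappa>) * ?a + of_real (- \<kappa> * t) * (?b - ?main)"
      unfolding e main by (simp add: algebra_simps)
    moreover have "cmod (of_real (- \<kappa> * t) * (?b - ?main)) \<le> C2 * \<bar>\<kappa> * t\<bar> ^ Suc m / \<bar>t\<bar>"
    proof -
      have "cmod (of_real (- \<kappa> * t) * (?b - ?main)) \<le> \<bar>\<kappa> * t\<bar> * (C2 * \<bar>\<kappa> * t\<bar> ^ m / \<bar>t\<bar>)"
        unfolding norm_mult norm_of_real by (intro mult_mono C2(4)[OF t]) auto
      also have "\<dots> = C2 * \<bar>\<kappa> * t\<bar> ^ Suc m / \<bar>t\<bar>" by simp
      finally show ?thesis .
    qed
    ultimately show "cmod (uword i j (Suc m) (testf i j t \<kappa> \<beta>) x
      - of_real ((- \<kappa> * t) ^ Suc m) * testf i j t \<kappa> (\<lambda>X. (\<i> * of_real (speed i j X)) ^ Suc m * \<beta> X) x)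
      \<le> (C1 + C2) * \<bar>\<kappa> * t\<bar> ^ Suc m / \<bar>t\<bar>"
      unfolding distrib_right add_divide_distrib
      by (simp only:) (rule norm_triangle_le, rule add_mono[OF na])
  qed
qed

section \<open>The lower bound\<close>

text \<open>On the box \<open>amp\<close> is 1: with \<bar>\<kappa>\<bar> \<ge> 5 and ratio at least
  1/5 the step is complete, and with ratio at most 3/4 the oscillatory integral has not begun. What
  remains is a product of explicit powers and phases.\<close>

lemma sol_on_box:
  fixes i j :: "'n::finite"
  assumes "i \<noteq> j" "lam \<noteq> 0" "\<kappa> = - t / lam" "\<bar>\<kappa>\<bar> \<ge> 5" and X: "dilate i \<kappa> x \<in> tbox i j"
  shows "sol i j lam pm t x = mc CARD('n) pm t (1 / \<kappa>)
    * of_real (dilate i \<kappa> x $ j powr (- real CARD('n) / 2) * tail i j (dilate i \<kappa> x))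
    * cis (- t * phase i j (dilate i \<kappa> x))"
proof -
  define Y where "Y = dilate i \<kappa> x"
  note b = tbox_nth[OF X assms(1), folded Y_def]
  have k: "\<kappa> \<noteq> 0" using assms(4) by auto
  have xi: "x $ i = Y $ i" by (simp add: Y_def far_scal_def)
  have xk: "x $ k = (1 / \<kappa>) * Y $ k" if "k \<noteq> i" for k using that k by (simp add: Y_def far_scal_def)
  note xj = xk[OF assms(1)[symmetric]]
  define \<eta> where "\<eta> = Y $ i / Y $ j"
  have eta: "1/5 \<le> \<eta>" "\<eta> \<le> 3/4" using b by (auto simp: \<eta>_def field_simps)
  have r: "x $ i / x $ j = \<kappa> * \<eta>" unfolding xi xj using k by (simp add: \<eta>_def)
  have tl: "tail i j x = tail i j Y"
    unfolding tail_def by (intro prod.cong refl) (use xj xk k in auto)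
  have "1 \<le> sgn \<kappa> * (\<kappa> * \<eta>)"
  proof -
    have "5 * (1/5) \<le> \<bar>\<kappa>\<bar> * \<eta>" using assms(4) eta by (intro mult_mono) auto
    also have "\<bar>\<kappa>\<bar> * \<eta> = sgn \<kappa> * (\<kappa> * \<eta>)" by (simp add: sgn_if abs_if)
    finally show ?thesis by simp
  qed
  then have amp: "amp lam t (\<kappa> * \<eta>) = 1"
    unfolding amp_def assms(3)[symmetric] using k eta by (simp add: step_1 oscint_0)
  have lk: "lam * (\<kappa> * \<eta>) = - t * \<eta>" using assms(2,3) by simp
  have "sol i j lam pm t x = mc CARD('n) pm t ((1 / \<kappa>) * Y $ j) * (cis (- t * \<eta>) * of_real (tail i j Y))"
  proof -
    have "scal (\<lambda>_. 1) x = x" by (simp add: vec_eq_iff)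
    then show ?thesis
      unfolding sol_def wfun_def sol_sym_def by (simp only: r amp lk tl mult_1_right) (simp only: xj)
  qed
  also have "mc CARD('n) pm t ((1 / \<kappa>) * Y $ j) = mc CARD('n) pm t (1 / \<kappa>) * mc CARD('n) pm t (Y $ j)"
    using k b by (intro mc_mult) auto
  also have "mc CARD('n) pm t (Y $ j) = of_real (Y $ j powr (- real CARD('n) / 2)) * cis (- t * ln (Y $ j))"
    using b by (intro mc_pos) auto
  also have "mc CARD('n) pm t (1 / \<kappa>) * (of_real (Y $ j powr (- real CARD('n) / 2)) * cis (- t * ln (Y $ j))) * (cis (- t * \<eta>) * of_real (tail i j Y))
     = mc CARD('n) pm t (1 / \<kappa>) * of_real (Y $ j powr (- real CARD('n) / 2) * tail i j Y) * (cis (- t * ln (Y $ j)) * cis (- t * \<eta>))"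
    by simp
  also have "cis (- t * ln (Y $ j)) * cis (- t * \<eta>) = cis (- t * phase i j Y)"
    unfolding cis_mult phase_def \<eta>_def by (simp add: algebra_simps)
  finally show ?thesis unfolding Y_def .
qed

definition bfun :: "'n \<Rightarrow> 'n \<Rightarrow> real^'n::finite \<Rightarrow> real" where
  "bfun i j x = (\<Prod>k\<in>UNIV. bump (blo i j k) (bhi i j k) (x $ k))"

lemma cls_bfun: "cls i j (\<lambda>x. of_real (bfun i j x))"
  unfolding cls_def
proof (intro conjI allI impI)
  show "smooth UNIV (\<lambda>x. complex_of_real (bfun i j x))"
    unfolding bfun_def by (intro smooth_of_real smooth_prod smooth_compose[OF _ _ smooth_bump] smooth_nth) auto
  fix x assume "x \<notin> tbox i j"
  then obtain k where "\<not> (blo i j k \<le> x $ k \<and> x $ k \<le> bhi i j k)" by (auto simp: tbox_def)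
  then have "bump (blo i j k) (bhi i j k) (x $ k) = 0" by (intro bump_0) auto
  then have "bfun i j x = 0" unfolding bfun_def by (intro prod_zero) auto
  then show "complex_of_real (bfun i j x) = 0" by simp
qed

text \<open>The modulus of the solution on the box, apart from the constant modulus of the character
  at 1 / \<kappa>.\<close>

definition wt0 :: "'n \<Rightarrow> 'n \<Rightarrow> real^'n::finite \<Rightarrow> real" where
  "wt0 i j X = X $ j powr (- real CARD('n) / 2) * tail i j X"

definition wt :: "'n \<Rightarrow> 'n \<Rightarrow> nat \<Rightarrow> real^'n::finite \<Rightarrow> real" where
  "wt i j m X = wt0 i j X * (speed i j X ^ m * bfun i j X)"

lemma continuous_wt0: "i \<noteq> j \<Longrightarrow> continuous_on (tbox i j) (wt0 i j)"
  unfolding wt0_def[abs_def]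
  by (intro continuous_intros continuous_on_subset[OF smooth_continuous_on[OF smooth_tail]])
    (auto dest: tbox_nth(3))

lemma continuous_wt: "i \<noteq> j \<Longrightarrow> continuous_on (tbox i j) (wt i j m)"
  unfolding wt_def[abs_def]
proof (intro continuous_intros continuous_wt0)
  assume ij: "i \<noteq> j"
  show "continuous_on (tbox i j) (speed i j)"
    by (rule continuous_on_subset[OF smooth_continuous_on[OF smooth_speed]]) (use ij in \<open>auto dest: tbox_nth(3)\<close>)
  have "smooth UNIV (bfun i j)"
    unfolding bfun_def[abs_def] by (intro smooth_prod smooth_compose[OF _ _ smooth_bump] smooth_nth) auto
  then show "continuous_on (tbox i j) (bfun i j)"
    using smooth_continuous_on continuous_on_subset by blast
qed

lemma speed_pos:
  assumes "x \<in> tbox i j" "i \<noteq> j"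
  shows "speed i j x > 0"
proof -
  note b = tbox_nth[OF assms]
  have "1 / x $ j - x $ i / (x $ j)\<^sup>2 = (x $ j - x $ i) / (x $ j)\<^sup>2"
    using b by (simp add: field_simps power2_eq_square)
  moreover have "(x $ j - x $ i) / (x $ j)\<^sup>2 > 0" using b by (intro divide_pos_pos) auto
  ultimately show ?thesis unfolding speed_def using b by simp
qed

lemma tail_nonneg: "tail i j x \<ge> 0"
  unfolding tail_def by (intro prod_nonneg bump_nonneg ballI)

lemma wt_nonneg: "x \<in> tbox i j \<Longrightarrow> i \<noteq> j \<Longrightarrow> wt i j m x \<ge> 0"
  unfolding wt_def wt0_def bfun_def using speed_pos[of x i j]
  by (intro mult_nonneg_nonneg tail_nonneg prod_nonneg zero_le_power) (auto simp: bump_nonneg)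

text \<open>The amplitude vanishes on the boundary of the box, so a positive lower bound is
  available only on a smaller concentric one; here each side is halved.\<close>

definition blo' :: "'n \<Rightarrow> 'n \<Rightarrow> 'n \<Rightarrow> real" where
  "blo' i j k = blo i j k + (bhi i j k - blo i j k) / 4"

definition bhi' :: "'n \<Rightarrow> 'n \<Rightarrow> 'n \<Rightarrow> real" where
  "bhi' i j k = bhi i j k - (bhi i j k - blo i j k) / 4"

lemma inner_bounds: "blo i j k < blo' i j k" "blo' i j k < bhi' i j k" "bhi' i j k < bhi i j k"
  using blo_less_bhi[of i j k] by (simp_all add: blo'_def bhi'_def field_simps)

lemma wt_lower:
  assumes "i \<noteq> j"
  obtains \<epsilon> where "\<epsilon> > 0" "\<And>x. (\<And>k. blo' i j k \<le> x $ k \<and> x $ k \<le> bhi' i j k) \<Longrightarrow> \<epsilon> \<le> wt i j m x"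
proof -
  let ?S = "cbox (\<chi> k. blo' i j k) (\<chi> k. bhi' i j k)"
  have mem: "x \<in> ?S \<longleftrightarrow> (\<forall>k. blo' i j k \<le> x $ k \<and> x $ k \<le> bhi' i j k)" for x
    by (auto simp: mem_box_cart)
  have sub: "?S \<subseteq> tbox i j"
  proof
    fix x assume x: "x \<in> ?S"
    have "blo i j k \<le> x $ k \<and> x $ k \<le> bhi i j k" for k
    proof -
      have "blo' i j k \<le> x $ k" "x $ k \<le> bhi' i j k" using x mem by blast+
      then show ?thesis using inner_bounds[of i j k] by linarith
    qed
    then show "x \<in> tbox i j" by (simp add: tbox_def)
  qed
  have "(\<chi> k. blo' i j k) \<in> ?S" by (simp add: mem less_imp_le[OF inner_bounds(2)])
  then have "?S \<noteq> {}" by blast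
  then obtain x0 where x0: "x0 \<in> ?S" "\<And>x. x \<in> ?S \<Longrightarrow> wt i j m x0 \<le> wt i j m x"
    using continuous_attains_inf[OF compact_cbox _ continuous_on_subset[OF continuous_wt[OF assms] sub]] by metis
  have "wt i j m x0 > 0"
  proof -
    have x0b: "x0 \<in> tbox i j" using x0 sub by auto
    note b = tbox_nth[OF x0b assms]
    have "bfun i j x0 > 0"
      unfolding bfun_def
    proof (intro prod_pos ballI bump_pos)
      fix k
      show "blo i j k < x0 $ k" "x0 $ k < bhi i j k"
        using x0(1) inner_bounds[of i j k] mem by (meson less_le_trans le_less_trans)+
    qed
    moreover have "tail i j x0 > 0"
      unfolding tail_def
    proof (intro prod_pos ballI bump_pos)
      fix k assume "k \<in> - {i, j}"
      then have "\<bar>x0 $ k\<bar> < x0 $ j" using b(3) b(5)[of k] by auto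
      then have "\<bar>x0 $ k / x0 $ j\<bar> < 1" using b(3) by (simp add: abs_divide)
      then show "- 1 < x0 $ k / x0 $ j" "x0 $ k / x0 $ j < 1" by linarith+
    qed
    ultimately show ?thesis
      unfolding wt_def wt0_def using speed_pos[OF x0b assms] b by (intro mult_pos_pos zero_less_power) auto
  qed
  then show ?thesis using that[of "wt i j m x0"] x0(2) mem by blast
qed

definition tdom :: "'n \<Rightarrow> 'n \<Rightarrow> real \<Rightarrow> (real^'n::finite) set" where
  "tdom i j \<kappa> = dbox (far_scal i \<kappa>) (blo i j) (bhi i j)"

lemma far_scal_neq: "\<kappa> \<noteq> 0 \<Longrightarrow> far_scal i \<kappa> k \<noteq> 0"
  by (simp add: far_scal_def)

lemma mem_tdom: "\<kappa> \<noteq> 0 \<Longrightarrow> x \<in> tdom i j \<kappa> \<longleftrightarrow> dilate i \<kappa> x \<in> tbox i j"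
  unfolding tdom_def by (subst mem_dbox) (auto simp: far_scal_neq tbox_def less_imp_le[OF blo_less_bhi])

lemma exp1_ge: "exp 1 \<ge> (5/2::real)"
  using exp_lower_Taylor_quadratic[of "1::real"] by simp

text \<open>Coordinate i alone lies in [1, 2]. The others are at most 5 / \<bar>\<kappa>\<bar> \<le>
  1 / (2 n) and add at most 1/2, so the norm stays below 5/2 < e. This is where the factor 10 n
  comes from.\<close>

lemma tdom_annulus:
  fixes i j :: "'n::finite"
  assumes "i \<noteq> j" "\<bar>\<kappa>\<bar> \<ge> 10 * real CARD('n)"
  shows "tdom i j \<kappa> \<subseteq> (annulus :: (real^'n) set)"
proof
  fix x :: "real^'n" assume x: "x \<in> tdom i j \<kappa>"
  have N: "real CARD('n) \<ge> 1" by (simp add: Suc_leI)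
  have k: "\<kappa> \<noteq> 0" "\<bar>\<kappa>\<bar> > 0" using assms(2) N by auto
  let ?X = "dilate i \<kappa> x"
  have X: "?X \<in> tbox i j" using x k by (simp add: mem_tdom)
  note b = tbox_nth[OF X assms(1)]
  have xi: "1 \<le> x $ i" "x $ i \<le> 2" using b by (auto simp: far_scal_def)
  have xk: "\<bar>x $ k\<bar> \<le> 1 / (2 * real CARD('n))" if "k \<noteq> i" for k
  proof -
    have "\<bar>?X $ k\<bar> \<le> 5" using b(3,4) b(5)[of k] that by (cases "k = j") auto
    then have "\<bar>\<kappa>\<bar> * \<bar>x $ k\<bar> \<le> 5" using that by (simp add: far_scal_def abs_mult)
    moreover have "(10 * real CARD('n)) * \<bar>x $ k\<bar> \<le> \<bar>\<kappa>\<bar> * \<bar>x $ k\<bar>"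
      using assms(2) by (intro mult_right_mono) auto
    ultimately show ?thesis using N by (simp add: field_simps)
  qed
  have "1 \<le> norm x" using component_le_norm_cart[of x i] xi by simp
  moreover have "norm x \<le> exp 1"
  proof -
    have "norm x \<le> (\<Sum>k\<in>UNIV. \<bar>x $ k\<bar>)" by (rule norm_le_l1_cart)
    also have "\<dots> = \<bar>x $ i\<bar> + (\<Sum>k\<in>UNIV - {i}. \<bar>x $ k\<bar>)" by (rule sum.remove) auto
    also have "\<dots> \<le> 2 + (\<Sum>k\<in>UNIV - {i}. 1 / (2 * real CARD('n)))"
      using xi xk by (intro add_mono sum_mono) auto
    also have "(\<Sum>k\<in>UNIV - {i}. 1 / (2 * real CARD('n))) \<le> (\<Sum>k\<in>(UNIV::'n set). 1 / (2 * real CARD('n)))"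
      by (rule sum_mono2) auto
    also have "\<dots> = 1 / 2" using N by simp
    finally show ?thesis using exp1_ge by linarith
  qed
  ultimately show "x \<in> annulus" by (simp add: annulus_def)
qed

text \<open>All sides of the undilated box have length at least 1, and n - 1 of them are divided by
  \<bar>\<kappa>\<bar>; the inner box halves all n sides.\<close>

lemma measure_tdom:
  fixes i j :: "'n::finite"
  assumes "\<kappa> \<noteq> 0"
  shows "measure lborel (tdom i j \<kappa> :: (real^'n) set) > 0"
    "measure lborel (tdom i j \<kappa> :: (real^'n) set) \<ge> 1 / \<bar>\<kappa>\<bar> ^ (CARD('n) - 1)"
    "measure lborel (dbox (far_scal i \<kappa>) (blo' i j) (bhi' i j) :: (real^'n) set)
      = measure lborel (tdom i j \<kappa> :: (real^'n) set) / 2 ^ CARD('n)"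
proof -
  let ?d = "far_scal i \<kappa>"
  note ne = far_scal_neq[OF assms, of i]
  have m: "measure lborel (tdom i j \<kappa> :: (real^'n) set) = (\<Prod>k\<in>UNIV. (bhi i j k - blo i j k) / \<bar>?d k\<bar>)"
    unfolding tdom_def by (rule measure_dbox) (auto simp: ne less_imp_le[OF blo_less_bhi])
  show "measure lborel (tdom i j \<kappa> :: (real^'n) set) > 0"
    unfolding m using blo_less_bhi ne by (intro prod_pos ballI divide_pos_pos) auto
  have "1 / \<bar>\<kappa>\<bar> ^ (CARD('n) - 1) = (\<Prod>k\<in>UNIV. 1 / \<bar>?d k\<bar>)"
  proof -
    have "(\<Prod>k\<in>UNIV. 1 / \<bar>?d k\<bar>) = 1 / \<bar>?d i\<bar> * (\<Prod>k\<in>UNIV - {i}. 1 / \<bar>?d k\<bar>)"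
      by (rule prod.remove) auto
    also have "(\<Prod>k\<in>UNIV - {i}. 1 / \<bar>?d k\<bar>) = (\<Prod>k\<in>UNIV - {i}. 1 / \<bar>\<kappa>\<bar>)"
      by (intro prod.cong) (auto simp: far_scal_def)
    also have "1 / \<bar>?d i\<bar> * (\<Prod>k\<in>UNIV - {i}. 1 / \<bar>\<kappa>\<bar>) = 1 / \<bar>\<kappa>\<bar> ^ (CARD('n) - 1)"
      by (simp add: far_scal_def card_Diff_singleton power_one_over)
    finally show ?thesis by (rule sym)
  qed
  also have "\<dots> \<le> (\<Prod>k\<in>UNIV. (bhi i j k - blo i j k) / \<bar>?d k\<bar>)"
    using ne by (intro prod_mono) (auto simp: blo_def bhi_def divide_right_mono)
  finally show "measure lborel (tdom i j \<kappa> :: (real^'n) set) \<ge> 1 / \<bar>\<kappa>\<bar> ^ (CARD('n) - 1)" unfolding m .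
  have "measure lborel (dbox ?d (blo' i j) (bhi' i j) :: (real^'n) set) = (\<Prod>k\<in>UNIV. (bhi' i j k - blo' i j k) / \<bar>?d k\<bar>)"
    by (rule measure_dbox) (auto simp: ne less_imp_le[OF inner_bounds(2)])
  also have "\<dots> = (\<Prod>k\<in>UNIV. ((bhi i j k - blo i j k) / \<bar>?d k\<bar>) / 2)"
  proof (intro prod.cong refl)
    fix k
    have h: "bhi' i j k - blo' i j k = (bhi i j k - blo i j k) / 2" by (simp add: blo'_def bhi'_def field_simps)
    show "(bhi' i j k - blo' i j k) / \<bar>?d k\<bar> = ((bhi i j k - blo i j k) / \<bar>?d k\<bar>) / 2" unfolding h by simp
  qed
  also have "\<dots> = measure lborel (tdom i j \<kappa> :: (real^'n) set) / 2 ^ CARD('n)"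
    unfolding m prod_dividef by simp
  finally show "measure lborel (dbox (far_scal i \<kappa>) (blo' i j) (bhi' i j) :: (real^'n) set)
      = measure lborel (tdom i j \<kappa> :: (real^'n) set) / 2 ^ CARD('n)" .
qed

section \<open>Pairing the solution with oscillating test functions\<close>

definition ftest :: "'n \<Rightarrow> 'n \<Rightarrow> real \<Rightarrow> real \<Rightarrow> real^'n::finite \<Rightarrow> complex" where
  "ftest i j t \<kappa> = testf i j t \<kappa> (\<lambda>x. of_real (bfun i j x))"

definition regime :: "nat \<Rightarrow> real \<Rightarrow> real \<Rightarrow> real \<Rightarrow> bool" where
  "regime N lam t \<kappa> \<longleftrightarrow> \<kappa> = - t / lam \<and> \<bar>\<kappa>\<bar> \<ge> 10 * real N \<and> oscint t 2 \<noteq> 0"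

text \<open>The opposite phases cancel, so up to the error in \<open>word_est\<close> the integrand
  is one complex constant times the nonnegative weight \<open>wt\<close>. The error is smaller by a
  factor t and is absorbed for large t.\<close>

lemma pairing_lower:
  fixes i j :: "'n::finite"
  assumes "i \<noteq> j" "lam \<noteq> 0"
  shows "\<exists>c>0. \<exists>t1\<ge>1. \<forall>t \<kappa> pm. \<bar>t\<bar> \<ge> t1 \<longrightarrow> regime CARD('n) lam t \<kappa> \<longrightarrow>
    c * \<bar>\<kappa>\<bar> powr (CARD('n) / 2) * \<bar>\<kappa> * t\<bar> ^ m * measure lborel (tdom i j \<kappa> :: (real^'n) set)
    \<le> cmod (integral (tdom i j \<kappa>) (\<lambda>x. sol i j lam pm t x * uword i j m (ftest i j t \<kappa>) x))"
proof -
  obtain C where C: "C \<ge> 0" and est: "word_est i j m (\<lambda>x. of_real (bfun i j x)) C"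
    using testf_word[OF assms(1) cls_bfun] by blast
  obtain \<epsilon> where eps: "\<epsilon> > 0" "\<And>x. (\<And>k. blo' i j k \<le> x $ k \<and> x $ k \<le> bhi' i j k) \<Longrightarrow> \<epsilon> \<le> wt i j m x"
    using wt_lower[OF assms(1), of m] by metis
  have "compact (wt0 i j ` tbox i j)"
    by (rule compact_continuous_image[OF continuous_wt0[OF assms(1)] compact_tbox])
  then obtain C0 where C0: "\<And>x. x \<in> tbox i j \<Longrightarrow> \<bar>wt0 i j x\<bar> \<le> C0"
    using compact_imp_bounded by (force simp: bounded_iff)
  define D where "D = max C0 0 * C"
  \<comment> \<open>Half of the main term per unit volume: the inner box has the fraction 1 / 2^n of
    the volume and carries weight at least \<epsilon>. The other half pays for the error, which is
    at most c once \<bar>t\<bar> \<ge> D / c.\<close>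
  define c where "c = \<epsilon> / 2 ^ CARD('n) / 2"
  have c: "c > 0" using eps by (simp add: c_def)
  show ?thesis
  proof (rule exI[of _ c], rule conjI[OF c], rule exI[of _ "max 1 (D / c)"], rule conjI[OF max.cobounded1], intro allI impI)
    fix t \<kappa> pm
    assume t: "max 1 (D / c) \<le> \<bar>t\<bar>" and "regime CARD('n) lam t \<kappa>"
    then have kap: "\<kappa> = - t / lam" and kN: "\<bar>\<kappa>\<bar> \<ge> 10 * real CARD('n)" and osc: "oscint t 2 \<noteq> 0"
      by (auto simp: regime_def)
    have N: "real CARD('n) \<ge> 1" by (simp add: Suc_leI)
    have k5: "\<bar>\<kappa>\<bar> \<ge> 5" using kN N by linarith
    then have k: "\<kappa> \<noteq> 0" "\<bar>\<kappa>\<bar> \<ge> 5" by auto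
    have t1: "\<bar>t\<bar> \<ge> 1" and tD: "D / \<bar>t\<bar> \<le> c"
    proof -
      show t1: "\<bar>t\<bar> \<ge> 1" using t by simp
      have "D / c \<le> \<bar>t\<bar>" using t by simp
      then show "D / \<bar>t\<bar> \<le> c" using t1 c by (simp add: field_simps)
    qed
    let ?Q = "tdom i j \<kappa> :: (real^'n) set" and ?D = "dilate i \<kappa>" and ?T = "\<bar>\<kappa> * t\<bar> ^ m"
      and ?p = "\<bar>\<kappa>\<bar> powr (CARD('n) / 2)" and ?V = "measure lborel (tdom i j \<kappa> :: (real^'n) set)"
    let ?W = "uword i j m (ftest i j t \<kappa>)"
    define a where "a = mc CARD('n) pm t (1 / \<kappa>) * (of_real ((- \<kappa> * t) ^ m) * \<i> ^ m)"
    have nm: "cmod (mc CARD('n) pm t (1 / \<kappa>)) = ?p"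
    proof -
      have "\<bar>1 / \<kappa>\<bar> = \<bar>\<kappa>\<bar> powr (- 1)" using k by (simp add: powr_minus_divide)
      moreover have "(\<bar>\<kappa>\<bar> powr (- 1)) powr (- real CARD('n) / 2) = ?p" unfolding powr_powr by simp
      moreover have "cmod (mc CARD('n) pm t (1 / \<kappa>)) = \<bar>1 / \<kappa>\<bar> powr (- real CARD('n) / 2)"
        by (rule norm_mc) (use k in simp)
      ultimately show ?thesis by (simp only:)
    qed
    have na: "cmod a = ?p * ?T"
      unfolding a_def norm_mult nm norm_power norm_of_real by (simp add: power_abs abs_mult)
    define G where "G x = sol i j lam pm t x * ?W x" for x
    define H where "H x = a * of_real (wt i j m (?D x))" for x
    have GH: "cmod (G x - H x) \<le> ?p * ?T * c" if x: "x \<in> ?Q" for x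
    proof -
      have X: "?D x \<in> tbox i j" using x k by (simp add: mem_tdom)
      define err where "err = ?W x - of_real ((- \<kappa> * t) ^ m) * testf i j t \<kappa> (\<lambda>X. (\<i> * of_real (speed i j X)) ^ m * of_real (bfun i j X)) x"
      have err: "cmod err \<le> C * ?T / \<bar>t\<bar>"
        unfolding err_def ftest_def by (rule word_estD(1)[OF est t1])
      let ?A = "mc CARD('n) pm t (1 / \<kappa>)" and ?c = "cis (- t * phase i j (?D x))"
      have s: "sol i j lam pm t x = ?A * of_real (wt0 i j (?D x)) * ?c"
        unfolding wt0_def by (rule sol_on_box[OF assms kap k(2) X])
      have cc: "?c * cis (t * phase i j (?D x)) = 1" by (simp add: cis_mult)
      have "G x = ?A * of_real (wt0 i j (?D x)) * ?c * (of_real ((- \<kappa> * t) ^ m) * (cis (t * phase i j (?D x)) * ((\<i> * of_real (speed i j (?D x))) ^ m * of_real (bfun i j (?D x)))) + err)"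
        unfolding G_def s err_def testf_def by simp
      also have "\<dots> = ?A * of_real (wt0 i j (?D x)) * (of_real ((- \<kappa> * t) ^ m) * ((?c * cis (t * phase i j (?D x))) * ((\<i> * of_real (speed i j (?D x))) ^ m * of_real (bfun i j (?D x)))))
          + ?A * of_real (wt0 i j (?D x)) * ?c * err"
        by (simp only: algebra_simps)
      also have "\<dots> = H x + ?A * of_real (wt0 i j (?D x)) * ?c * err"
        unfolding cc H_def a_def wt_def by (simp add: power_mult_distrib mult_ac)
      finally have "cmod (G x - H x) = ?p * \<bar>wt0 i j (?D x)\<bar> * cmod err"
        by (simp add: norm_mult nm)
      also have "\<dots> \<le> ?p * max C0 0 * (C * ?T / \<bar>t\<bar>)"
        using C0[OF X] err by (intro mult_mono mult_left_mono) auto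
      also have "\<dots> = ?p * ?T * (D / \<bar>t\<bar>)" by (simp add: D_def)
      also have "\<dots> \<le> ?p * ?T * c" using tD by (intro mult_left_mono) auto
      finally show ?thesis .
    qed
    have Qn: "?Q \<subseteq> annulus" by (rule tdom_annulus[OF assms(1) kN])
    then have Q0: "?Q \<subseteq> - {0}" by (auto simp: annulus_def)
    have sW: "smooth UNIV ?W"
      unfolding ftest_def by (intro smooth_act_word smooth_testf assms(1) cls_bfun) auto
    have t0: "- t / lam \<noteq> 0" using k kap by simp
    have sS: "smooth (- {0}) (sol i j lam pm t)"
      using sol_ind_smooth[OF assms(1) t0 osc, of pm] by (simp add: ind_smooth_def smooth_off0_iff)
    have Gi: "G integrable_on ?Q"
      unfolding G_def[abs_def] tdom_def dbox_def
      by (intro integrable_continuous continuous_intros)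
        (use Q0 in \<open>auto simp: tdom_def dbox_def intro: continuous_on_subset[OF smooth_continuous_on[OF sW]] continuous_on_subset[OF smooth_continuous_on[OF sS]]\<close>)
    have wc: "continuous_on ?Q (\<lambda>x. wt i j m (?D x))"
      by (rule continuous_on_compose2[OF continuous_wt[OF assms(1)] linear_continuous_on[OF bounded_linear_scal]])
        (use k in \<open>auto simp: mem_tdom\<close>)
    have wi: "(\<lambda>x. wt i j m (?D x)) integrable_on ?Q"
      using wc unfolding tdom_def dbox_def by (rule integrable_continuous)
    have Hi: "H integrable_on ?Q"
      unfolding H_def[abs_def] using wc unfolding tdom_def dbox_def by (intro integrable_continuous continuous_intros)
    have IH: "integral ?Q H = a * of_real (integral ?Q (\<lambda>x. wt i j m (?D x)))"
      unfolding H_def[abs_def]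
      using integral_linear[OF wi bounded_linear_compose[OF bounded_linear_mult_right[of a] bounded_linear_of_real]]
      by (simp add: o_def)
    let ?Q' = "dbox (far_scal i \<kappa>) (blo' i j) (bhi' i j) :: (real^'n) set"
    have memQ': "x \<in> ?Q' \<longleftrightarrow> (\<forall>l. blo' i j l \<le> ?D x $ l \<and> ?D x $ l \<le> bhi' i j l)" for x
      by (subst mem_dbox) (auto simp: far_scal_neq k less_imp_le[OF inner_bounds(2)])
    have Q'Q: "?Q' \<subseteq> ?Q"
    proof
      fix x assume "x \<in> ?Q'"
      then have "blo i j l \<le> ?D x $ l \<and> ?D x $ l \<le> bhi i j l" for l
        using memQ'[of x] inner_bounds[of i j l] by (meson less_imp_le order_trans)
      then show "x \<in> ?Q" unfolding mem_tdom[OF k(1)] tbox_def by blast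
    qed
    have "\<epsilon> * (?V / 2 ^ CARD('n)) = integral ?Q' (\<lambda>x. \<epsilon>)"
      unfolding measure_tdom(3)[OF k(1), of i j, symmetric] dbox_def by simp
    also have "\<dots> \<le> integral ?Q' (\<lambda>x. wt i j m (?D x))"
    proof (rule integral_le)
      show "(\<lambda>x. \<epsilon>) integrable_on ?Q'" unfolding dbox_def by (rule integrable_const)
      show "(\<lambda>x. wt i j m (?D x)) integrable_on ?Q'"
        using continuous_on_subset[OF wc Q'Q] unfolding dbox_def by (rule integrable_continuous)
      show "\<epsilon> \<le> wt i j m (?D x)" if "x \<in> ?Q'" for x using eps(2) that memQ' by blast
    qed
    also have "\<dots> \<le> integral ?Q (\<lambda>x. wt i j m (?D x))"
    proof (rule integral_subset_le[OF Q'Q _ wi])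
      show "(\<lambda>x. wt i j m (?D x)) integrable_on ?Q'"
        using continuous_on_subset[OF wc Q'Q] unfolding dbox_def by (rule integrable_continuous)
      show "\<forall>x\<in>?Q. 0 \<le> wt i j m (?D x)"
        using k assms by (auto simp: mem_tdom intro!: wt_nonneg)
    qed
    finally have "2 * c * ?V \<le> integral ?Q (\<lambda>x. wt i j m (?D x))" by (simp add: c_def)
    then have "?p * ?T * (2 * c * ?V) \<le> ?p * ?T * \<bar>integral ?Q (\<lambda>x. wt i j m (?D x))\<bar>"
      by (intro mult_left_mono) auto
    also have "\<dots> = cmod (integral ?Q H)" unfolding IH norm_mult na by simp
    also have "\<dots> \<le> cmod (integral ?Q G) + cmod (integral ?Q (\<lambda>x. G x - H x))"
    proof -
      have "integral ?Q (\<lambda>x. G x - H x) = integral ?Q G - integral ?Q H" by (rule integral_diff[OF Gi Hi])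
      then show ?thesis using norm_triangle_sub[of "integral ?Q H" "integral ?Q G"] by (simp add: norm_minus_commute)
    qed
    also have "cmod (integral ?Q (\<lambda>x. G x - H x)) \<le> (?p * ?T * c) * ?V"
    proof -
      have "cmod (integral ?Q (\<lambda>x. G x - H x)) \<le> integral ?Q (\<lambda>x. ?p * ?T * c)"
        by (rule integral_norm_bound_integral[OF integrable_diff[OF Gi Hi] _ GH])
          (auto simp: tdom_def dbox_def)
      then show ?thesis unfolding tdom_def dbox_def by (simp add: mult_ac)
    qed
    finally show "c * ?p * ?T * ?V \<le> cmod (integral ?Q (\<lambda>x. sol i j lam pm t x * ?W x))"
      unfolding G_def[abs_def] by (simp add: algebra_simps)
  qed
qed

lemma parts_iter:
  fixes v \<phi> :: "real^'n::finite \<Rightarrow> complex"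
  assumes "i \<noteq> j" "smooth (- {0}) v" "smooth UNIV \<phi>" "\<And>x. x \<notin> cbox a b \<Longrightarrow> \<phi> x = 0" "0 \<notin> cbox a b"
  shows "integral (cbox a b) (\<lambda>x. uword i j m v x * \<phi> x)
    = (-1) ^ m * integral (cbox a b) (\<lambda>x. v x * uword i j m \<phi> x)"
  using assms(3,4)
proof (induction m arbitrary: \<phi>)
  case (Suc m)
  let ?U = "elem_mat j i :: real^'n^'n"
  have z: "dpi ?U \<phi> x = 0" if "x \<notin> cbox a b" for x
    by (rule dpi_zero_nbhd[of "- cbox a b"]) (use Suc.prems(2) that in \<open>auto simp: open_Compl closed_cbox\<close>)
  have "integral (cbox a b) (\<lambda>x. uword i j (Suc m) v x * \<phi> x)
     = integral (cbox a b) (\<lambda>x. dpi ?U (uword i j m v) x * \<phi> x)" by simp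
  also have "\<dots> = - integral (cbox a b) (\<lambda>x. uword i j m v x * dpi ?U \<phi> x)"
    by (rule dpi_parts) (use assms Suc.prems in \<open>auto intro: smooth_act_word\<close>)
  also have "\<dots> = - ((-1) ^ m * integral (cbox a b) (\<lambda>x. v x * uword i j m (dpi ?U \<phi>) x))"
    by (subst Suc.IH) (use z Suc.prems in \<open>auto intro: smooth_dpi\<close>)
  also have "uword i j m (dpi ?U \<phi>) = uword i j (Suc m) \<phi>"
    by (metis act_word_simps(3) replicate_Suc replicate_append_same)
  finally show ?case by simp
qed simp

lemma dpi_funpow: "(dpi U ^^ k) F = act_word (replicate k U) F"
  by (induction k) auto

lemma opnorm_int_nonneg: "0 \<le> opnorm_int U k F"
  unfolding opnorm_int_def by (intro real_sqrt_ge_zero sum_nonneg) auto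

lemma opnorm_int_zero: "opnorm_int U k (\<lambda>_. 0) = 0"
  by (simp add: opnorm_int_def dpi_funpow)

lemma opnorm_int_ge: "L2n (act_word (replicate k U) F) \<le> opnorm_int U k F"
proof -
  have "real (k choose k) * (L2n ((dpi U ^^ k) F))\<^sup>2 \<le> (\<Sum>m\<le>k. real (k choose m) * (L2n ((dpi U ^^ m) F))\<^sup>2)"
    by (rule member_le_sum[where f = "\<lambda>m. real (k choose m) * (L2n ((dpi U ^^ m) F))\<^sup>2"]) auto
  then show ?thesis unfolding opnorm_int_def
    by (intro real_le_rsqrt) (simp add: dpi_funpow)
qed

text \<open>The solution is paired with k + 1 letters applied to the test function. For v0, k
  letters move over and one stays, costing \<bar>\<kappa> t\<bar>; for v1 all k + 1 move over. After
  division by this cost both terms appear in the ratio that \<open>interp_ge\<close> needs with T =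
  \<bar>\<kappa> t\<bar>.\<close>

lemma decomposition_lower:
  fixes i j :: "'n::finite"
  assumes "i \<noteq> j" "lam \<noteq> 0"
  shows "\<exists>c>0. \<exists>t1\<ge>1. \<forall>t (\<kappa>::real) pm v0 v1. \<bar>t\<bar> \<ge> t1 \<longrightarrow> regime CARD('n) lam t \<kappa> \<longrightarrow>
    v0 \<in> ind_smooth pm t \<longrightarrow> v1 \<in> ind_smooth pm t \<longrightarrow> (\<lambda>x. v0 x + v1 x) = sol i j lam pm t \<longrightarrow>
    c * sqrt \<bar>\<kappa>\<bar> * \<bar>\<kappa> * t\<bar> ^ k
      \<le> opnorm_int (elem_mat j i) k v0 + opnorm_int (elem_mat j i) (Suc k) v1 / \<bar>\<kappa> * t\<bar>"
proof -
  obtain c t1 where c: "c > 0" "t1 \<ge> 1" and low: "\<And>t \<kappa> pm. \<bar>t\<bar> \<ge> t1 \<Longrightarrow> regime CARD('n) lam t \<kappa> \<Longrightarrow>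
    c * \<bar>\<kappa>\<bar> powr (CARD('n) / 2) * \<bar>\<kappa> * t\<bar> ^ Suc k * measure lborel (tdom i j \<kappa> :: (real^'n) set)
    \<le> cmod (integral (tdom i j \<kappa>) (\<lambda>x. sol i j lam pm t x * uword i j (Suc k) (ftest i j t \<kappa>) x))"
    using pairing_lower[OF assms, of "Suc k"] by blast
  obtain C0 where C0: "C0 \<ge> 0" and e0: "word_est i j 0 (\<lambda>x. of_real (bfun i j x)) C0"
    using testf_word[OF assms(1) cls_bfun] by blast
  obtain C1 where C1: "C1 \<ge> 0" and e1: "word_est i j 1 (\<lambda>x. of_real (bfun i j x)) C1"
    using testf_word[OF assms(1) cls_bfun] by blast
  define D where "D = C0 + C1 + 1"
  have D: "D > 0" "C0 \<le> D" "C1 \<le> D" using C0 C1 by (auto simp: D_def)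
  show ?thesis
  proof (rule exI[of _ "c / D"], rule conjI[OF divide_pos_pos[OF c(1) D(1)]],
      rule exI[of _ t1], rule conjI[OF c(2)], intro allI impI)
    fix t \<kappa> pm and v0 v1 :: "real^'n \<Rightarrow> complex"
    assume t: "\<bar>t\<bar> \<ge> t1" and reg: "regime CARD('n) lam t \<kappa>"
      and v0: "v0 \<in> ind_smooth pm t" and v1: "v1 \<in> ind_smooth pm t" and sum: "(\<lambda>x. v0 x + v1 x) = sol i j lam pm t"
    let ?U = "elem_mat j i :: real^'n^'n" and ?Q = "tdom i j \<kappa> :: (real^'n) set" and ?V = "measure lborel (tdom i j \<kappa> :: (real^'n) set)"
    let ?T = "\<bar>\<kappa> * t\<bar>" and ?p = "\<bar>\<kappa>\<bar> powr (CARD('n) / 2)" and ?\<psi> = "ftest i j t \<kappa>"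
    have N: "real CARD('n) \<ge> 1" by (simp add: Suc_leI)
    have kN: "\<bar>\<kappa>\<bar> \<ge> 10 * real CARD('n)" using reg unfolding regime_def by blast
    then have k0: "\<kappa> \<noteq> 0" using N by auto
    have t1: "\<bar>t\<bar> \<ge> 1" using t c by simp
    have T: "?T > 0" using k0 t1 by auto
    define qa where "qa = (\<chi> l. min (blo i j l / far_scal i \<kappa> l) (bhi i j l / far_scal i \<kappa> l))"
    define qb where "qb = (\<chi> l. max (blo i j l / far_scal i \<kappa> l) (bhi i j l / far_scal i \<kappa> l))"
    have Q: "?Q = cbox qa qb" by (simp add: tdom_def dbox_def qa_def qb_def)
    have ann: "cbox qa qb \<subseteq> annulus" using tdom_annulus[OF assms(1) kN] by (simp add: Q)
    then have n0: "0 \<notin> cbox qa qb" by (auto simp: annulus_def)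
    have V: "?V > 0" by (rule measure_tdom(1)[OF k0])
    have s0: "smooth (- {0}) v0" "smooth (- {0}) v1"
      using v0 v1 by (auto simp: ind_smooth_def smooth_off0_iff)
    have sp: "smooth UNIV ?\<psi>" unfolding ftest_def by (rule smooth_testf[OF assms(1) cls_bfun])
    have sp1: "smooth UNIV (dpi ?U ?\<psi>)" by (intro smooth_dpi sp) auto
    have z0: "?\<psi> x = 0" if "x \<notin> cbox qa qb" for x
    proof -
      have "dilate i \<kappa> x \<notin> tbox i j" using that unfolding Q[symmetric] mem_tdom[OF k0] .
      then show ?thesis using word_estD(3)[OF e0 t1] by (simp add: ftest_def)
    qed
    have z1: "dpi ?U ?\<psi> x = 0" if "x \<notin> cbox qa qb" for x
      by (rule dpi_zero_nbhd[of "- cbox qa qb"]) (use z0 that in \<open>auto simp: open_Compl closed_cbox\<close>)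
    have b0: "cmod (?\<psi> x) \<le> D" for x
      using word_estD(2)[OF e0 t1, of \<kappa> x] D by (simp add: ftest_def)
    have b1: "cmod (dpi ?U ?\<psi> x) \<le> D * ?T" for x
    proof -
      have "cmod (dpi ?U ?\<psi> x) \<le> C1 * ?T" using word_estD(2)[OF e1 t1, of \<kappa> x] by (simp add: ftest_def)
      also have "\<dots> \<le> D * ?T" using D by (intro mult_right_mono) auto
      finally show ?thesis .
    qed
    let ?W = "uword i j (Suc k) ?\<psi>"
    have sW: "smooth UNIV ?W" by (intro smooth_act_word sp) auto
    have cW: "continuous_on (cbox qa qb) ?W"
      by (rule continuous_on_subset[OF smooth_continuous_on[OF sW]]) auto
    have cv: "continuous_on (cbox qa qb) v0" "continuous_on (cbox qa qb) v1"
      using n0 by (auto intro!: continuous_on_subset[OF smooth_continuous_on[of "- {0}"]] s0)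
    have W1: "uword i j k (dpi ?U ?\<psi>) = ?W"
      by (metis act_word_simps(3) replicate_Suc replicate_append_same)
    have "integral (cbox qa qb) (\<lambda>x. uword i j k v0 x * dpi ?U ?\<psi> x)
        = (-1) ^ k * integral (cbox qa qb) (\<lambda>x. v0 x * ?W x)"
      using parts_iter[OF assms(1) s0(1) sp1 z1 n0, of k] unfolding W1 .
    then have "cmod (integral (cbox qa qb) (\<lambda>x. v0 x * ?W x))
        = cmod (integral (cbox qa qb) (\<lambda>x. uword i j k v0 x * dpi ?U ?\<psi> x))"
      by (simp add: norm_mult norm_power)
    also have "\<dots> \<le> L2n (uword i j k v0) * sqrt ?V * (D * ?T)"
      unfolding Q by (rule pairing_bound[OF smooth_act_word[OF _ s0(1)] ann _ _ b1])
        (use V continuous_on_subset[OF smooth_continuous_on[OF sp1]] in \<open>auto simp: Q open_Compl\<close>)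
    finally have I0: "cmod (integral (cbox qa qb) (\<lambda>x. v0 x * ?W x)) \<le> L2n (uword i j k v0) * sqrt ?V * (D * ?T)" .
    have "integral (cbox qa qb) (\<lambda>x. uword i j (Suc k) v1 x * ?\<psi> x)
        = (-1) ^ Suc k * integral (cbox qa qb) (\<lambda>x. v1 x * ?W x)"
      by (rule parts_iter[OF assms(1) s0(2) sp z0 n0])
    then have "cmod (integral (cbox qa qb) (\<lambda>x. v1 x * ?W x))
        = cmod (integral (cbox qa qb) (\<lambda>x. uword i j (Suc k) v1 x * ?\<psi> x))"
      by (simp only: norm_mult norm_power) simp
    also have "\<dots> \<le> L2n (uword i j (Suc k) v1) * sqrt ?V * D"
      unfolding Q by (rule pairing_bound[OF smooth_act_word[OF _ s0(2)] ann _ _ b0])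
        (use V continuous_on_subset[OF smooth_continuous_on[OF sp]] in \<open>auto simp: Q open_Compl\<close>)
    finally have I1: "cmod (integral (cbox qa qb) (\<lambda>x. v1 x * ?W x)) \<le> L2n (uword i j (Suc k) v1) * sqrt ?V * D" .
    have "integral (cbox qa qb) (\<lambda>x. sol i j lam pm t x * ?W x)
        = integral (cbox qa qb) (\<lambda>x. v0 x * ?W x + v1 x * ?W x)"
      unfolding sum[symmetric] by (simp only: distrib_right)
    also have "\<dots> = integral (cbox qa qb) (\<lambda>x. v0 x * ?W x) + integral (cbox qa qb) (\<lambda>x. v1 x * ?W x)"
      by (rule integral_add) (intro integrable_continuous continuous_on_mult cv cW)+
    finally have "cmod (integral (cbox qa qb) (\<lambda>x. sol i j lam pm t x * ?W x))
       \<le> L2n (uword i j k v0) * sqrt ?V * (D * ?T) + L2n (uword i j (Suc k) v1) * sqrt ?V * D"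
      using norm_triangle_mono[OF I0 I1] by simp
    also have "\<dots> \<le> opnorm_int ?U k v0 * sqrt ?V * (D * ?T) + opnorm_int ?U (Suc k) v1 * sqrt ?V * D"
      using D T V by (intro add_mono mult_right_mono opnorm_int_ge) auto
    finally have "c * ?p * ?T ^ Suc k * ?V \<le> opnorm_int ?U k v0 * sqrt ?V * (D * ?T) + opnorm_int ?U (Suc k) v1 * sqrt ?V * D"
      using low[OF t reg, of pm] unfolding Q by (rule order_trans[rotated])
    also have "\<dots> = (D * ?T * sqrt ?V) * (opnorm_int ?U k v0 + opnorm_int ?U (Suc k) v1 / ?T)"
      using T by (simp add: field_simps)
    also have "c * ?p * ?T ^ Suc k * ?V = (D * ?T * sqrt ?V) * (c / D * (?p * sqrt ?V) * ?T ^ k)"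
    proof -
      have "?V = sqrt ?V * sqrt ?V" using V by simp
      then show ?thesis using D by (simp add: field_simps)
    qed
    finally have main: "c / D * (?p * sqrt ?V) * ?T ^ k \<le> opnorm_int ?U k v0 + opnorm_int ?U (Suc k) v1 / ?T"
      using D T V by (subst (asm) mult_le_cancel_left_pos) auto
    \<comment> \<open>The character contributes n half-powers of \<bar>\<kappa>\<bar>, while the
      root of the volume removes only n - 1, one for each dilated direction. The half-power left
      over is the 1/2 in the exponent 2 s + 1/2.\<close>
    have "sqrt \<bar>\<kappa>\<bar> \<le> ?p * sqrt ?V"
    proof -
      have kp: "\<bar>\<kappa>\<bar> > 0" using k0 by simp
      have "?p\<^sup>2 = \<bar>\<kappa>\<bar> powr (real CARD('n))" by (simp add: power2_eq_square powr_add[symmetric])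
      also have "\<dots> = \<bar>\<kappa>\<bar> ^ CARD('n)" using kp by (simp add: powr_realpow)
      also have "\<dots> = \<bar>\<kappa>\<bar> * \<bar>\<kappa>\<bar> ^ (CARD('n) - 1)"
        by (metis power_Suc Suc_diff_1 zero_less_card_finite)
      finally have p2: "?p\<^sup>2 = \<bar>\<kappa>\<bar> * \<bar>\<kappa>\<bar> ^ (CARD('n) - 1)" .
      have "\<bar>\<kappa>\<bar> = ?p\<^sup>2 * (1 / \<bar>\<kappa>\<bar> ^ (CARD('n) - 1))" unfolding p2 using kp by simp
      also have "\<dots> \<le> ?p\<^sup>2 * ?V" by (rule mult_left_mono[OF measure_tdom(2)[OF k0]]) simp
      finally have "sqrt \<bar>\<kappa>\<bar> \<le> sqrt (?p\<^sup>2 * ?V)" by simp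
      then show ?thesis by (simp add: real_sqrt_mult)
    qed
    then have "c / D * sqrt \<bar>\<kappa>\<bar> * ?T ^ k \<le> c / D * (?p * sqrt ?V) * ?T ^ k"
      using c D by (intro mult_right_mono mult_left_mono) auto
    with main show "c / D * sqrt \<bar>\<kappa>\<bar> * ?T ^ k \<le> opnorm_int ?U k v0 + opnorm_int ?U (Suc k) v1 / ?T" by simp
  qed
qed

theorem theorem10p1:
  fixes i j :: "'n::{finite,linorder}"
    and B :: "(real^('n::{finite,linorder})^('n::{finite,linorder})) set" and s \<sigma> lam :: real
  assumes "CARD('n) \<ge> 2"
    and "sl_basis B"
    and "j < i"
    and "s \<ge> 0" and "0 \<le> \<sigma>" and "\<sigma> < s + 1/2"
    and "lam \<noteq> 0"
  shows "\<forall>C>0. \<exists>\<delta>>0. \<forall>t pm. \<bar>t\<bar> > \<delta> \<longrightarrow>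
           (\<exists>f g. f \<in> ind_smooth pm t \<and> g \<in> ind_smooth pm t \<and>
              g = (\<lambda>x. dpi (elem_mat i j) f x + \<i> * complex_of_real lam * f x) \<and>
              opnorm (elem_mat j i) pm t s f > C * sob B pm t (s + \<sigma>) g)"
proof (intro allI impI)
  fix C :: real assume C: "C > 0"
  have ij: "i \<noteq> j" using assms(3) by auto
  obtain t0 where t0: "t0 \<ge> 1" and tame: "\<And>t0'. t0' \<ge> t0 \<Longrightarrow> tame t0' (rhs i j lam)"
    and osc: "\<And>t. \<bar>t\<bar> \<ge> t0 \<Longrightarrow> oscint t 2 \<noteq> 0" and kN: "\<And>t. \<bar>t\<bar> \<ge> t0 \<Longrightarrow> \<bar>- t / lam\<bar> \<ge> 10 * real CARD('n)"
    using tame_rhs[OF ij assms(7)] by metis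
  have kne: "- t / lam \<noteq> 0" if "\<bar>t\<bar> \<ge> t0" for t using that t0 assms(7) by auto
  obtain C2 where C2: "C2 \<ge> 0" and up: "\<And>pm t. \<bar>t\<bar> \<ge> t0 \<Longrightarrow> sob B pm t (s + \<sigma>) (rhs i j lam pm t) \<le> C2 * \<bar>t\<bar> powr (s + \<sigma>)"
    using sob_bound[OF tame[OF order_refl] t0, of "s + \<sigma>" B] rhs_ind_smooth[OF ij kne] assms(4,5) by auto
  let ?U = "elem_mat j i"
  obtain c t1 where c: "c > 0" "t1 \<ge> 1" and dec: "\<And>t \<kappa> pm v0 v1. \<bar>t\<bar> \<ge> t1 \<Longrightarrow> regime CARD('n) lam t \<kappa> \<Longrightarrow>
    v0 \<in> ind_smooth pm t \<Longrightarrow> v1 \<in> ind_smooth pm t \<Longrightarrow> (\<lambda>x. v0 x + v1 x) = sol i j lam pm t \<Longrightarrow>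
    c * sqrt \<bar>\<kappa>\<bar> * \<bar>\<kappa> * t\<bar> ^ nat \<lfloor>s\<rfloor>
      \<le> opnorm_int ?U (nat \<lfloor>s\<rfloor>) v0 + opnorm_int ?U (Suc (nat \<lfloor>s\<rfloor>)) v1 / \<bar>\<kappa> * t\<bar>"
    using decomposition_lower[OF ij assms(7), of "nat \<lfloor>s\<rfloor>"] by blast
  define K where "K = interp_lower s"
  have K: "K > 0" using interp_lower_pos[OF assms(4)] by (simp add: K_def)
  define c3 where "c3 = K * c * (1 / sqrt \<bar>lam\<bar>) * (1 / \<bar>lam\<bar>) powr s"
  have c3: "c3 > 0" using K c assms(7) by (simp add: c3_def)
  \<comment> \<open>The gap between the exponents 2 s + 1/2 and s + \<sigma>. As it is positive,
    \<open>\<bar>t\<bar> powr a\<close> eventually exceeds every constant; the last entry of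
    \<delta> is the point at which it reaches C C2 / c3.\<close>
  define a where "a = s + 1/2 - \<sigma>"
  have a: "a > 0" using assms(6) by (simp add: a_def)
  define \<delta> where "\<delta> = max (max t0 t1) ((C * C2 / c3) powr (1 / a))"
  show "\<exists>\<delta>>0. \<forall>t pm. \<bar>t\<bar> > \<delta> \<longrightarrow>
           (\<exists>f g. f \<in> ind_smooth pm t \<and> g \<in> ind_smooth pm t \<and>
              g = (\<lambda>x. dpi (elem_mat i j) f x + \<i> * complex_of_real lam * f x) \<and>
              opnorm (elem_mat j i) pm t s f > C * sob B pm t (s + \<sigma>) g)"
  proof (intro exI[of _ \<delta>] conjI allI impI)
    show "\<delta> > 0" using t0 by (simp add: \<delta>_def)
    fix t pm assume "\<bar>t\<bar> > \<delta>"
    then have t: "\<bar>t\<bar> \<ge> t0" "\<bar>t\<bar> \<ge> t1" and td: "\<bar>t\<bar> > (C * C2 / c3) powr (1 / a)" by (auto simp: \<delta>_def)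
    have tp: "\<bar>t\<bar> > 0" using t t0 by auto
    define \<kappa> where "\<kappa> = - t / lam"
    \<comment> \<open>This scale is quadratic in t, which is why the s-th power contributes 2 s to
      the exponent.\<close>
    have kt: "\<bar>\<kappa> * t\<bar> = (1 / \<bar>lam\<bar>) * (\<bar>t\<bar> * \<bar>t\<bar>)" by (simp add: \<kappa>_def abs_mult abs_divide)
    have kt0: "\<bar>\<kappa> * t\<bar> > 0" unfolding kt by (intro mult_pos_pos) (use tp assms(7) in auto)
    have lower: "K * (c * sqrt \<bar>\<kappa>\<bar>) * \<bar>\<kappa> * t\<bar> powr s \<le> opnorm ?U pm t s (sol i j lam pm t)"
      unfolding opnorm_def
      unfolding K_def
    proof (rule interp_ge[OF assms(4)])
      show "sol i j lam pm t \<in> ind_smooth pm t" by (rule sol_ind_smooth[OF ij kne[OF t(1)] osc[OF t(1)]])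
      have "regime CARD('n) lam t \<kappa>" using kN[OF t(1)] osc[OF t(1)] by (simp add: regime_def \<kappa>_def)
      from dec[OF t(2) this] show "c * sqrt \<bar>\<kappa>\<bar> * \<bar>\<kappa> * t\<bar> ^ nat \<lfloor>s\<rfloor>
        \<le> opnorm_int ?U (nat \<lfloor>s\<rfloor>) v0 + opnorm_int ?U (Suc (nat \<lfloor>s\<rfloor>)) v1 / \<bar>\<kappa> * t\<bar>"
        if "v0 \<in> ind_smooth pm t" "v1 \<in> ind_smooth pm t" "(\<lambda>x. v0 x + v1 x) = sol i j lam pm t" for v0 v1
        using that by blast
    qed (use zero_in_ind_smooth opnorm_int_zero opnorm_int_nonneg kt0 c in auto)
    have "sqrt \<bar>\<kappa>\<bar> = (1 / sqrt \<bar>lam\<bar>) * \<bar>t\<bar> powr (1/2)"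
      using tp by (simp add: \<kappa>_def abs_divide real_sqrt_divide powr_half_sqrt)
    moreover have "\<bar>\<kappa> * t\<bar> powr s = (1 / \<bar>lam\<bar>) powr s * (\<bar>t\<bar> powr s * \<bar>t\<bar> powr s)"
      unfolding kt by (simp only: powr_mult abs_ge_zero mult_nonneg_nonneg zero_le_divide_1_iff)
    ultimately have "K * (c * sqrt \<bar>\<kappa>\<bar>) * \<bar>\<kappa> * t\<bar> powr s = c3 * (\<bar>t\<bar> powr (1/2) * \<bar>t\<bar> powr s * \<bar>t\<bar> powr s)"
      by (simp only:) (simp add: c3_def)
    also have "\<bar>t\<bar> powr (1/2) * \<bar>t\<bar> powr s * \<bar>t\<bar> powr s = \<bar>t\<bar> powr a * \<bar>t\<bar> powr (s + \<sigma>)"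
      unfolding powr_add[symmetric] by (simp add: a_def algebra_simps)
    finally have lower': "c3 * \<bar>t\<bar> powr a * \<bar>t\<bar> powr (s + \<sigma>) \<le> opnorm ?U pm t s (sol i j lam pm t)"
      using lower by (simp only: mult.assoc)
    have "C * C2 / c3 = ((C * C2 / c3) powr (1 / a)) powr a" 
      using a C C2 c3 by (simp add: powr_powr)
    also have "\<dots> < \<bar>t\<bar> powr a" using td a by (intro powr_less_mono2) auto
    finally have "C * C2 < c3 * \<bar>t\<bar> powr a" using c3 by (simp add: field_simps)
    then have "C * C2 * \<bar>t\<bar> powr (s + \<sigma>) < c3 * \<bar>t\<bar> powr a * \<bar>t\<bar> powr (s + \<sigma>)"
      using tp by (intro mult_strict_right_mono) auto
    moreover have "C * sob B pm t (s + \<sigma>) (rhs i j lam pm t) \<le> C * (C2 * \<bar>t\<bar> powr (s + \<sigma>))"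
      using up[OF t(1)] C by (intro mult_left_mono) auto
    ultimately have "C * sob B pm t (s + \<sigma>) (rhs i j lam pm t) < opnorm ?U pm t s (sol i j lam pm t)"
      using lower' by simp
    moreover have "t \<noteq> 0" using tp by simp
    ultimately show "\<exists>f g. f \<in> ind_smooth pm t \<and> g \<in> ind_smooth pm t \<and>
              g = (\<lambda>x. dpi (elem_mat i j) f x + \<i> * complex_of_real lam * f x) \<and>
              opnorm (elem_mat j i) pm t s f > C * sob B pm t (s + \<sigma>) g"
      using sol_ind_smooth[OF ij kne[OF t(1)] osc[OF t(1)], of pm] rhs_ind_smooth[OF ij kne[OF t(1)], of pm]
        solution_equation[OF ij _ assms(7) osc[OF t(1)], of pm]
      by (intro exI[of _ "sol i j lam pm t"] exI[of _ "rhs i j lam pm t"]) auto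
  qed
qed

end
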